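(* The Kadison-Singer Problem has a positive solution if and only if the following statement holds: there exist universal constants $\delta,\epsilon$ with $0<\delta$ and $\sqrt{\delta}\le\epsilon<1$, and $r\in\mathbb N$, such that for all $n$ and all orthogonal projections $P$ on $\ell_2^n$ with $\delta(P)\le\delta$ and $\|Pe_i\|=\|Pe_j\|$ for all $i,j=1,2,\dots,n$, there is a partition $\{A_j\}_{j=1}^r$ of $\{1,2,\dots,n\}$ such that $\|Q_{A_j}PQ_{A_j}\|\le 1-\epsilon$ for all $j=1,2,\dots,r$.
   Context: Kadison-Singer Problem (KS): does every pure state on the (abelian) von Neumann algebra $\mathbb D$ of bounded diagonal operators on $\ell_2$ have a unique extension to a (pure) state on $B(\ell_2)$, the von Neumann algebra of all bounded linear operators on $\ell_2$? A state of a von Neumann algebra $\mathcal R$ is a linear functional $f$ with $f(I)=1$ and $f(T)\ge0$ whenever $T\ge0$; a pure state is an extreme point of the convex set of states. A positive solution to KS means the answer is yes. $\ell_2^n$ is the complex $n$-dimensional Hilbert space with fixed orthonormal basis $\{e_i\}_{i=1}^n$. For $A\subset\{1,\dots,n\}$, $Q_A$ is the diagonal projection onto the coordinates in $A$. For a matrix (operator) $P=(p_{ij})$, $\delta(P)=\max_i|p_{ii}|$. *)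

theory Defs
  imports
    "HOL-Analysis.Inner_Product"
    "HOL-Analysis.L2_Norm"
    "HOL-Library.Complex_Order"
    "HOL-Library.Disjoint_Sets"
    "Jordan_Normal_Form.Schur_Decomposition"
begin

section \<open>The complex Hilbert space of square-summable sequences\<close>

typedef ell2 = "{x :: nat \<Rightarrow> complex. summable (\<lambda>n. (cmod (x n))\<^sup>2)}"
  morphisms coord Abs_ell2
  by (rule exI[of _ "\<lambda>_. 0"]) simp

setup_lifting type_definition_ell2

lemma ell2_mult_le: "2 * (cmod a * cmod b) \<le> (cmod a)\<^sup>2 + (cmod b)\<^sup>2"
  using sum_squares_bound[of "cmod a" "cmod b"] by (simp add: mult.assoc)

lemma summable_mult_cnj:
  assumes "summable (\<lambda>n. (cmod (x n))\<^sup>2)" and "summable (\<lambda>n. (cmod (y n))\<^sup>2)"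
  shows "summable (\<lambda>n. x n * cnj (y n))"
proof (rule summable_comparison_test'[where N = 0])
  show "summable (\<lambda>n. (cmod (x n))\<^sup>2 + (cmod (y n))\<^sup>2)"
    using assms by (rule summable_add)
  show "norm (x n * cnj (y n)) \<le> (cmod (x n))\<^sup>2 + (cmod (y n))\<^sup>2" for n
  proof -
    have "0 \<le> cmod (x n) * cmod (y n)" by simp
    with ell2_mult_le[of "x n" "y n"]
    have "cmod (x n) * cmod (y n) \<le> (cmod (x n))\<^sup>2 + (cmod (y n))\<^sup>2" by linarith
    thus ?thesis by (simp add: norm_mult)
  qed
qed

lemma summable_ell2_add:
  assumes "summable (\<lambda>n. (cmod (x n))\<^sup>2)" and "summable (\<lambda>n. (cmod (y n))\<^sup>2)"
  shows "summable (\<lambda>n. (cmod (x n + y n))\<^sup>2)"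
proof (rule summable_comparison_test'[where N = 0])
  show "summable (\<lambda>n. 2 * (cmod (x n))\<^sup>2 + 2 * (cmod (y n))\<^sup>2)"
    using assms by (intro summable_add summable_mult)
  show "norm ((cmod (x n + y n))\<^sup>2) \<le> 2 * (cmod (x n))\<^sup>2 + 2 * (cmod (y n))\<^sup>2" for n
  proof -
    have "(cmod (x n + y n))\<^sup>2 \<le> (cmod (x n) + cmod (y n))\<^sup>2"
      by (rule power_mono[OF norm_triangle_ineq]) simp
    also have "\<dots> \<le> 2 * (cmod (x n))\<^sup>2 + 2 * (cmod (y n))\<^sup>2"
      using ell2_mult_le[of "x n" "y n"] by (simp add: power2_sum)
    finally show ?thesis by simp
  qed
qed

lemma summable_ell2_scale:
  assumes "summable (\<lambda>n. (cmod (x n))\<^sup>2)"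
  shows "summable (\<lambda>n. (cmod (c * x n))\<^sup>2)"
  using summable_mult[OF assms, of "(cmod c)\<^sup>2"] by (simp add: norm_mult power_mult_distrib)

lift_definition scaleC :: "complex \<Rightarrow> ell2 \<Rightarrow> ell2" is "\<lambda>c x n. c * x n"
  by (rule summable_ell2_scale)

text \<open>The inner product is linear in its first argument.\<close>

lift_definition cinner :: "ell2 \<Rightarrow> ell2 \<Rightarrow> complex" is "\<lambda>x y. \<Sum>n. x n * cnj (y n)" .

instantiation ell2 :: real_vector
begin

lift_definition zero_ell2 :: ell2 is "\<lambda>_. 0" by simp
lift_definition plus_ell2 :: "ell2 \<Rightarrow> ell2 \<Rightarrow> ell2" is "\<lambda>x y n. x n + y n"
  by (rule summable_ell2_add)
lift_definition uminus_ell2 :: "ell2 \<Rightarrow> ell2" is "\<lambda>x n. - x n" by simp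
definition minus_ell2 :: "ell2 \<Rightarrow> ell2 \<Rightarrow> ell2" where "minus_ell2 x y = x + - y"
definition scaleR_ell2 :: "real \<Rightarrow> ell2 \<Rightarrow> ell2" where
  "scaleR_ell2 r x = scaleC (complex_of_real r) x"

instance
proof
  fix x y z :: ell2 and a b :: real
  show "x + y + z = x + (y + z)" by transfer (simp add: add.assoc)
  show "x + y = y + x" by transfer (simp add: add.commute)
  show "0 + x = x" by transfer simp
  show "- x + x = 0" by transfer simp
  show "x - y = x + - y" by (rule minus_ell2_def)
  show "a *\<^sub>R (x + y) = a *\<^sub>R x + a *\<^sub>R y"
    unfolding scaleR_ell2_def by transfer (simp add: algebra_simps)
  show "(a + b) *\<^sub>R x = a *\<^sub>R x + b *\<^sub>R x"
    unfolding scaleR_ell2_def by transfer (simp add: algebra_simps)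
  show "a *\<^sub>R b *\<^sub>R x = (a * b) *\<^sub>R x"
    unfolding scaleR_ell2_def by transfer (simp add: algebra_simps)
  show "1 *\<^sub>R x = x"
    unfolding scaleR_ell2_def by transfer simp
qed

end

lemma cinner_self: "cinner x x = complex_of_real (\<Sum>n. (cmod (coord x n))\<^sup>2)"
proof -
  have "(\<lambda>n. complex_of_real ((cmod (coord x n))\<^sup>2)) sums
          complex_of_real (\<Sum>n. (cmod (coord x n))\<^sup>2)"
    using coord[of x] by (intro sums_of_real) (simp add: summable_sums)
  thus ?thesis
    by (simp add: cinner.rep_eq complex_norm_square[symmetric] sums_unique[symmetric])
qed

lemma cinner_cnj: "cinner y x = cnj (cinner x y)"
proof transfer
  fix x y :: "nat \<Rightarrow> complex"
  assume "summable (\<lambda>n. (cmod (y n))\<^sup>2)" and "summable (\<lambda>n. (cmod (x n))\<^sup>2)"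
  hence "(\<lambda>n. x n * cnj (y n)) sums (\<Sum>n. x n * cnj (y n))"
    by (intro summable_sums summable_mult_cnj)
  hence "(\<lambda>n. cnj (x n * cnj (y n))) sums cnj (\<Sum>n. x n * cnj (y n))"
    by (simp only: sums_cnj)
  thus "(\<Sum>n. y n * cnj (x n)) = cnj (\<Sum>n. x n * cnj (y n))"
    by (simp add: sums_iff mult.commute)
qed

lemma cinner_add_left: "cinner (x + y) z = cinner x z + cinner y z"
  by transfer (simp add: algebra_simps suminf_add summable_mult_cnj)

lemma cinner_scaleC_left: "cinner (scaleC c x) y = c * cinner x y"
  by transfer (simp add: mult.assoc suminf_mult summable_mult_cnj)

instantiation ell2 :: real_inner
begin

definition inner_ell2 :: "ell2 \<Rightarrow> ell2 \<Rightarrow> real" where "inner_ell2 x y = Re (cinner x y)"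
definition norm_ell2 :: "ell2 \<Rightarrow> real" where "norm_ell2 x = sqrt (\<Sum>n. (cmod (coord x n))\<^sup>2)"
definition dist_ell2 :: "ell2 \<Rightarrow> ell2 \<Rightarrow> real" where "dist_ell2 x y = norm (x - y)"
definition sgn_ell2 :: "ell2 \<Rightarrow> ell2" where "sgn_ell2 x = inverse (norm x) *\<^sub>R x"
definition uniformity_ell2 :: "(ell2 \<times> ell2) filter" where
  "uniformity_ell2 = (INF e\<in>{0<..}. principal {(x, y). dist x y < e})"
definition open_ell2 :: "ell2 set \<Rightarrow> bool" where
  "open_ell2 U \<longleftrightarrow> (\<forall>x\<in>U. eventually (\<lambda>(x', y). x' = x \<longrightarrow> y \<in> U) uniformity)"

instance
proof
  fix x y z :: ell2 and r :: real
  show "dist x y = norm (x - y)" by (rule dist_ell2_def)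
  show "sgn x = inverse (norm x) *\<^sub>R x" by (rule sgn_ell2_def)
  show "uniformity = (INF e\<in>{0<..}. principal {(x::ell2, y). dist x y < e})"
    by (rule uniformity_ell2_def)
  show "open U = (\<forall>x\<in>U. eventually (\<lambda>(x', y). x' = x \<longrightarrow> y \<in> U) uniformity)"
    for U :: "ell2 set"
    by (rule open_ell2_def)
  show "inner x y = inner y x"
    unfolding inner_ell2_def by (subst cinner_cnj) simp
  show "inner (x + y) z = inner x z + inner y z"
    unfolding inner_ell2_def by (simp add: cinner_add_left)
  show "inner (r *\<^sub>R x) y = r * inner x y"
    unfolding inner_ell2_def scaleR_ell2_def by (simp add: cinner_scaleC_left)
  have s: "summable (\<lambda>n. (cmod (coord x n))\<^sup>2)" using coord[of x] by simp
  show "0 \<le> inner x x"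
    unfolding inner_ell2_def by (simp add: cinner_self suminf_nonneg s)
  show "inner x x = 0 \<longleftrightarrow> x = 0"
  proof -
    have "inner x x = 0 \<longleftrightarrow> (\<forall>n. coord x n = 0)"
      unfolding inner_ell2_def by (simp add: cinner_self suminf_eq_zero_iff s)
    thus ?thesis by (auto simp: coord_inject[symmetric] zero_ell2.rep_eq)
  qed
  show "norm x = sqrt (inner x x)"
    unfolding inner_ell2_def norm_ell2_def by (simp add: cinner_self)
qed

end


section \<open>Operators, states and the Kadison--Singer Problem\<close>

text \<open>
  Operators are plain functions on \<open>ell2\<close>, added and scaled pointwise.
  \<open>bounded_linear\<close> is boundedness together with real linearity.
\<close>

definition bounded_operators :: "(ell2 \<Rightarrow> ell2) set" where
  "bounded_operators = {T. bounded_linear T \<and> (\<forall>c x. T (scaleC c x) = scaleC c (T x))}"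

definition diagonal_operators :: "(ell2 \<Rightarrow> ell2) set" where
  "diagonal_operators =
     {T \<in> bounded_operators. \<exists>d. \<forall>x n. coord (T x) n = d n * coord x n}"

text \<open>
  In the order on \<^typ>\<open>complex\<close> used below, \<open>0 \<le> z\<close> means that \<open>z\<close> is real and nonnegative.
\<close>

definition positive_operator :: "(ell2 \<Rightarrow> ell2) \<Rightarrow> bool" where
  "positive_operator T \<longleftrightarrow> (\<forall>x. 0 \<le> cinner (T x) x)"

text \<open>
  Functionals on an algebra \<open>R\<close> of operators are total functions whose values outside \<open>R\<close> are
  irrelevant, so equality of functionals always means agreement on \<open>R\<close>.
\<close>

definition is_state :: "(ell2 \<Rightarrow> ell2) set \<Rightarrow> ((ell2 \<Rightarrow> ell2) \<Rightarrow> complex) \<Rightarrow> bool" where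
  "is_state R f \<longleftrightarrow>
     (\<forall>S\<in>R. \<forall>T\<in>R. f (\<lambda>x. S x + T x) = f S + f T) \<and>
     (\<forall>c. \<forall>T\<in>R. f (\<lambda>x. scaleC c (T x)) = c * f T) \<and>
     f (\<lambda>x. x) = 1 \<and>
     (\<forall>T\<in>R. positive_operator T \<longrightarrow> 0 \<le> f T)"

definition is_pure_state :: "(ell2 \<Rightarrow> ell2) set \<Rightarrow> ((ell2 \<Rightarrow> ell2) \<Rightarrow> complex) \<Rightarrow> bool" where
  "is_pure_state R f \<longleftrightarrow>
     is_state R f \<and>
     (\<forall>g h. \<forall>t::real. is_state R g \<and> is_state R h \<and> 0 < t \<and> t < 1 \<and>
        (\<forall>T\<in>R. f T = complex_of_real (1 - t) * g T + complex_of_real t * h T) \<longrightarrow>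
        (\<forall>T\<in>R. g T = f T \<and> h T = f T))"

text \<open>
  Existence and uniqueness of the extension are asserted together with its purity; uniqueness
  is among all states.
\<close>

definition kadison_singer :: bool where
  "kadison_singer \<longleftrightarrow>
     (\<forall>f. is_pure_state diagonal_operators f \<longrightarrow>
        (\<exists>g. is_pure_state bounded_operators g \<and> (\<forall>T\<in>diagonal_operators. g T = f T) \<and>
           (\<forall>h. is_state bounded_operators h \<and> (\<forall>T\<in>diagonal_operators. h T = f T) \<longrightarrow>
              (\<forall>T\<in>bounded_operators. h T = g T))))"


section \<open>Operators on finite-dimensional Hilbert space\<close>

text \<open>
  Operators on the \<open>n\<close>-dimensional space are \<open>n \<times> n\<close> complex matrices; coordinates are
  numbered \<open>0, \<dots>, n - 1\<close>.
\<close>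

definition l2norm_vec :: "complex Matrix.vec \<Rightarrow> real" where
  "l2norm_vec v = L2_set (\<lambda>i. cmod (vec_index v i)) {..<dim_vec v}"

definition opnorm_mat :: "complex mat \<Rightarrow> real" where
  "opnorm_mat A = (SUP v \<in> {v \<in> carrier_vec (dim_col A). l2norm_vec v \<le> 1}. l2norm_vec (A *\<^sub>v v))"

definition orthogonal_projection :: "nat \<Rightarrow> complex mat \<Rightarrow> bool" where
  "orthogonal_projection n P \<longleftrightarrow> P \<in> carrier_mat n n \<and> P * P = P \<and> mat_adjoint P = P"

definition max_diag :: "complex mat \<Rightarrow> real" where
  "max_diag P = (MAX i \<in> {..<dim_row P}. cmod (P $$ (i, i)))"

definition diag_proj :: "nat \<Rightarrow> nat set \<Rightarrow> complex mat" where
  "diag_proj n A = Matrix.mat n n (\<lambda>(i, j). if i = j \<and> i \<in> A then 1 else 0)"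

text \<open>The blocks of a partition into \<open>r\<close> sets may be empty, as \<open>r\<close> does not depend on \<open>n\<close>.\<close>

definition is_partition :: "nat \<Rightarrow> nat \<Rightarrow> (nat \<Rightarrow> nat set) \<Rightarrow> bool" where
  "is_partition n r A \<longleftrightarrow> disjoint_family_on A {1..r} \<and> (\<Union>j\<in>{1..r}. A j) = {..<n}"

end

theory Submission
  imports Defs "HOL-Analysis.Topology_Euclidean_Space"
begin

text \<open>
  Both directions compare the two problems directly. A family of vectors in a finite-dimensional
  space is called Bessel with bound \<open>C\<close> when its analysis map has squared norm at most \<open>C\<close>.

  From projections to the Kadison--Singer Problem. A Bessel family with bound \<open>1\<close> and small norms
  is enlarged, after adding a little to each vector, to a Parseval frame all of whose vectors have
  the same norm (\<open>parseval_completion\<close>). The Gram matrix of a Parseval frame is an orthogonal projection, so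
  the hypothesis splits the family into \<open>r\<close> classes whose bound drops to some \<open>q < 1\<close>
  (\<open>bessel_paving_of_pavable_projections\<close>). Rescaling and repeating drives the bound to \<open>q ^ k\<close>, provided
  the norms were small enough at the start (\<open>bessel_paving_iterate\<close>). A Hermitian matrix with zero
  diagonal enters as follows: a colouring that minimises the weight of monochromatic pairs, with
  weights \<open>\<bar>a i j\<bar>\<^sup>2\<close>, leaves every row with little mass inside its own class
  (\<open>max_cut_coloring\<close>). So the rows cut down to their classes are a Bessel family of small vectors;
  splitting that family once more bounds the diagonal blocks of the matrix itself (\<open>finite_paving\<close>),
  and an ultrafilter limit of colourings does the same for an infinite matrix (\<open>infinite_paving\<close>).

  A pure state on the diagonal operators takes only the values \<open>0\<close> and \<open>1\<close> on diagonal projections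
  (\<open>pure_state_diagonal_zero_one\<close>). Hence any extension \<open>h\<close> of it gives the value \<open>1\<close> to the projection onto one
  block of each paving, and sees only the compression of an operator to that block
  (\<open>state_le_of_compression_le\<close>). As the compressions can be made arbitrarily small, \<open>h\<close> vanishes on all operators with
  zero diagonal, and so \<open>h\<close> is the given state applied to the diagonal part. Purity of this one extension
  is inherited from the given state.

  From the Kadison--Singer Problem to projections. If no \<open>r\<close> worked for \<open>\<delta> = 1/16\<close> and
  \<open>\<epsilon> = 1/2\<close>, then for each \<open>r\<close> there would be a projection that \<open>r\<close> blocks cannot pave. On the direct sum \<open>T\<close> of
  these projections, call a set of coordinates good if the quadratic form of \<open>T\<close> is at most \<open>1/4\<close> on
  unit vectors supported there. Finitely many good sets never cover all coordinates, so some
  ultrafilter contains no good set. The limit along it of the diagonal entries is a pure state on the diagonal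
  operators, with two extensions: the limit of the diagonal entries themselves, at most \<open>1/16\<close> on \<open>T\<close>, and a limit of
  vector states at unit vectors supported on ever smaller sets of the ultrafilter, at
  least \<open>1/4\<close> on \<open>T\<close> (\<open>pavable_projections_of_kadison_singer\<close>).
\<close>

section \<open>Bessel families and Parseval frames\<close>

lemma sum_lessThan_mult:
  fixes f :: "nat \<Rightarrow> 'a::comm_monoid_add"
  shows "(\<Sum>p<a * b. f p) = (\<Sum>x<a. \<Sum>y<b. f (x * b + y))"
proof -
  have "(\<Sum>y = x * b..<x * b + b. f y) = (\<Sum>y<b. f (x * b + y))" for x
    using sum.shift_bounds_nat_ivl[of f 0 "x * b" b] by (simp add: atLeast0LessThan add.commute)
  then show ?thesis
    using sum.nat_group[of f b a] by simp
qed

lemma cnj_mult_self: "cnj z * z = complex_of_real ((cmod z)\<^sup>2)"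
  by (simp only: complex_norm_square mult.commute)

abbreviation sqnorm :: "nat \<Rightarrow> (nat \<Rightarrow> complex) \<Rightarrow> real" where
  "sqnorm n x \<equiv> \<Sum>i<n. (cmod (x i))\<^sup>2"

abbreviation qform :: "nat \<Rightarrow> (nat \<Rightarrow> nat \<Rightarrow> complex) \<Rightarrow> (nat \<Rightarrow> complex) \<Rightarrow> complex" where
  "qform n a x \<equiv> \<Sum>i<n. \<Sum>j<n. cnj (x i) * a i j * x j"

text \<open>
  Gaussian elimination of the last variable: the Schur complement \<open>g'\<close> is the minimum of the form
  over the last coordinate, hence again positive semidefinite, and the eliminated row supplies
  one new vector. A vanishing pivot forces its whole row to vanish, so the formula for the
  complement covers that case through division by zero.
\<close>

lemma cholesky_decomposition:
  fixes g :: "nat \<Rightarrow> nat \<Rightarrow> complex"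
  assumes herm: "\<And>k l. k < m \<Longrightarrow> l < m \<Longrightarrow> g l k = cnj (g k l)"
    and psd: "\<And>u. 0 \<le> Re (\<Sum>k<m. \<Sum>l<m. cnj (u k) * g k l * u l)"
  shows "\<exists>r. \<forall>k<m. \<forall>l<m. g k l = (\<Sum>a<m. cnj (r a k) * r a l)"
  using assms
proof (induction m arbitrary: g)
  case 0
  then show ?case by simp
next
  case (Suc m)
  let ?q = "\<lambda>u. \<Sum>k<m. \<Sum>l<m. cnj (u k) * g k l * u l"
  define p where "p = Re (g m m)"
  have gmm: "g m m = complex_of_real p"
    using Suc.prems(1)[of m m] by (simp add: p_def complex_eq_iff)
  have hc: "cnj (g m k) = g k m" if "k < m" for k
    using Suc.prems(1)[of m k] that by simp
  define b where "b u = (\<Sum>l<m. g m l * u l)" for u :: "nat \<Rightarrow> complex"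
  have form: "(\<Sum>k<Suc m. \<Sum>l<Suc m. cnj (u k) * g k l * u l) =
      ?q u + cnj (b u) * u m + cnj (u m) * b u + cnj (u m) * p * u m"
    for u
  proof -
    have "cnj (b u) * u m = (\<Sum>k<m. cnj (u k) * g k m * u m)"
      unfolding b_def by (auto simp: sum_distrib_right hc intro!: sum.cong)
    moreover have "cnj (u m) * b u = (\<Sum>l<m. cnj (u m) * g m l * u l)"
      unfolding b_def by (simp add: sum_distrib_left mult.assoc)
    ultimately show ?thesis
      by (simp add: sum.distrib gmm)
  qed
  have p0: "0 \<le> p"
    using Suc.prems(2)[of "\<lambda>k. if k = m then 1 else 0"] unfolding form by (simp add: b_def)
  have row0: "g m l = 0" if "p = 0" "l < m" for l
  proof (rule ccontr)
    assume nz: "g m l \<noteq> 0"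
    \<comment> \<open>With zero pivot the form is affine in \<open>t\<close> along \<open>u\<close>; this \<open>t\<close> makes its value \<open>-1\<close>.\<close>
    define t where "t = (Re (g l l) + 1) / (2 * (cmod (g m l))\<^sup>2)"
    define u where "u k = (if k = l then 1 else if k = m then - of_real t * g m l else 0)" for k
    have bu: "b u = g m l"
      using that by (simp add: b_def u_def if_distrib[of "\<lambda>z. _ * z"] sum.delta cong: if_cong)
    have "(\<Sum>k<m. \<Sum>l'<m. cnj (u k) * g k l' * u l') =
        (\<Sum>k<m. \<Sum>l'<m. if k = l then if l' = l then g l l else 0 else 0)"
      using that by (intro sum.cong refl) (auto simp: u_def)
    also have "\<dots> = (\<Sum>k<m. if k = l then g l l else 0)"
      using that by (intro sum.cong refl) simp
    also have "\<dots> = g l l"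
      using that by simp
    finally have fm: "(\<Sum>k<m. \<Sum>l'<m. cnj (u k) * g k l' * u l') = g l l" .
    have um: "u m = - of_real t * g m l" using that by (simp add: u_def)
    have "0 \<le> Re (g l l) + Re (cnj (g m l) * u m + cnj (u m) * g m l)"
      using Suc.prems(2)[of u] unfolding form fm bu that(1) by simp
    also have "cnj (g m l) * u m + cnj (u m) * g m l = - of_real (2 * t * (cmod (g m l))\<^sup>2)"
    proof -
      have "cnj (g m l) * u m + cnj (u m) * g m l = - of_real (2 * t) * (cnj (g m l) * g m l)"
        unfolding um by (simp add: algebra_simps)
      then show ?thesis unfolding cnj_mult_self by simp
    qed
    also have "Re (g l l) + Re (- of_real (2 * t * (cmod (g m l))\<^sup>2)) = Re (g l l) - 2 * t * (cmod (g m l))\<^sup>2"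
      by (simp only: uminus_complex.sel Re_complex_of_real)
    also have "\<dots> = -1" using nz by (simp add: t_def field_simps)
    finally show False by simp
  qed
  define g' where "g' k l = g k l - g k m * g m l / p" for k l
  have "\<exists>r. \<forall>k<m. \<forall>l<m. g' k l = (\<Sum>a<m. cnj (r a k) * r a l)"
  proof (rule Suc.IH)
    show "g' l k = cnj (g' k l)" if "k < m" "l < m" for k l
      unfolding g'_def using Suc.prems(1)[of k l] hc[of k] hc[of l] that
      by (metis (no_types, lifting) complex_cnj_cnj complex_cnj_complex_of_real complex_cnj_diff
          complex_cnj_divide complex_cnj_mult less_SucI mult.commute)
  next
    fix u :: "nat \<Rightarrow> complex"
    define u' where "u' = u(m := - b u / p)"
    have bu': "b u' = b u" unfolding b_def u'_def by (intro sum.cong) auto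
    have fm: "(\<Sum>k<m. \<Sum>l<m. cnj (u' k) * g k l * u' l) = ?q u"
      by (intro sum.cong refl) (simp add: u'_def)
    have "(\<Sum>k<m. \<Sum>l<m. cnj (u k) * g' k l * u l) = ?q u -
        (\<Sum>k<m. \<Sum>l<m. cnj (u k) * g k m * (g m l * u l)) / p"
      unfolding g'_def by (simp add: sum_subtractf algebra_simps sum_divide_distrib)
    also have "(\<Sum>k<m. \<Sum>l<m. cnj (u k) * g k m * (g m l * u l)) = cnj (b u) * b u"
      unfolding b_def cnj_sum sum_product by (intro sum.cong refl) (auto simp: hc)
    also have "?q u - cnj (b u) * b u / p =
        (\<Sum>k<Suc m. \<Sum>l<Suc m. cnj (u' k) * g k l * u' l)"
      unfolding form bu' fm by (cases "p = 0") (simp_all add: u'_def field_simps)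
    finally show "0 \<le> Re (\<Sum>k<m. \<Sum>l<m. cnj (u k) * g' k l * u l)"
      using Suc.prems(2)[of u'] by simp
  qed
  then obtain r where r: "\<And>k l. k < m \<Longrightarrow> l < m \<Longrightarrow> g' k l = (\<Sum>a<m. cnj (r a k) * r a l)"
    by blast
  define r' where "r' a k = (if a = m then g m k / sqrt p else if k = m then 0 else r a k)" for a k
  have "g k l = (\<Sum>a<Suc m. cnj (r' a k) * r' a l)" if kl: "k < Suc m" "l < Suc m" for k l
  proof -
    have hk: "cnj (g m k) = g k m" using Suc.prems(1)[of m k] kl by simp
    have sq: "complex_of_real (sqrt p) * complex_of_real (sqrt p) = p"
      using p0 by (simp flip: of_real_mult)
    have "(\<Sum>a<Suc m. cnj (r' a k) * r' a l) = (\<Sum>a<m. cnj (r' a k) * r' a l) + g k m * g m l / p"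
      by (simp add: r'_def hk sq)
    also have "(\<Sum>a<m. cnj (r' a k) * r' a l) = (if k < m \<and> l < m then g' k l else 0)"
    proof (cases "k < m \<and> l < m")
      case True
      then show ?thesis by (simp add: r r'_def cong: if_cong)
    next
      case False
      then have "k = m \<or> l = m" using kl by auto
      then show ?thesis using False by (auto simp: r'_def intro!: sum.neutral)
    qed
    also have "\<dots> + g k m * g m l / p = g k l"
    proof (cases "p = 0")
      case True
      then show ?thesis
        using kl row0[OF True] hk gmm by (auto simp: g'_def less_Suc_eq)
    next
      case False
      then show ?thesis
        using kl gmm by (auto simp: g'_def less_Suc_eq)
    qed
    finally show ?thesis ..
  qed
  then show ?case by blast
qed

lemma sum_lessThan_add:
  fixes f :: "nat \<Rightarrow> 'a::comm_monoid_add"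
  shows "(\<Sum>p<a + b. f p) = (\<Sum>p<a. f p) + (\<Sum>q<b. f (a + q))"
  by (induction b) (simp_all add: add.assoc)

lemma sum_cis_orthogonal:
  fixes a b N :: nat
  assumes "a < N" "b < N"
  shows "(\<Sum>t<N. cnj (cis (2 * pi * t * a / N)) * cis (2 * pi * t * b / N)) = (if a = b then of_nat N else 0)"
proof (cases "a = b")
  case True
  then show ?thesis by (simp add: cis_cnj cis_mult)
next
  case False
  define z where "z = cis (2 * pi * (real b - real a) / N)"
  have N: "N > 0" using assms by simp
  have tm: "cnj (cis (2 * pi * t * a / N)) * cis (2 * pi * t * b / N) = z ^ t" for t :: nat
    by (simp add: z_def cis_cnj cis_mult DeMoivre algebra_simps diff_divide_distrib)
  have "z ^ N = cis (2 * pi * (real_of_int (int b - int a)))"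
    using N by (simp add: z_def DeMoivre)
  also have "\<dots> = 1"
    by (rule cis_multiple_2pi) simp
  finally have zN: "z ^ N = 1" .
  have "z \<noteq> 1"
  proof
    assume "z = 1"
    then have "cos (2 * pi * (real b - real a) / N) = 1"
      by (simp add: z_def complex_eq_iff)
    then obtain k :: int where "2 * pi * (real b - real a) / N = k * 2 * pi"
      using cos_one_2pi_int by auto
    then have "2 * pi * (real b - real a) = 2 * pi * (k * N)"
      using N by (simp add: field_simps)
    then have "real b - real a = k * N"
      by simp
    then have eq: "int b - int a = k * int N"
      by (metis (mono_tags, opaque_lifting) of_int_diff of_int_eq_iff of_int_mult of_int_of_nat_eq)
    have "\<bar>int b - int a\<bar> < int N" using assms by linarith
    then have "\<bar>k\<bar> * int N < 1 * int N" unfolding eq using N by (simp add: abs_mult)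
    then have "k = 0" by (simp add: mult_less_cancel_right_pos N)
    then show False using eq False by simp
  qed
  then have "(\<Sum>t<N. z ^ t) = 0"
    by (simp add: geometric_sum zN)
  then show ?thesis using False by (simp add: tm)
qed

text \<open>
  The pairing of \<open>v i\<close> with \<open>u\<close> is bilinear instead of sesquilinear; since \<open>u\<close> ranges over a space
  closed under conjugation, the bound is the same.
\<close>

definition bessel :: "nat \<Rightarrow> nat \<Rightarrow> (nat \<Rightarrow> nat \<Rightarrow> complex) \<Rightarrow> real \<Rightarrow> bool" where
  "bessel n m v C \<longleftrightarrow>
    (\<forall>u. (\<Sum>i<n. (cmod (\<Sum>k<m. v i k * u k))\<^sup>2) \<le> C * sqnorm m u)"

lemma bessel_scale:
  assumes "bessel n m v C"
  shows "bessel n m (\<lambda>i k. complex_of_real s * v i k) (s\<^sup>2 * C)"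
proof -
  have "(\<Sum>k<m. complex_of_real s * v i k * u k) = of_real s * (\<Sum>k<m. v i k * u k)" for i u
    by (simp add: sum_distrib_left mult.assoc)
  then show ?thesis
    using assms unfolding bessel_def
    by (simp add: norm_mult power_mult_distrib mult.assoc flip: sum_distrib_left)
      (simp add: mult_left_mono)
qed

lemma bessel_restrict:
  assumes "bessel n m v C"
  shows "bessel n m (\<lambda>i k. if P i then v i k else 0) C"
  unfolding bessel_def
proof
  fix u
  have "(\<Sum>i<n. (cmod (\<Sum>k<m. (if P i then v i k else 0) * u k))\<^sup>2) \<le> (\<Sum>i<n. (cmod (\<Sum>k<m. v i k * u k))\<^sup>2)"
  proof (rule sum_mono)
    show "(cmod (\<Sum>k<m. (if P i then v i k else 0) * u k))\<^sup>2 \<le> (cmod (\<Sum>k<m. v i k * u k))\<^sup>2" for i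
      by (cases "P i") simp_all
  qed
  then show "(\<Sum>i<n. (cmod (\<Sum>k<m. (if P i then v i k else 0) * u k))\<^sup>2) \<le> C * sqnorm m u"
    using assms unfolding bessel_def by (meson order_trans)
qed

text \<open>
  The defect \<open>g\<close> of the frame operator from the identity factors as \<open>R\<^sup>* R\<close> by the Cholesky
  decomposition, so adjoining the rows \<open>r a\<close> of \<open>R\<close> gives a Parseval frame. These rows can have different
  norms. To equalise them, take \<open>m\<close> orthogonal copies of the whole frame and group the rows
  by a cyclic shift \<open>s\<close>: in one group \<open>r a\<close> lies in the copy \<open>c\<close> with \<open>a \<equiv> c + s\<close> modulo \<open>m\<close>, so the
  rows of a group are mutually orthogonal. Replacing them by the combinations whose coefficients are the entries of
  an \<open>N\<close> by \<open>m\<close> discrete Fourier isometry keeps the frame operator and gives every new vector the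
  average squared norm, which is \<open>1 / K\<close> for \<open>N = K m - n\<close>. Row \<open>p < n m\<close> is the vector \<open>v (p mod n)\<close> in copy
  \<open>p div n\<close>, and coordinate \<open>\<alpha>\<close> is coordinate \<open>\<alpha> mod m\<close> of copy \<open>\<alpha> div m\<close>.
\<close>

lemma parseval_completion:
  fixes v :: "nat \<Rightarrow> nat \<Rightarrow> complex" and n m K :: nat
  assumes bes: "bessel n m v 1"
    and K: "2 \<le> K" and nm: "n \<le> m"
    and vn: "\<And>i. i < n \<Longrightarrow> sqnorm m (v i) = 1 / K"
  shows "\<exists>w. (\<forall>\<alpha><m * m. \<forall>\<beta><m * m. (\<Sum>p<K * m * m. cnj (w p \<alpha>) * w p \<beta>) = (if \<alpha> = \<beta> then 1 else 0)) \<and>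
    (\<forall>p<K * m * m. sqnorm (m * m) (w p) = 1 / K) \<and>
    (\<forall>i<n. \<forall>\<alpha><m * m. w i \<alpha> = (if \<alpha> < m then v i \<alpha> else 0))"
proof (cases "m = 0")
  case True
  then show ?thesis using nm by auto
next
  case False
  then have m: "m > 0" by simp
  define g where "g k l = (if k = l then 1 else 0) - (\<Sum>i<n. cnj (v i k) * v i l)" for k l
  have "\<exists>r. \<forall>k<m. \<forall>l<m. g k l = (\<Sum>a<m. cnj (r a k) * r a l)"
  proof (rule cholesky_decomposition)
    show "g l k = cnj (g k l)" for k l
      by (simp add: g_def mult.commute)
  next
    fix u :: "nat \<Rightarrow> complex"
    let ?h = "\<lambda>i k l. cnj (v i k * u k) * (v i l * u l)"
    have "cnj (u k) * g k l * u l = cnj (u k) * (if k = l then 1 else 0) * u l -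
        (\<Sum>i<n. ?h i k l)" for k l
      by (simp add: g_def left_diff_distrib right_diff_distrib sum_distrib_left sum_distrib_right mult_ac)
    then have "(\<Sum>k<m. \<Sum>l<m. cnj (u k) * g k l * u l) =
        (\<Sum>k<m. \<Sum>l<m. cnj (u k) * (if k = l then 1 else 0) * u l) -
        (\<Sum>k<m. \<Sum>l<m. \<Sum>i<n. ?h i k l)"
      by (simp only: sum_subtractf)
    also have "(\<Sum>k<m. \<Sum>l<m. cnj (u k) * (if k = l then 1 else 0) * u l) = of_real (sqnorm m u)"
    proof -
      have "(\<Sum>l<m. cnj (u k) * (if k = l then 1 else 0) * u l) = of_real ((cmod (u k))\<^sup>2)" if "k < m" for k
        using that by (simp add: if_distrib if_distribR sum.delta cnj_mult_self del: of_real_power cong: if_cong)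
      then show ?thesis
        unfolding of_real_sum by (intro sum.cong refl) (simp only: lessThan_iff)
    qed
    also have "(\<Sum>k<m. \<Sum>l<m. \<Sum>i<n. ?h i k l) =
        (\<Sum>k<m. \<Sum>i<n. \<Sum>l<m. ?h i k l)"
      by (intro sum.cong refl sum.swap)
    also have "\<dots> = (\<Sum>i<n. \<Sum>k<m. \<Sum>l<m. ?h i k l)"
      by (rule sum.swap)
    also have "\<dots> = (\<Sum>i<n. cnj (\<Sum>k<m. v i k * u k) * (\<Sum>k<m. v i k * u k))"
      unfolding cnj_sum sum_product ..
    also have "\<dots> = of_real (\<Sum>i<n. (cmod (\<Sum>k<m. v i k * u k))\<^sup>2)"
      by (simp only: of_real_sum cnj_mult_self)
    finally show "0 \<le> Re (\<Sum>k<m. \<Sum>l<m. cnj (u k) * g k l * u l)"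
      using bes unfolding bessel_def by (simp del: of_real_sum of_real_power) 
  qed
  then obtain r where r: "\<And>k l. k < m \<Longrightarrow> l < m \<Longrightarrow> g k l = (\<Sum>a<m. cnj (r a k) * r a l)"
    by blast
  define N where "N = K * m - n"
  have "2 * m \<le> K * m" using K by simp
  then have mN: "m \<le> N" and N0: "0 < N" using nm m unfolding N_def by linarith+
  have Kmn: "n \<le> K * m" using \<open>2 * m \<le> K * m\<close> nm by linarith
  have L: "K * m * m = n * m + m * N"
    using Kmn by (simp add: N_def diff_mult_distrib2 algebra_simps)
  \<comment> \<open>Trace of the defect: \<open>m\<close> minus the sum \<open>n / K\<close> of the squared norms of the \<open>v i\<close>.\<close>
  have rsum: "(\<Sum>a<m. \<Sum>k<m. (cmod (r a k))\<^sup>2) = N / K"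
  proof -
    have "complex_of_real (\<Sum>a<m. \<Sum>k<m. (cmod (r a k))\<^sup>2) = (\<Sum>k<m. \<Sum>a<m. cnj (r a k) * r a k)"
      by (subst sum.swap) (simp only: cnj_mult_self of_real_sum)
    also have "\<dots> = (\<Sum>k<m. g k k)" by (simp add: r)
    also have "\<dots> = of_nat m - (\<Sum>k<m. \<Sum>i<n. cnj (v i k) * v i k)"
      by (simp add: g_def sum_subtractf)
    also have "(\<Sum>k<m. \<Sum>i<n. cnj (v i k) * v i k) = of_real (\<Sum>i<n. \<Sum>k<m. (cmod (v i k))\<^sup>2)"
      by (subst sum.swap) (simp only: cnj_mult_self of_real_sum)
    also have "(\<Sum>i<n. \<Sum>k<m. (cmod (v i k))\<^sup>2) = n / K" by (simp add: vn)
    also have "of_nat m - complex_of_real (n / K) = complex_of_real (m - n / K)" by simp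
    also have "real m - n / K = N / K"
      using K Kmn by (simp add: N_def field_simps of_nat_diff)
    finally show ?thesis by (simp only: of_real_eq_iff)
  qed
  define sh where "sh s \<alpha> = (\<alpha> div m + s) mod m" for s \<alpha> :: nat
  define w where "w p \<alpha> = (if p < n * m then if \<alpha> div m = p div n then v (p mod n) (\<alpha> mod m) else 0
     else cis (2 * pi * real ((p - n * m) mod N) * real (sh ((p - n * m) div N) \<alpha>) / N) / sqrt N
       * r (sh ((p - n * m) div N) \<alpha>) (\<alpha> mod m))" for p \<alpha>
  have shm: "sh s \<alpha> < m" for s \<alpha> using m by (simp add: sh_def)
  have bij: "bij_betw (\<lambda>s. (c + s) mod m) {..<m} {..<m}" for c
  proof -
    have "inj_on (\<lambda>s. (c + s) mod m) {..<m}"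
    proof (rule inj_onI)
      fix s t assume st: "s \<in> {..<m}" "t \<in> {..<m}" "(c + s) mod m = (c + t) mod m"
      then have "int m dvd (int c + int s) - (int c + int t)"
        by (metis mod_eq_dvd_iff of_nat_add of_nat_mod)
      then have "int m dvd int s - int t" by simp
      moreover have "\<bar>int s - int t\<bar> < int m" using st by auto
      ultimately have "int s - int t = 0"
        using dvd_imp_le_int[of "int s - int t" "int m"] by linarith
      then show "s = t" by simp
    qed
    moreover have "(\<lambda>s. (c + s) mod m) ` {..<m} \<subseteq> {..<m}" using m by auto
    ultimately show ?thesis
      by (metis bij_betw_def card_image card_subset_eq finite_lessThan)
  qed
  have wA: "w (x * n + y) \<alpha> = (if \<alpha> div m = x then v y (\<alpha> mod m) else 0)" if "x < m" "y < n" for x y \<alpha>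
  proof -
    have "x * n + y < Suc x * n" using that by simp
    also have "\<dots> \<le> m * n" using that by (intro mult_right_mono) auto
    finally show ?thesis using that by (simp add: w_def mult.commute)
  qed
  have wB: "w (n * m + (s * N + t)) \<alpha> = cis (2 * pi * real t * real (sh s \<alpha>) / N) / sqrt N * r (sh s \<alpha>) (\<alpha> mod m)"
    if "t < N" for s t \<alpha>
    using that by (simp add: w_def)
  have split: "(\<Sum>p<K * m * m. f p) = (\<Sum>x<m. \<Sum>y<n. f (x * n + y)) + (\<Sum>s<m. \<Sum>t<N. f (n * m + (s * N + t)))"
    for f :: "nat \<Rightarrow> complex"
    unfolding L sum_lessThan_add by (simp add: mult.commute[of n m] sum_lessThan_mult) 
  have parseval: "(\<Sum>p<K * m * m. cnj (w p \<alpha>) * w p \<beta>) = (if \<alpha> = \<beta> then 1 else 0)"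
    if ab: "\<alpha> < m * m" "\<beta> < m * m" for \<alpha> \<beta>
  proof -
    define c k d l where "c = \<alpha> div m" and "k = \<alpha> mod m" and "d = \<beta> div m" and "l = \<beta> mod m"
    have cd: "c < m" "d < m" using ab by (simp_all add: c_def d_def less_mult_imp_div_less)
    have kl: "k < m" "l < m" using m by (simp_all add: k_def l_def)
    have A: "(\<Sum>x<m. \<Sum>y<n. cnj (w (x * n + y) \<alpha>) * w (x * n + y) \<beta>) =
        (if c = d then \<Sum>i<n. cnj (v i k) * v i l else 0)"
    proof -
      have "(\<Sum>x<m. \<Sum>y<n. cnj (w (x * n + y) \<alpha>) * w (x * n + y) \<beta>) =
          (\<Sum>x<m. if x = c then if c = d then \<Sum>i<n. cnj (v i k) * v i l else 0 else 0)"
        by (intro sum.cong refl) (auto simp: wA c_def k_def d_def l_def intro!: sum.neutral)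
      also have "\<dots> = (if c = d then \<Sum>i<n. cnj (v i k) * v i l else 0)"
        using cd by simp
      finally show ?thesis .
    qed
    have shi: "sh s \<alpha> = sh s \<beta> \<longleftrightarrow> c = d" for s
    proof -
      have "inj_on (\<lambda>c. (s + c) mod m) {..<m}" using bij[of s] by (simp add: bij_betw_def)
      moreover have "sh s \<alpha> = (s + c) mod m" "sh s \<beta> = (s + d) mod m"
        by (simp_all only: sh_def c_def d_def add.commute)
      ultimately show ?thesis
        using cd by (metis (no_types, lifting) inj_on_eq_iff lessThan_iff)
    qed
    have B: "(\<Sum>s<m. \<Sum>t<N. cnj (w (n * m + (s * N + t)) \<alpha>) * w (n * m + (s * N + t)) \<beta>) =
        (if c = d then \<Sum>a<m. cnj (r a k) * r a l else 0)"
    proof -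
      let ?b = "\<lambda>s. \<Sum>t<N. cnj (w (n * m + (s * N + t)) \<alpha>) * w (n * m + (s * N + t)) \<beta>"
      have sq: "complex_of_real (sqrt N) * complex_of_real (sqrt N) = of_nat N"
        by (simp flip: of_real_mult)
      have "?b s =
          (if c = d then cnj (r (sh s \<alpha>) k) * r (sh s \<alpha>) l else 0)" for s
      proof -
        have "?b s =
          (\<Sum>t<N. cnj (cis (2 * pi * real t * real (sh s \<alpha>) / N)) * cis (2 * pi * real t * real (sh s \<beta>) / N))
             * (cnj (r (sh s \<alpha>) k) * r (sh s \<beta>) l / of_nat N)"
          unfolding sum_distrib_right
          by (intro sum.cong refl) (simp add: wB k_def l_def flip: sq)
        also have "\<dots> = (if c = d then of_nat N else 0) * (cnj (r (sh s \<alpha>) k) * r (sh s \<beta>) l / of_nat N)"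
          using shm[of s \<alpha>] shm[of s \<beta>] mN by (subst sum_cis_orthogonal) (auto simp: shi)
        also have "\<dots> = (if c = d then cnj (r (sh s \<alpha>) k) * r (sh s \<alpha>) l else 0)"
          using N0 shi[of s] by (cases "c = d") simp_all
        finally show ?thesis .
      qed
      then have "(\<Sum>s<m. \<Sum>t<N. cnj (w (n * m + (s * N + t)) \<alpha>) * w (n * m + (s * N + t)) \<beta>) =
        (if c = d then \<Sum>s<m. cnj (r (sh s \<alpha>) k) * r (sh s \<alpha>) l else 0)"
        by simp
      also have "(\<Sum>s<m. cnj (r (sh s \<alpha>) k) * r (sh s \<alpha>) l) = (\<Sum>a<m. cnj (r a k) * r a l)"
        unfolding sh_def by (rule sum.reindex_bij_betw[OF bij])
      finally show ?thesis .
    qed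
    have "(\<Sum>p<K * m * m. cnj (w p \<alpha>) * w p \<beta>) = (if c = d then (\<Sum>i<n. cnj (v i k) * v i l) + g k l else 0)"
      unfolding split A B using kl by (simp add: r)
    also have "\<dots> = (if c = d \<and> k = l then 1 else 0)"
      by (simp add: g_def)
    also have "c = d \<and> k = l \<longleftrightarrow> \<alpha> = \<beta>"
      unfolding c_def d_def k_def l_def by (metis div_mult_mod_eq)
    finally show ?thesis .
  qed
  have norm: "sqnorm (m * m) (w p) = 1 / K" if p: "p < K * m * m" for p
  proof -
    have dm: "(x * m + y) div m = x" "(x * m + y) mod m = y" if "y < m" for x y
      using that by simp_all
    show ?thesis
    proof (cases "p < n * m")
      case True
      then have n0: "0 < n" by (cases n) auto
      define x y where "x = p div n" and "y = p mod n"
      have xy: "x < m" "y < n" "p = x * n + y"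
        using True n0 by (simp_all add: x_def y_def less_mult_imp_div_less mult.commute)
      have "sqnorm (m * m) (w p) = (\<Sum>c<m. \<Sum>k<m. if c = x then (cmod (v y k))\<^sup>2 else 0)"
        unfolding sum_lessThan_mult using xy
        by (intro sum.cong refl) (simp add: wA dm)
      also have "\<dots> = (\<Sum>c<m. if c = x then \<Sum>k<m. (cmod (v y k))\<^sup>2 else 0)"
        by (intro sum.cong refl) simp
      also have "\<dots> = 1 / K" using xy by (simp add: vn)
      finally show ?thesis .
    next
      case False
      define s t where "s = (p - n * m) div N" and "t = (p - n * m) mod N"
      have st: "t < N" "p = n * m + (s * N + t)"
        using False N0 by (simp_all add: s_def t_def)
      have w': "(cmod (w p \<alpha>))\<^sup>2 = (cmod (r (sh s \<alpha>) (\<alpha> mod m)))\<^sup>2 / N" for \<alpha>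
        unfolding st(2) wB[OF st(1)] using N0
        by (simp add: norm_mult norm_divide power_mult_distrib power_divide)
      have "sqnorm (m * m) (w p) = (\<Sum>c<m. \<Sum>k<m. (cmod (r ((s + c) mod m) k))\<^sup>2 / N)"
        unfolding sum_lessThan_mult
        by (intro sum.cong refl) (simp add: w' sh_def dm add.commute)
      also have "\<dots> = (\<Sum>a<m. \<Sum>k<m. (cmod (r a k))\<^sup>2 / N)"
        by (rule sum.reindex_bij_betw[OF bij])
      also have "\<dots> = (\<Sum>a<m. \<Sum>k<m. (cmod (r a k))\<^sup>2) / N"
        by (simp add: sum_divide_distrib)
      also have "\<dots> = 1 / K" unfolding rsum using N0 by simp
      finally show ?thesis .
    qed
  qed
  have first: "w i \<alpha> = (if \<alpha> < m then v i \<alpha> else 0)" if "i < n" "\<alpha> < m * m" for i \<alpha>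
  proof -
    have "\<alpha> div m = 0 \<longleftrightarrow> \<alpha> < m" using m by (simp add: div_eq_0_iff)
    then show ?thesis using wA[of 0 i \<alpha>] m that by auto
  qed
  show ?thesis
    using parseval norm first by blast
qed

section \<open>Operator norms of matrices\<close>

lemma cmod_sum_mult_le:
  "(cmod (\<Sum>i\<in>I. a i * b i))\<^sup>2 \<le> (\<Sum>i\<in>I. (cmod (a i))\<^sup>2) * (\<Sum>i\<in>I. (cmod (b i))\<^sup>2)"
proof -
  have "cmod (\<Sum>i\<in>I. a i * b i) \<le> (\<Sum>i\<in>I. \<bar>cmod (a i)\<bar> * \<bar>cmod (b i)\<bar>)"
    by (rule order_trans[OF norm_sum]) (simp add: norm_mult)
  also have "\<dots> \<le> L2_set (\<lambda>i. cmod (a i)) I * L2_set (\<lambda>i. cmod (b i)) I"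
    by (rule L2_set_mult_ineq)
  finally have "(cmod (\<Sum>i\<in>I. a i * b i))\<^sup>2 \<le> (L2_set (\<lambda>i. cmod (a i)) I * L2_set (\<lambda>i. cmod (b i)) I)\<^sup>2"
    by (rule power_mono) simp
  then show ?thesis
    by (simp add: power_mult_distrib L2_set_def sum_nonneg)
qed

lemma l2norm_vec_power2: "(l2norm_vec v)\<^sup>2 = (\<Sum>i<dim_vec v. (cmod (v $ i))\<^sup>2)"
  by (simp add: l2norm_vec_def L2_set_def sum_nonneg)

lemma l2norm_vec_nonneg [simp]: "0 \<le> l2norm_vec v"
  by (simp add: l2norm_vec_def)

lemma l2norm_vec_smult: "l2norm_vec (c \<cdot>\<^sub>v v) = cmod c * l2norm_vec v"
proof -
  have "(l2norm_vec (c \<cdot>\<^sub>v v))\<^sup>2 = (cmod c * l2norm_vec v)\<^sup>2"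
    by (simp add: l2norm_vec_power2 power_mult_distrib norm_mult sum_distrib_left)
  then show ?thesis by (simp add: power2_eq_iff_nonneg)
qed

lemma mult_mat_vec_index:
  assumes "A \<in> carrier_mat n m" "v \<in> carrier_vec m" "i < n"
  shows "(A *\<^sub>v v) $ i = (\<Sum>j<m. A $$ (i, j) * v $ j)"
  using assms by (auto simp: scalar_prod_def atLeast0LessThan intro!: sum.cong)

lemma l2norm_le_opnorm:
  assumes A: "A \<in> carrier_mat n n" and v: "v \<in> carrier_vec n"
  shows "l2norm_vec (A *\<^sub>v v) \<le> opnorm_mat A * l2norm_vec v"
proof (cases "l2norm_vec v = 0")
  case True
  then have "\<And>i. i < n \<Longrightarrow> v $ i = 0"
    using l2norm_vec_power2[of v] v by (simp add: sum_nonneg_eq_0_iff)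
  then have "l2norm_vec (A *\<^sub>v v) = 0"
    using A v l2norm_vec_power2[of "A *\<^sub>v v"] by (simp add: mult_mat_vec_index[OF A v] del: index_mult_mat_vec)
  then show ?thesis using True by simp
next
  case False
  let ?B = "{v \<in> carrier_vec (dim_col A). l2norm_vec v \<le> 1}"
  have bdd: "bdd_above ((\<lambda>v. l2norm_vec (A *\<^sub>v v)) ` ?B)"
  proof (rule bdd_aboveI2)
    fix u assume u: "u \<in> ?B"
    then have uc: "u \<in> carrier_vec n" using A by auto
    have u1: "cmod (u $ j) \<le> 1" if "j < n" for j
    proof -
      have "cmod (u $ j) \<le> l2norm_vec u"
        unfolding l2norm_vec_def using that uc by (intro member_le_L2_set) auto
      then show ?thesis using u by simp
    qed
    have "l2norm_vec (A *\<^sub>v u) \<le> (\<Sum>i<n. cmod ((A *\<^sub>v u) $ i))"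
      unfolding l2norm_vec_def using A by (auto intro!: L2_set_le_sum simp del: index_mult_mat_vec)
    also have "\<dots> \<le> (\<Sum>i<n. \<Sum>j<n. cmod (A $$ (i, j)))"
    proof (rule sum_mono)
      fix i assume "i \<in> {..<n}"
      then have "cmod ((A *\<^sub>v u) $ i) \<le> (\<Sum>j<n. cmod (A $$ (i, j) * u $ j))"
        using mult_mat_vec_index[OF A uc, of i] by (simp add: norm_sum del: index_mult_mat_vec)
      also have "\<dots> \<le> (\<Sum>j<n. cmod (A $$ (i, j)))"
        by (intro sum_mono) (simp add: norm_mult u1 mult_left_le)
      finally show "cmod ((A *\<^sub>v u) $ i) \<le> (\<Sum>j<n. cmod (A $$ (i, j)))" .
    qed
    finally show "l2norm_vec (A *\<^sub>v u) \<le> (\<Sum>i<n. \<Sum>j<n. cmod (A $$ (i, j)))" .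
  qed
  define c where "c = complex_of_real (inverse (l2norm_vec v))"
  have "c \<cdot>\<^sub>v v \<in> ?B"
    using False A v by (simp add: l2norm_vec_smult c_def norm_inverse)
  then have "l2norm_vec (A *\<^sub>v (c \<cdot>\<^sub>v v)) \<le> opnorm_mat A"
    unfolding opnorm_mat_def by (rule cSUP_upper[OF _ bdd])
  then have "inverse (l2norm_vec v) * l2norm_vec (A *\<^sub>v v) \<le> opnorm_mat A"
    using mult_mat_vec[OF A v, of c] by (simp add: l2norm_vec_smult c_def norm_inverse)
  moreover have "0 < l2norm_vec v" using False l2norm_vec_nonneg[of v] by linarith
  ultimately show ?thesis by (simp add: field_simps)
qed

lemma opnorm_le:
  assumes A: "A \<in> carrier_mat n n" and c: "0 \<le> c"
    and le: "\<And>v. v \<in> carrier_vec n \<Longrightarrow> l2norm_vec (A *\<^sub>v v) \<le> c * l2norm_vec v"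
  shows "opnorm_mat A \<le> c"
  unfolding opnorm_mat_def
proof (rule cSUP_least)
  have "0\<^sub>v n \<in> {v \<in> carrier_vec (dim_col A). l2norm_vec v \<le> 1}"
    using A by (auto simp: l2norm_vec_def L2_set_def)
  then show "{v \<in> carrier_vec (dim_col A). l2norm_vec v \<le> 1} \<noteq> {}" by blast
next
  fix v assume "v \<in> {v \<in> carrier_vec (dim_col A). l2norm_vec v \<le> 1}"
  then have v: "v \<in> carrier_vec n" "l2norm_vec v \<le> 1" using A by auto
  have "l2norm_vec (A *\<^sub>v v) \<le> c * l2norm_vec v" by (rule le[OF v(1)])
  also have "\<dots> \<le> c" using c v(2) by (simp add: mult_left_le)
  finally show "l2norm_vec (A *\<^sub>v v) \<le> c" .
qed

lemma diag_proj_carrier [simp]: "diag_proj n A \<in> carrier_mat n n"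
  by (simp add: diag_proj_def)

lemma diag_proj_mult_vec:
  assumes "v \<in> carrier_vec n"
  shows "diag_proj n A *\<^sub>v v = Matrix.vec n (\<lambda>i. if i \<in> A then v $ i else 0)"
proof (rule eq_vecI)
  fix i assume "i < dim_vec (Matrix.vec n (\<lambda>i. if i \<in> A then v $ i else 0))"
  then have i: "i < n" by simp
  have "(diag_proj n A *\<^sub>v v) $ i = (\<Sum>j<n. if j = i then if i \<in> A then v $ i else 0 else 0)"
    unfolding mult_mat_vec_index[OF diag_proj_carrier assms i]
    using i by (intro sum.cong refl) (auto simp: diag_proj_def)
  then show "(diag_proj n A *\<^sub>v v) $ i = Matrix.vec n (\<lambda>i. if i \<in> A then v $ i else 0) $ i"
    using i by simp
qed (simp add: diag_proj_def)

lemma compression_mult_vec: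
  assumes P: "P \<in> carrier_mat n n" and v: "v \<in> carrier_vec n"
  shows "(diag_proj n A * P * diag_proj n A) *\<^sub>v v = diag_proj n A *\<^sub>v (P *\<^sub>v (diag_proj n A *\<^sub>v v))"
proof -
  have Q: "diag_proj n A \<in> carrier_mat n n" by simp
  show ?thesis
    using assoc_mult_mat_vec[OF mult_carrier_mat[OF Q P] Q v]
      assoc_mult_mat_vec[OF Q P mult_mat_vec_carrier[OF Q v]] by simp
qed

lemma mat_adjoint_index:
  assumes "A \<in> carrier_mat n n" "i < n" "j < n"
  shows "mat_adjoint A $$ (i, j) = cnj (A $$ (j, i))"
  using assms by (simp add: mat_adjoint_def mat_of_rows_def cols_def)

section \<open>Splitting Bessel families of small vectors\<close>

text \<open>
  The condition on projections in the equivalence to be proved, for fixed constants.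
\<close>

definition pavable_projections :: "real \<Rightarrow> real \<Rightarrow> nat \<Rightarrow> bool" where
  "pavable_projections \<delta> \<epsilon> r \<longleftrightarrow>
      (\<forall>n\<ge>1. \<forall>P. orthogonal_projection n P \<and> max_diag P \<le> \<delta> \<and>
        (\<forall>i<n. \<forall>j<n. l2norm_vec (P *\<^sub>v unit_vec n i) = l2norm_vec (P *\<^sub>v unit_vec n j)) \<longrightarrow>
        (\<exists>A. is_partition n r A \<and>
          (\<forall>j\<in>{1..r}. opnorm_mat (diag_proj n (A j) * P * diag_proj n (A j)) \<le> 1 - \<epsilon>)))"

text \<open>
  The Gram matrix \<open>P = W W\<^sup>*\<close> of a Parseval frame is a projection with diagonal \<open>1 / K\<close>. On a block
  \<open>Q\<close>, the norm of \<open>Q P Q = (Q W) (Q W)\<^sup>*\<close> is the squared norm of \<open>Q W\<close>, the analysis map of the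
  class. In the proof \<open>y\<close> is the image of \<open>u\<close> under this map and \<open>z = (Q W)\<^sup>* y\<close>.
\<close>

lemma paving_parseval_frame:
  assumes pav: "pavable_projections \<delta> \<epsilon> r" and eps: "\<epsilon> < 1"
    and K: "0 < K" "1 / K \<le> \<delta>" and L: "1 \<le> L"
    and parseval: "\<And>\<alpha> \<beta>. \<alpha> < M \<Longrightarrow> \<beta> < M \<Longrightarrow> (\<Sum>p<L. cnj (w p \<alpha>) * w p \<beta>) = (if \<alpha> = \<beta> then 1 else 0)"
    and wn: "\<And>p. p < L \<Longrightarrow> sqnorm M (w p) = 1 / K"
  shows "\<exists>c. (\<forall>p::nat. c p < Suc r) \<and> (\<forall>\<kappa>. bessel L M (\<lambda>p \<alpha>. if c p = \<kappa> then w p \<alpha> else 0) (1 - \<epsilon>))"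
proof -
  define P where "P = Matrix.mat L L (\<lambda>(p, s). \<Sum>\<alpha><M. w p \<alpha> * cnj (w s \<alpha>))"
  have Pc: "P \<in> carrier_mat L L" by (simp add: P_def)
  have Pi: "P $$ (p, s) = (\<Sum>\<alpha><M. w p \<alpha> * cnj (w s \<alpha>))" if "p < L" "s < L" for p s
    using that by (simp add: P_def)
  have Pd: "P $$ (p, p) = complex_of_real (1 / K)" if "p < L" for p
  proof -
    have "P $$ (p, p) = of_real (sqnorm M (w p))"
      using that by (simp only: Pi of_real_sum mult.commute[of "w _ _"] cnj_mult_self)
    then show ?thesis using wn[OF that] by simp
  qed
  have PPi: "(\<Sum>t<L. P $$ (p, t) * P $$ (t, s)) = P $$ (p, s)" if ps: "p < L" "s < L" for p s
  proof -
    have "(\<Sum>t<L. P $$ (p, t) * P $$ (t, s)) =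
        (\<Sum>t<L. \<Sum>\<alpha><M. \<Sum>\<beta><M. w p \<alpha> * cnj (w s \<beta>) * (cnj (w t \<alpha>) * w t \<beta>))"
      using ps by (intro sum.cong refl) (simp add: Pi sum_product, simp only: mult_ac)
    also have "\<dots> = (\<Sum>\<alpha><M. \<Sum>t<L. \<Sum>\<beta><M. w p \<alpha> * cnj (w s \<beta>) * (cnj (w t \<alpha>) * w t \<beta>))"
      by (rule sum.swap)
    also have "\<dots> = (\<Sum>\<alpha><M. \<Sum>\<beta><M. \<Sum>t<L. w p \<alpha> * cnj (w s \<beta>) * (cnj (w t \<alpha>) * w t \<beta>))"
      by (intro sum.cong refl sum.swap)
    also have "\<dots> = (\<Sum>\<alpha><M. \<Sum>\<beta><M. if \<alpha> = \<beta> then w p \<alpha> * cnj (w s \<alpha>) else 0)"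
      by (intro sum.cong refl) (simp add: parseval flip: sum_distrib_left)
    also have "\<dots> = P $$ (p, s)"
      using ps by (simp add: Pi)
    finally show ?thesis .
  qed
  have PP: "P * P = P"
    using Pc by (intro eq_matI) (auto simp: scalar_prod_def PPi atLeast0LessThan)
  have adj: "mat_adjoint P $$ (i, j) = P $$ (i, j)" if "i < L" "j < L" for i j
    using that by (simp add: mat_adjoint_index[OF Pc] Pi mult.commute)
  have PA: "mat_adjoint P = P"
    by (rule eq_matI) (use Pc adj in \<open>auto simp: mat_adjoint_def\<close>)
  have md: "max_diag P \<le> \<delta>"
  proof -
    have "(\<lambda>i. cmod (P $$ (i, i))) ` {..<dim_row P} = {1 / K}"
    proof -
      have "cmod (P $$ (i, i)) = 1 / K" if "i < L" for i
        using K unfolding Pd[OF that] norm_of_real by simp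
      moreover have "{..<dim_row P} = {..<L}" "{..<L} \<noteq> {}" using Pc L by (auto simp: lessThan_empty_iff)
      ultimately show ?thesis by (auto simp: image_constant_conv)
    qed
    then show ?thesis using K by (simp add: max_diag_def)
  qed
  have en: "l2norm_vec (P *\<^sub>v unit_vec L i) = sqrt (1 / K)" if i: "i < L" for i
  proof -
    have "complex_of_real ((l2norm_vec (P *\<^sub>v unit_vec L i))\<^sup>2) = (\<Sum>j<L. cnj (P $$ (j, i)) * P $$ (j, i))"
      unfolding l2norm_vec_power2 using Pc i by (simp add: cnj_mult_self)
    also have "\<dots> = (\<Sum>j<L. P $$ (i, j) * P $$ (j, i))"
      using i adj by (intro sum.cong refl) (simp flip: mat_adjoint_index[OF Pc])
    also have "\<dots> = complex_of_real (1 / K)" using i by (simp add: PPi Pd)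
    finally have "(l2norm_vec (P *\<^sub>v unit_vec L i))\<^sup>2 = 1 / K" by (simp only: of_real_eq_iff)
    then show ?thesis by (metis l2norm_vec_nonneg real_sqrt_unique)
  qed
  have "orthogonal_projection L P \<and> max_diag P \<le> \<delta> \<and>
        (\<forall>i<L. \<forall>j<L. l2norm_vec (P *\<^sub>v unit_vec L i) = l2norm_vec (P *\<^sub>v unit_vec L j))"
    using Pc PP PA md en by (simp add: orthogonal_projection_def)
  then obtain A where A: "is_partition L r A"
      and An: "\<And>j. j \<in> {1..r} \<Longrightarrow> opnorm_mat (diag_proj L (A j) * P * diag_proj L (A j)) \<le> 1 - \<epsilon>"
    using pav L unfolding pavable_projections_def by blast
  define c where "c p = (if p < L then SOME j. j \<in> {1..r} \<and> p \<in> A j else 0)" for p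
  have cA: "c p \<in> {1..r} \<and> p \<in> A (c p)" if "p < L" for p
  proof -
    have "\<exists>j. j \<in> {1..r} \<and> p \<in> A j" using A that unfolding is_partition_def by blast
    then show ?thesis unfolding c_def using that by (simp only: if_True) (rule someI_ex)
  qed
  have "c p < Suc r" for p using cA[of p] by (cases "p < L") (auto simp: c_def)
  moreover have "bessel L M (\<lambda>p \<alpha>. if c p = \<kappa> then w p \<alpha> else 0) (1 - \<epsilon>)" for \<kappa>
    unfolding bessel_def
  proof
    fix u :: "nat \<Rightarrow> complex"
    define y where "y p = (\<Sum>\<alpha><M. (if c p = \<kappa> then w p \<alpha> else 0) * u \<alpha>)" for p
    define z where "z \<alpha> = (\<Sum>p<L. y p * cnj (w p \<alpha>))" for \<alpha>
    let ?Z = "\<Sum>\<alpha><M. (cmod (z \<alpha>))\<^sup>2"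
    define S where "S = sqnorm L y"
    define U where "U = sqnorm M u"
    have S0: "0 \<le> S" and U0: "0 \<le> U" by (simp_all add: S_def U_def sum_nonneg)
    have supp: "y p = 0" if "p < L" "p \<notin> A \<kappa>" for p
      using cA[of p] that by (auto simp: y_def intro!: sum.neutral)
    have "complex_of_real S = (\<Sum>p<L. cnj (y p) * y p)" by (simp only: S_def of_real_sum cnj_mult_self)
    also have "\<dots> = (\<Sum>p<L. \<Sum>\<alpha><M. cnj (y p * cnj (w p \<alpha>)) * u \<alpha>)"
    proof (rule sum.cong[OF refl])
      fix p
      show "cnj (y p) * y p = (\<Sum>\<alpha><M. cnj (y p * cnj (w p \<alpha>)) * u \<alpha>)"
      proof (cases "c p = \<kappa>")
        case True
        then have "y p = (\<Sum>\<alpha><M. w p \<alpha> * u \<alpha>)" by (simp add: y_def)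
        then have "cnj (y p) * y p = (\<Sum>\<alpha><M. cnj (y p) * (w p \<alpha> * u \<alpha>))" by (metis sum_distrib_left)
        then show ?thesis by (simp add: mult_ac)
      next
        case False
        then have "y p = 0" by (simp add: y_def)
        then show ?thesis by simp
      qed
    qed
    also have "\<dots> = (\<Sum>\<alpha><M. cnj (z \<alpha>) * u \<alpha>)"
      unfolding z_def cnj_sum sum_distrib_right by (rule sum.swap)
    finally have Sz: "complex_of_real S = (\<Sum>\<alpha><M. cnj (z \<alpha>) * u \<alpha>)" .
    have "S\<^sup>2 = (cmod (\<Sum>\<alpha><M. cnj (z \<alpha>) * u \<alpha>))\<^sup>2"
      unfolding Sz[symmetric] by simp
    also have "\<dots> \<le> ?Z * U"
      unfolding U_def using cmod_sum_mult_le[of "\<lambda>\<alpha>. cnj (z \<alpha>)" u "{..<M}"] by simp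
    finally have SU: "S\<^sup>2 \<le> ?Z * U" .
    define Y where "Y = Matrix.vec L y"
    have Yc: "Y \<in> carrier_vec L" and Yi: "\<And>p. p < L \<Longrightarrow> Y $ p = y p" by (simp_all add: Y_def)
    have QY: "diag_proj L (A \<kappa>) *\<^sub>v Y = Y"
      unfolding diag_proj_mult_vec[OF Yc] by (rule eq_vecI) (auto simp: Y_def supp)
    define X where "X = (diag_proj L (A \<kappa>) * P * diag_proj L (A \<kappa>)) *\<^sub>v Y"
    have Xi: "X $ p = (if p \<in> A \<kappa> then \<Sum>\<alpha><M. w p \<alpha> * z \<alpha> else 0)" if p: "p < L" for p
    proof -
      have "(P *\<^sub>v Y) $ p = (\<Sum>s<L. \<Sum>\<alpha><M. w p \<alpha> * (y s * cnj (w s \<alpha>)))"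
        unfolding mult_mat_vec_index[OF Pc Yc p] using p
        by (intro sum.cong refl) (simp add: Pi Yi sum_distrib_left sum_distrib_right mult_ac)
      also have "\<dots> = (\<Sum>\<alpha><M. \<Sum>s<L. w p \<alpha> * (y s * cnj (w s \<alpha>)))" by (rule sum.swap)
      also have "\<dots> = (\<Sum>\<alpha><M. w p \<alpha> * z \<alpha>)" by (simp add: z_def sum_distrib_left)
      finally show ?thesis
        using p mult_mat_vec_carrier[OF Pc Yc]
        by (simp add: X_def compression_mult_vec[OF Pc Yc] QY diag_proj_mult_vec del: index_mult_mat_vec)
    qed
    have Xd: "dim_vec X = L" by (simp add: X_def diag_proj_def)
    have "complex_of_real ?Z = (\<Sum>\<alpha><M. cnj (z \<alpha>) * z \<alpha>)"
      by (simp only: of_real_sum cnj_mult_self)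
    also have "\<dots> = (\<Sum>\<alpha><M. \<Sum>p<L. cnj (y p) * (w p \<alpha> * z \<alpha>))"
    proof (rule sum.cong[OF refl])
      fix \<alpha>
      have "cnj (z \<alpha>) = (\<Sum>p<L. cnj (y p) * w p \<alpha>)" by (simp add: z_def)
      then show "cnj (z \<alpha>) * z \<alpha> = (\<Sum>p<L. cnj (y p) * (w p \<alpha> * z \<alpha>))"
        by (simp only: sum_distrib_right mult.assoc)
    qed
    also have "\<dots> = (\<Sum>p<L. \<Sum>\<alpha><M. cnj (y p) * (w p \<alpha> * z \<alpha>))" by (rule sum.swap)
    also have "\<dots> = (\<Sum>p<L. cnj (y p) * X $ p)"
      by (intro sum.cong refl) (auto simp: Xi supp sum_distrib_left)
    finally have zX: "complex_of_real ?Z = (\<Sum>p<L. cnj (y p) * X $ p)" .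
    have "?Z\<^sup>2 = (cmod (\<Sum>p<L. cnj (y p) * X $ p))\<^sup>2"
      unfolding zX[symmetric] by (simp only: norm_of_real power2_abs)
    also have "\<dots> \<le> S * (l2norm_vec X)\<^sup>2"
      unfolding S_def l2norm_vec_power2 Xd using cmod_sum_mult_le[of "\<lambda>p. cnj (y p)" "\<lambda>p. X $ p" "{..<L}"] by simp
    also have "\<dots> \<le> S * ((1 - \<epsilon>)\<^sup>2 * S)"
    proof (intro mult_left_mono S0)
      have YS: "(l2norm_vec Y)\<^sup>2 = S" by (simp add: l2norm_vec_power2 Y_def S_def)
      show "(l2norm_vec X)\<^sup>2 \<le> (1 - \<epsilon>)\<^sup>2 * S"
      proof (cases "\<kappa> \<in> {1..r}")
        case True
        have "l2norm_vec X \<le> opnorm_mat (diag_proj L (A \<kappa>) * P * diag_proj L (A \<kappa>)) * l2norm_vec Y"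
          unfolding X_def
          by (rule l2norm_le_opnorm[OF _ Yc]) (intro mult_carrier_mat[of _ _ L] Pc diag_proj_carrier)
        also have "\<dots> \<le> (1 - \<epsilon>) * l2norm_vec Y"
          by (intro mult_right_mono An True) simp
        finally have "(l2norm_vec X)\<^sup>2 \<le> ((1 - \<epsilon>) * l2norm_vec Y)\<^sup>2"
          by (rule power_mono) simp
        then show ?thesis by (simp add: power_mult_distrib YS)
      next
        case False
        then have "y p = 0" if "p < L" for p
          using cA[OF that] by (auto simp: y_def intro!: sum.neutral)
        then have "z \<alpha> = 0" for \<alpha> by (simp add: z_def)
        then have "(l2norm_vec X)\<^sup>2 = 0" by (simp add: l2norm_vec_power2 Xd Xi)
        then show ?thesis using S0 by simp
      qed
    qed
    also have "\<dots> = ((1 - \<epsilon>) * S)\<^sup>2" by (simp add: power2_eq_square mult_ac)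
    finally have "?Z \<le> (1 - \<epsilon>) * S"
      by (rule power2_le_imp_le) (use eps S0 in simp)
    then have "S\<^sup>2 \<le> (1 - \<epsilon>) * S * U"
      by (intro order_trans[OF SU] mult_right_mono U0)
    then have "S * S \<le> S * ((1 - \<epsilon>) * U)" by (simp add: power2_eq_square mult_ac)
    then have "S \<le> (1 - \<epsilon>) * U"
    proof (cases "S = 0")
      case True
      then show ?thesis using eps U0 by simp
    next
      case False
      then show ?thesis using S0 \<open>S * S \<le> S * ((1 - \<epsilon>) * U)\<close> by (simp add: mult_le_cancel_left)
    qed
    then show "(\<Sum>p<L. (cmod (\<Sum>\<alpha><M. (if c p = \<kappa> then w p \<alpha> else 0) * u \<alpha>))\<^sup>2) \<le> (1 - \<epsilon>) * sqnorm M u"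
      by (simp add: S_def U_def y_def)
  qed
  ultimately show ?thesis by blast
qed

text \<open>
  Classes are formed by replacing the vectors of the other colours by \<open>0\<close>, so that the index set
  stays \<open>{..<n}\<close>.
\<close>

definition bessel_paving :: "real \<Rightarrow> real \<Rightarrow> nat \<Rightarrow> bool" where
  "bessel_paving d q r \<longleftrightarrow>
    (\<forall>n m v. bessel n m v 1 \<and> (\<forall>i<n. sqnorm m (v i) \<le> d) \<longrightarrow>
      (\<exists>c. (\<forall>i::nat. c i < r) \<and> (\<forall>\<kappa>. bessel n m (\<lambda>i k. if c i = \<kappa> then v i k else 0) q)))"

lemma norm_add_mult_power2_le:
  fixes a b :: complex
  assumes d: "0 < d" and s: "s\<^sup>2 \<le> d" "0 \<le> s"
  shows "(cmod (a + of_real s * b))\<^sup>2 \<le> (1 + d) * ((cmod a)\<^sup>2 + (cmod b)\<^sup>2)"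
proof -
  have "cmod (a + of_real s * b) \<le> cmod a + s * cmod b"
    using norm_triangle_ineq[of a "of_real s * b"] s by (simp add: norm_mult)
  then have "(cmod (a + of_real s * b))\<^sup>2 \<le> (cmod a + s * cmod b)\<^sup>2"
    by (rule power_mono) simp
  also have "\<dots> \<le> (1 + s\<^sup>2) * ((cmod a)\<^sup>2 + (cmod b)\<^sup>2)"
  proof -
    have "0 \<le> (s * cmod a - cmod b)\<^sup>2" by simp
    then show ?thesis by (simp add: power2_eq_square algebra_simps)
  qed
  also have "\<dots> \<le> (1 + d) * ((cmod a)\<^sup>2 + (cmod b)\<^sup>2)"
    using s by (intro mult_right_mono) auto
  finally show ?thesis .
qed

text \<open>
  Each vector gets a component in a new direction of its own that raises its squared norm to exactly
  \<open>d = 1 / (K - 1)\<close>. This raises the Bessel bound to at most \<open>1 + d\<close>, and dividing it out leaves squared norm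
  \<open>d / (1 + d) = 1 / K \<le> \<delta>\<close>, as \<open>parseval_completion\<close> wants. Undoing the scaling turns the bound \<open>1 - \<epsilon>\<close> for a
  class into \<open>q = (1 - \<epsilon>) (1 + d)\<close>, which is below \<open>1\<close> as soon as \<open>d < \<epsilon>\<close>.
\<close>

lemma bessel_paving_of_pavable_projections:
  assumes pav: "pavable_projections \<delta> \<epsilon> r" and delta: "0 < \<delta>" and eps: "0 < \<epsilon>" "\<epsilon> < 1"
  shows "\<exists>d q r. 0 < d \<and> 0 < q \<and> q < 1 \<and> bessel_paving d q r"
proof -
  obtain K :: nat where Kb: "2 + 1 / \<delta> + 1 / \<epsilon> < real K"
    using reals_Archimedean2 by blast
  have pos: "0 < 1 / \<delta>" "0 < 1 / \<epsilon>" using delta eps by simp_all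
  have K2: "2 \<le> K" using Kb pos by linarith
  have Kr: "1 < real K" using K2 by simp
  have K\<delta>: "1 / K \<le> \<delta>"
  proof -
    have "1 / \<delta> < K" using Kb pos by linarith
    then show ?thesis using delta Kr by (simp add: field_simps)
  qed
  define d where "d = 1 / (real K - 1)"
  have d0: "0 < d" using Kr by (simp add: d_def)
  have d\<epsilon>: "d < \<epsilon>"
  proof -
    have "1 / \<epsilon> < real K - 1" using Kb pos by linarith
    then show ?thesis using eps Kr by (simp add: d_def field_simps)
  qed
  have dK: "d / (1 + d) = 1 / K" using Kr by (simp add: d_def field_simps)
  define q where "q = (1 - \<epsilon>) * (1 + d)"
  have q0: "0 < q" using eps d0 by (simp add: q_def)
  have "q < (1 - \<epsilon>) * (1 + \<epsilon>)" unfolding q_def using eps d\<epsilon> by (intro mult_strict_left_mono) auto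
  also have "\<dots> \<le> 1" by (simp add: algebra_simps)
  finally have q1: "q < 1" .
  have "bessel_paving d q (Suc r)"
    unfolding bessel_paving_def
  proof (intro allI impI, elim conjE)
    fix n m :: nat and v :: "nat \<Rightarrow> nat \<Rightarrow> complex"
    assume bes: "bessel n m v 1" and small: "\<forall>i<n. sqnorm m (v i) \<le> d"
    show "\<exists>c. (\<forall>i. c i < Suc r) \<and> (\<forall>\<kappa>. bessel n m (\<lambda>i k. if c i = \<kappa> then v i k else 0) q)"
    proof (cases "n = 0")
      case True
      then show ?thesis
        using q0 by (intro exI[of _ "\<lambda>_. 0"]) (simp add: bessel_def sum_nonneg)
    next
      case False
      define s where "s i = sqrt (d - sqnorm m (v i))" for i
      have s2: "(s i)\<^sup>2 = d - sqnorm m (v i)" "0 \<le> s i" if "i < n" for i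
        using small that by (auto simp: s_def)
      have sd: "(s i)\<^sup>2 \<le> d" if "i < n" for i using s2[OF that] by (simp add: sum_nonneg)
      define e where "e = 1 / sqrt (1 + d)"
      have e2: "e\<^sup>2 = 1 / (1 + d)" and e0: "0 < e" using d0 by (simp_all add: e_def power_divide)
      define v' where "v' i k = complex_of_real e * (if k < m then v i k else if k = m + i then of_real (s i) else 0)" for i k
      have v'u: "(\<Sum>k<m + n. v' i k * u k) = of_real e * ((\<Sum>k<m. v i k * u k) + of_real (s i) * u (m + i))"
        if "i < n" for i u
        unfolding sum_lessThan_add using that
        by (simp add: v'_def sum_distrib_left distrib_left mult.assoc if_distrib if_distribR cong: if_cong)
      have bes': "bessel n (m + n) v' 1"
        unfolding bessel_def
      proof
        fix u :: "nat \<Rightarrow> complex"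
        have "(\<Sum>i<n. (cmod (\<Sum>k<m + n. v' i k * u k))\<^sup>2) =
            (\<Sum>i<n. (cmod ((\<Sum>k<m. v i k * u k) + of_real (s i) * u (m + i)))\<^sup>2 / (1 + d))"
          using e0 by (intro sum.cong refl) (simp add: v'u norm_mult power_mult_distrib e2)
        also have "\<dots> \<le> (\<Sum>i<n. (cmod (\<Sum>k<m. v i k * u k))\<^sup>2 + (cmod (u (m + i)))\<^sup>2)"
        proof (rule sum_mono)
          fix i assume "i \<in> {..<n}"
          then have i: "i < n" by simp
          show "(cmod ((\<Sum>k<m. v i k * u k) + of_real (s i) * u (m + i)))\<^sup>2 / (1 + d) \<le> (cmod (\<Sum>k<m. v i k * u k))\<^sup>2 + (cmod (u (m + i)))\<^sup>2"
            using norm_add_mult_power2_le[OF d0 sd[OF i] s2(2)[OF i], of "\<Sum>k<m. v i k * u k" "u (m + i)"] d0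
            by (simp add: field_simps)
        qed
        also have "\<dots> \<le> sqnorm m u + (\<Sum>i<n. (cmod (u (m + i)))\<^sup>2)"
          using bes by (simp add: sum.distrib bessel_def)
        finally show "(\<Sum>i<n. (cmod (\<Sum>k<m + n. v' i k * u k))\<^sup>2) \<le> 1 * sqnorm (m + n) u"
          by (simp add: sum_lessThan_add)
      qed
      have nrm: "sqnorm (m + n) (v' i) = 1 / K" if "i < n" for i
      proof -
        have "sqnorm (m + n) (v' i) = e\<^sup>2 * sqnorm m (v i) + (\<Sum>l<n. if l = i then e\<^sup>2 * (s i)\<^sup>2 else 0)"
          unfolding sum_lessThan_add sum_distrib_left
          by (intro arg_cong2[of _ _ _ _ "(+)"] sum.cong refl) (auto simp: v'_def norm_mult power_mult_distrib)
        also have "\<dots> = d / (1 + d)" using that by (simp add: s2 e2 flip: add_divide_distrib)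
        finally show ?thesis using dK by simp
      qed
      obtain w where w:
          "\<forall>\<alpha><(m + n) * (m + n). \<forall>\<beta><(m + n) * (m + n).
            (\<Sum>p<K * (m + n) * (m + n). cnj (w p \<alpha>) * w p \<beta>) = (if \<alpha> = \<beta> then 1 else 0)"
          "\<forall>p<K * (m + n) * (m + n). sqnorm ((m + n) * (m + n)) (w p) = 1 / K"
          "\<forall>i<n. \<forall>\<alpha><(m + n) * (m + n). w i \<alpha> = (if \<alpha> < m + n then v' i \<alpha> else 0)"
        using parseval_completion[OF bes' K2 le_add2 nrm] by blast
      define L where "L = K * (m + n) * (m + n)"
      define M where "M = (m + n) * (m + n)"
      have mM: "m + n \<le> M" unfolding M_def using le_square[of "m + n"] by simp
      have "1 * M \<le> K * M" using K2 by (intro mult_right_mono) auto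
      moreover have "L = K * M" by (simp only: L_def M_def mult.assoc)
      ultimately have nL: "n \<le> L" using mM by linarith
      have L1: "1 \<le> L" using nL False by linarith
      have "\<exists>c. (\<forall>p::nat. c p < Suc r) \<and> (\<forall>\<kappa>. bessel L M (\<lambda>p \<alpha>. if c p = \<kappa> then w p \<alpha> else 0) (1 - \<epsilon>))"
        by (rule paving_parseval_frame[OF pav eps(2) _ K\<delta> L1]) (use K2 w in \<open>auto simp: L_def M_def\<close>)
      then obtain c where c: "\<And>p. c p < Suc r"
        and cb: "\<And>\<kappa>. bessel L M (\<lambda>p \<alpha>. if c p = \<kappa> then w p \<alpha> else 0) (1 - \<epsilon>)" by blast
      have "bessel n m (\<lambda>i k. if c i = \<kappa> then v i k else 0) q" for \<kappa>
        unfolding bessel_def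
      proof
        fix u :: "nat \<Rightarrow> complex"
        define u' where "u' \<alpha> = (if \<alpha> < m then u \<alpha> else 0)" for \<alpha>
        have restrict: "(\<Sum>\<alpha><M. f \<alpha>) = (\<Sum>\<alpha><m. f \<alpha>)" if "\<And>\<alpha>. m \<le> \<alpha> \<Longrightarrow> f \<alpha> = 0" for f :: "nat \<Rightarrow> complex"
          using mM that by (intro sum.mono_neutral_right) auto
        have tm: "(cmod (\<Sum>\<alpha><M. (if c i = \<kappa> then w i \<alpha> else 0) * u' \<alpha>))\<^sup>2 =
            (cmod (\<Sum>k<m. (if c i = \<kappa> then v i k else 0) * u k))\<^sup>2 / (1 + d)" if "i < n" for i
        proof -
          have "(\<Sum>\<alpha><M. (if c i = \<kappa> then w i \<alpha> else 0) * u' \<alpha>) = (\<Sum>k<m. (if c i = \<kappa> then w i k else 0) * u' k)"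
            by (rule restrict) (simp add: u'_def)
          also have "\<dots> = of_real e * (\<Sum>k<m. (if c i = \<kappa> then v i k else 0) * u k)"
            unfolding sum_distrib_left
          proof (rule sum.cong[OF refl])
            fix k assume "k \<in> {..<m}"
            then have k: "k < m" by simp
            then have "k < (m + n) * (m + n)" using mM unfolding M_def by linarith
            then have "w i k = v' i k" using w(3) that k by simp
            then show "(if c i = \<kappa> then w i k else 0) * u' k = of_real e * ((if c i = \<kappa> then v i k else 0) * u k)"
              using k by (simp add: u'_def v'_def)
          qed
          finally show ?thesis using e0 by (simp add: norm_mult power_mult_distrib e2)
        qed
        have "(\<Sum>i<n. (cmod (\<Sum>k<m. (if c i = \<kappa> then v i k else 0) * u k))\<^sup>2 / (1 + d)) \<le>
            (\<Sum>p<L. (cmod (\<Sum>\<alpha><M. (if c p = \<kappa> then w p \<alpha> else 0) * u' \<alpha>))\<^sup>2)"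
          unfolding lessThan_iff[symmetric] using nL
          by (subst sum.cong[OF refl tm[symmetric]]) (auto intro!: sum_mono2)
        also have "\<dots> \<le> (1 - \<epsilon>) * sqnorm M u'"
          using cb unfolding bessel_def by blast
        also have "sqnorm M u' = sqnorm m u"
          using mM by (intro sum.mono_neutral_cong_right) (auto simp: u'_def)
        finally show "(\<Sum>i<n. (cmod (\<Sum>k<m. (if c i = \<kappa> then v i k else 0) * u k))\<^sup>2) \<le> q * sqnorm m u"
          using d0 by (simp add: q_def field_simps flip: sum_divide_distrib)
      qed
      then show ?thesis using c by blast
    qed
  qed
  then show ?thesis using d0 q0 q1 by blast
qed

text \<open>
  A class with bound \<open>q ^ k\<close> is rescaled to bound \<open>1\<close>; its squared norms grow by \<open>1 / q ^ k\<close> and still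
  do not exceed \<open>d\<close>, so the class can be split again.
\<close>

lemma bessel_paving_iterate:
  assumes pav: "bessel_paving d q r" and d: "0 < d" and q: "0 < q" "q < 1"
  shows "bessel_paving (d * q ^ k) (q ^ k) (r ^ k)"
proof (induction k)
  case 0
  show ?case
    unfolding bessel_paving_def
  proof (intro allI impI, elim conjE)
    fix n m :: nat and v :: "nat \<Rightarrow> nat \<Rightarrow> complex"
    assume "bessel n m v 1"
    then have "bessel n m (\<lambda>i k. if 0 = \<kappa> then v i k else 0) 1" for \<kappa> :: nat
      by (rule bessel_restrict[where P = "\<lambda>_. 0 = \<kappa>"])
    then show "\<exists>c. (\<forall>i::nat. c i < r ^ 0) \<and> (\<forall>\<kappa>. bessel n m (\<lambda>i k. if c i = \<kappa> then v i k else 0) (q ^ 0))"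
      by (intro exI[of _ "\<lambda>_. 0"]) simp
  qed
next
  case (Suc k)
  show ?case
    unfolding bessel_paving_def
  proof (intro allI impI, elim conjE)
    fix n m :: nat and v :: "nat \<Rightarrow> nat \<Rightarrow> complex"
    assume bes: "bessel n m v 1" and small: "\<forall>i<n. sqnorm m (v i) \<le> d * q ^ Suc k"
    have le: "d * q ^ Suc k \<le> d * q ^ k" using d q by simp
    obtain c where c: "\<And>i. c i < r ^ k"
      and cb: "\<And>\<kappa>. bessel n m (\<lambda>i k. if c i = \<kappa> then v i k else 0) (q ^ k)"
    proof -
      have "\<forall>i<n. sqnorm m (v i) \<le> d * q ^ k"
        using small le by (meson order_trans)
      then show ?thesis using that Suc.IH bes unfolding bessel_paving_def by blast
    qed
    define t where "t = 1 / sqrt (q ^ k)"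
    have t2: "t\<^sup>2 = 1 / q ^ k" and t0: "0 < t" using q by (simp_all add: t_def power_divide)
    define v' where "v' \<kappa> i j = complex_of_real t * (if c i = \<kappa> then v i j else 0)" for \<kappa> i j
    have "\<exists>c'. (\<forall>i. c' i < r) \<and> (\<forall>\<mu>. bessel n m (\<lambda>i j. if c' i = \<mu> then v' \<kappa> i j else 0) q)" for \<kappa>
    proof -
      have "bessel n m (v' \<kappa>) 1"
      proof -
        have "v' \<kappa> = (\<lambda>i j. complex_of_real t * (if c i = \<kappa> then v i j else 0))"
          by (intro ext) (simp only: v'_def)
        then show ?thesis using bessel_scale[OF cb[of \<kappa>], of t] q by (simp add: t2)
      qed
      moreover have "(\<Sum>j<m. (cmod (v' \<kappa> i j))\<^sup>2) \<le> d" if "i < n" for i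
      proof -
        have "(\<Sum>j<m. (cmod (v' \<kappa> i j))\<^sup>2) \<le> (\<Sum>j<m. t\<^sup>2 * (cmod (v i j))\<^sup>2)"
          by (intro sum_mono) (auto simp: v'_def norm_mult power_mult_distrib)
        also have "\<dots> \<le> t\<^sup>2 * (d * q ^ Suc k)"
          unfolding sum_distrib_left[symmetric] using small that by (intro mult_left_mono) auto
        also have "\<dots> = d * q" using q by (simp add: t2)
        also have "\<dots> \<le> d" using d q by (simp add: mult_left_le)
        finally show ?thesis .
      qed
      ultimately show ?thesis using pav unfolding bessel_paving_def by blast
    qed
    then have "\<exists>c'. \<forall>\<kappa>. (\<forall>i. c' \<kappa> i < r) \<and> (\<forall>\<mu>. bessel n m (\<lambda>i j. if c' \<kappa> i = \<mu> then v' \<kappa> i j else 0) q)"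
      by (intro choice allI)
    then obtain c' where c': "\<And>\<kappa> i. c' \<kappa> i < r"
      and cb': "\<And>\<kappa> \<mu>. bessel n m (\<lambda>i j. if c' \<kappa> i = \<mu> then v' \<kappa> i j else 0) q"
      by blast
    define C where "C i = c i * r + c' (c i) i" for i
    have "C i < r ^ Suc k" for i
    proof -
      have "C i < Suc (c i) * r" using c'[of "c i" i] by (simp add: C_def)
      also have "\<dots> \<le> r ^ k * r" using c[of i] by (intro mult_right_mono) auto
      finally show ?thesis by (simp add: mult.commute)
    qed
    moreover have "bessel n m (\<lambda>i j. if C i = \<kappa> then v i j else 0) (q ^ Suc k)" for \<kappa>
    proof -
      have Ck: "C i = \<kappa> \<longleftrightarrow> c i = \<kappa> div r \<and> c' (\<kappa> div r) i = \<kappa> mod r" for i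
      proof
        assume "C i = \<kappa>"
        then have "\<kappa> div r = c i" "\<kappa> mod r = c' (c i) i"
          using c'[of "c i" i] unfolding C_def by auto
        then show "c i = \<kappa> div r \<and> c' (\<kappa> div r) i = \<kappa> mod r" by simp
      next
        assume "c i = \<kappa> div r \<and> c' (\<kappa> div r) i = \<kappa> mod r"
        then show "C i = \<kappa>" by (simp add: C_def)
      qed
      have "bessel n m (\<lambda>i j. complex_of_real (1 / t) * (if c' (\<kappa> div r) i = \<kappa> mod r then v' (\<kappa> div r) i j else 0))
          ((1 / t)\<^sup>2 * q)"
        by (rule bessel_scale[OF cb'])
      moreover have "complex_of_real (1 / t) * (if c' (\<kappa> div r) i = \<kappa> mod r then v' (\<kappa> div r) i j else 0) =
          (if C i = \<kappa> then v i j else 0)" for i j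
        using t0 by (auto simp: Ck v'_def)
      moreover have "(1 / t)\<^sup>2 * q = q ^ Suc k" using q by (simp add: power_divide t2)
      ultimately show ?thesis by (simp only:)
    qed
    ultimately show "\<exists>c. (\<forall>i. c i < r ^ Suc k) \<and> (\<forall>\<kappa>. bessel n m (\<lambda>i j. if c i = \<kappa> then v i j else 0) (q ^ Suc k))"
      by blast
  qed
qed

section \<open>Paving Hermitian matrices with zero diagonal\<close>

text \<open>
  In a colouring that minimises the total weight \<open>\<Phi>\<close> of monochromatic pairs, moving \<open>i\<close> to another
  colour cannot help, so the weight from \<open>i\<close> into its own class is at most its weight into any
  class. Averaging over the \<open>m\<close> classes gives the bound.
\<close>

lemma max_cut_coloring:
  fixes w :: "nat \<Rightarrow> nat \<Rightarrow> real"
  assumes sym: "\<And>i j. i < n \<Longrightarrow> j < n \<Longrightarrow> w i j = w j i"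
    and diag: "\<And>i. i < n \<Longrightarrow> w i i = 0" and m: "0 < m"
  shows "\<exists>c. (\<forall>i. c i < m) \<and> (\<forall>i<n. real m * (\<Sum>j<n. if c j = c i then w i j else 0) \<le> (\<Sum>j<n. w i j))"
proof -
  define D where "D = ({..<n} \<rightarrow>\<^sub>E {..<m::nat})"
  define \<Phi> where "\<Phi> c = (\<Sum>i<n. \<Sum>j<n. if c j = c i then w i j else 0)" for c :: "nat \<Rightarrow> nat"
  have finD: "finite D" unfolding D_def by (intro finite_PiE) auto
  have "(\<lambda>i\<in>{..<n}. 0) \<in> D" using m by (auto simp: D_def)
  then have neD: "D \<noteq> {}" by blast
  define c where "c = arg_min_on \<Phi> D"
  have cD: "c \<in> D" unfolding c_def by (rule arg_min_if_finite(1)[OF finD neD])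
  have cmin: "\<Phi> c \<le> \<Phi> c'" if "c' \<in> D" for c'
    unfolding c_def by (rule arg_min_least[OF finD neD that])
  have cm: "c i < m" if "i < n" for i using PiE_mem[OF cD[unfolded D_def], of i] that by simp
  have cu: "c i = undefined" if "\<not> i < n" for i using PiE_arb[OF cD[unfolded D_def], of i] that by simp
  have step: "(\<Sum>j<n. if c j = c i then w i j else 0) \<le> (\<Sum>j<n. if c j = \<kappa> then w i j else 0)"
    if i: "i < n" and \<kappa>: "\<kappa> < m" for i \<kappa>
  proof -
    let ?I = "{..<n} - {i}"
    define c' where "c' = c(i := \<kappa>)"
    have c'D: "c' \<in> D" unfolding D_def c'_def
      using i \<kappa> by (intro PiE_I) (simp_all add: cm cu)
    have decomp: "\<Phi> f = (\<Sum>i'\<in>?I. \<Sum>j\<in>?I. if f j = f i' then w i' j else 0)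
        + 2 * (\<Sum>j\<in>?I. if f j = f i then w i j else 0)" for f
    proof -
      have fin: "finite {..<n}" and mem: "i \<in> {..<n}" using i by auto
      have row: "(\<Sum>j<n. if f j = f i' then w i' j else 0) =
          (if f i = f i' then w i i' else 0) + (\<Sum>j\<in>?I. if f j = f i' then w i' j else 0)" if "i' < n" for i'
        by (simp only: sum.remove[OF fin mem] sym[OF i that])
      have "\<Phi> f = (\<Sum>i'<n. (if f i = f i' then w i i' else 0) + (\<Sum>j\<in>?I. if f j = f i' then w i' j else 0))"
        unfolding \<Phi>_def by (intro sum.cong refl) (simp only: row lessThan_iff)
      also have "\<dots> = (\<Sum>j\<in>?I. if f j = f i then w i j else 0) +
         (\<Sum>i'\<in>?I. (if f i = f i' then w i i' else 0) + (\<Sum>j\<in>?I. if f j = f i' then w i' j else 0))"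
        unfolding sum.remove[OF fin mem] using diag[OF i] by simp
      also have "(\<Sum>i'\<in>?I. (if f i = f i' then w i i' else 0) + (\<Sum>j\<in>?I. if f j = f i' then w i' j else 0)) =
         (\<Sum>j\<in>?I. if f j = f i then w i j else 0) +
         (\<Sum>i'\<in>?I. \<Sum>j\<in>?I. if f j = f i' then w i' j else 0)"
        unfolding sum.distrib by (simp only: eq_commute[of "f i"])
      finally show ?thesis by simp
    qed
    have same: "(\<Sum>i'\<in>?I. \<Sum>j\<in>?I. if c' j = c' i' then w i' j else 0) =
        (\<Sum>i'\<in>?I. \<Sum>j\<in>?I. if c j = c i' then w i' j else 0)"
      by (intro sum.cong refl) (auto simp: c'_def)
    have own: "(\<Sum>j\<in>?I. if c' j = c' i then w i j else 0) = (\<Sum>j\<in>?I. if c j = \<kappa> then w i j else 0)"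
      by (intro sum.cong refl) (auto simp: c'_def)
    have drop: "(\<Sum>j<n. if P j then w i j else 0) = (\<Sum>j\<in>?I. if P j then w i j else 0)" for P
      using i diag[OF i] by (subst sum.remove[of _ i]) auto
    show ?thesis
      using cmin[OF c'D] unfolding decomp same own drop by simp
  qed
  define c'' where "c'' i = (if i < n then c i else 0)" for i
  have "c'' i < m" for i using cm m by (simp add: c''_def)
  moreover have "real m * (\<Sum>j<n. if c'' j = c'' i then w i j else 0) \<le> (\<Sum>j<n. w i j)" if i: "i < n" for i
  proof -
    have "real m * (\<Sum>j<n. if c j = c i then w i j else 0) = (\<Sum>\<kappa><m. \<Sum>j<n. if c j = c i then w i j else 0)"
      by simp
    also have "\<dots> \<le> (\<Sum>\<kappa><m. \<Sum>j<n. if c j = \<kappa> then w i j else 0)"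
      by (intro sum_mono step i) simp
    also have "\<dots> = (\<Sum>j<n. \<Sum>\<kappa><m. if c j = \<kappa> then w i j else 0)" by (rule sum.swap)
    also have "\<dots> = (\<Sum>j<n. w i j)" using cm by (intro sum.cong refl) simp
    also have "(\<Sum>j<n. if c j = c i then w i j else 0) = (\<Sum>j<n. if c'' j = c'' i then w i j else 0)"
      using i by (intro sum.cong refl) (simp add: c''_def)
    finally show ?thesis .
  qed
  ultimately show ?thesis by blast
qed

text \<open>
  The vector \<open>x\<close> is supported on the colour class \<open>\<kappa>\<close>, so this bounds the quadratic forms of all
  diagonal blocks.
\<close>

definition block_bound :: "nat \<Rightarrow> (nat \<Rightarrow> nat \<Rightarrow> complex) \<Rightarrow> (nat \<Rightarrow> nat) \<Rightarrow> real \<Rightarrow> bool" where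
  "block_bound n a c \<theta> \<longleftrightarrow>
    (\<forall>\<kappa> x. (\<forall>i<n. c i \<noteq> \<kappa> \<longrightarrow> x i = 0) \<longrightarrow>
      cmod (qform n a x) \<le> \<theta> * sqnorm n x)"

text \<open>
  Cutting a matrix down to its diagonal blocks does not increase its norm: the blocks act on
  orthogonal subspaces.
\<close>

lemma bessel_pinching:
  fixes c :: "nat \<Rightarrow> nat"
  assumes a: "bessel n n a C" and c: "\<And>i. c i < m"
  shows "bessel n n (\<lambda>i j. if c j = c i then a i j else 0) C"
  unfolding bessel_def
proof
  fix u :: "nat \<Rightarrow> complex"
  define u' where "u' \<kappa> j = (if c j = \<kappa> then u j else 0)" for \<kappa> j
  have "(\<Sum>i<n. (cmod (\<Sum>j<n. (if c j = c i then a i j else 0) * u j))\<^sup>2) =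
      (\<Sum>i<n. \<Sum>\<kappa><m. if c i = \<kappa> then (cmod (\<Sum>j<n. a i j * u' \<kappa> j))\<^sup>2 else 0)"
  proof (rule sum.cong[OF refl])
    fix i
    have "(\<Sum>j<n. (if c j = c i then a i j else 0) * u j) = (\<Sum>j<n. a i j * u' (c i) j)"
      by (intro sum.cong refl) (simp add: u'_def)
    then show "(cmod (\<Sum>j<n. (if c j = c i then a i j else 0) * u j))\<^sup>2 =
        (\<Sum>\<kappa><m. if c i = \<kappa> then (cmod (\<Sum>j<n. a i j * u' \<kappa> j))\<^sup>2 else 0)"
      using c[of i] by simp
  qed
  also have "\<dots> = (\<Sum>\<kappa><m. \<Sum>i<n. if c i = \<kappa> then (cmod (\<Sum>j<n. a i j * u' \<kappa> j))\<^sup>2 else 0)"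
    by (rule sum.swap)
  also have "\<dots> \<le> (\<Sum>\<kappa><m. C * sqnorm n (u' \<kappa>))"
  proof (rule sum_mono)
    fix \<kappa>
    have "(\<Sum>i<n. if c i = \<kappa> then (cmod (\<Sum>j<n. a i j * u' \<kappa> j))\<^sup>2 else 0) \<le>
        (\<Sum>i<n. (cmod (\<Sum>j<n. a i j * u' \<kappa> j))\<^sup>2)"
      by (intro sum_mono) simp
    also have "\<dots> \<le> C * sqnorm n (u' \<kappa>)" using a unfolding bessel_def by blast
    finally show "(\<Sum>i<n. if c i = \<kappa> then (cmod (\<Sum>j<n. a i j * u' \<kappa> j))\<^sup>2 else 0) \<le> C * sqnorm n (u' \<kappa>)" .
  qed
  also have "\<dots> = C * (\<Sum>j<n. \<Sum>\<kappa><m. (cmod (u' \<kappa> j))\<^sup>2)"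
    unfolding sum_distrib_left[symmetric] by (simp only: sum.swap[of _ "{..<m}"])
  also have "(\<Sum>j<n. \<Sum>\<kappa><m. (cmod (u' \<kappa> j))\<^sup>2) = sqnorm n u"
  proof (rule sum.cong[OF refl])
    fix j
    have "(\<Sum>\<kappa><m. (cmod (u' \<kappa> j))\<^sup>2) = (\<Sum>\<kappa><m. if c j = \<kappa> then (cmod (u j))\<^sup>2 else 0)"
      by (intro sum.cong refl) (simp add: u'_def)
    then show "(\<Sum>\<kappa><m. (cmod (u' \<kappa> j))\<^sup>2) = (cmod (u j))\<^sup>2" using c[of j] by simp
  qed
  finally show "(\<Sum>i<n. (cmod (\<Sum>j<n. (if c j = c i then a i j else 0) * u j))\<^sup>2) \<le> C * sqnorm n u" .
qed

lemma div_mult_add_unique: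
  fixes a b r :: nat
  assumes "r < b"
  shows "(a * b + r) div b = a" "(a * b + r) mod b = r"
  using assms by simp_all

text \<open>
  The first colouring \<open>c0\<close> makes the rows of the pinched matrix small, and the second colouring
  \<open>c1\<close> splits these rows, scaled by \<open>1 / M\<close>, into classes with Bessel bound \<open>q ^ k\<close>. For \<open>x\<close> supported on a common
  class, the quadratic form pairs \<open>x\<close> with \<open>M y\<close>, where \<open>y\<close> is the image of \<open>x\<close> under the
  analysis map of that class; the Cauchy--Schwarz inequality gives the bound \<open>M (q ^ k)\<^sup>1\<^sup>/\<^sup>2 \<le> \<theta>\<close>.
  The number of colours depends on \<open>M\<close> and \<open>\<theta>\<close> but not on \<open>n\<close>.
\<close>

lemma finite_paving:
  assumes bp: "bessel_paving d q r" and d: "0 < d" and q: "0 < q" "q < 1"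
    and M: "0 < M" and \<theta>: "0 < \<theta>"
  shows "\<exists>R. \<forall>n a. (\<forall>i<n. \<forall>j<n. a j i = cnj (a i j)) \<and> (\<forall>i<n. a i i = 0) \<and> bessel n n a (M\<^sup>2) \<longrightarrow>
      (\<exists>c. (\<forall>i. c i < R) \<and> block_bound n a c \<theta>)"
proof -
  obtain k where k: "q ^ k < \<theta>\<^sup>2 / M\<^sup>2"
    using real_arch_pow_inv[of "\<theta>\<^sup>2 / M\<^sup>2" q] M \<theta> q by auto
  have qk: "0 < q ^ k" "0 < d * q ^ k" using q d by simp_all
  obtain m :: nat where m: "1 / (d * q ^ k) < real m" using reals_Archimedean2 by blast
  have "0 < 1 / (d * q ^ k)" using qk by simp
  then have m0: "0 < real m" using m by linarith
  have m1: "1 / real m \<le> d * q ^ k" using m m0 qk by (simp add: field_simps)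
  show ?thesis
  proof (intro exI[of _ "m * r ^ k"] allI impI, elim conjE)
    fix n and a :: "nat \<Rightarrow> nat \<Rightarrow> complex"
    assume herm: "\<forall>i<n. \<forall>j<n. a j i = cnj (a i j)" and diag: "\<forall>i<n. a i i = 0"
      and bes: "bessel n n a (M\<^sup>2)"
    have cm: "cmod (a j i) = cmod (a i j)" if "i < n" "j < n" for i j
      using herm that by (metis complex_mod_cnj)
    have "\<exists>c. (\<forall>i. c i < m) \<and> (\<forall>i<n. real m * (\<Sum>j<n. if c j = c i then (cmod (a i j))\<^sup>2 else 0) \<le> sqnorm n (a i))"
      by (rule max_cut_coloring) (use cm diag m0 in auto)
    then obtain c0 where c0: "\<And>i. c0 i < m"
      and cut: "\<And>i. i < n \<Longrightarrow> real m * (\<Sum>j<n. if c0 j = c0 i then (cmod (a i j))\<^sup>2 else 0) \<le> sqnorm n (a i)"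
      by blast
    have row: "sqnorm n (a i) \<le> M\<^sup>2" if i: "i < n" for i
    proof -
      define u where "u j = (if j = i then 1 else 0 :: complex)" for j
      have "sqnorm n (a i) = (\<Sum>j<n. (cmod (a j i))\<^sup>2)"
        using i by (intro sum.cong refl) (simp add: cm)
      also have "\<dots> = (\<Sum>j<n. (cmod (\<Sum>l<n. a j l * u l))\<^sup>2)"
        using i by (simp add: u_def if_distrib cong: if_cong)
      also have "\<dots> \<le> M\<^sup>2 * sqnorm n u" using bes unfolding bessel_def by blast
      also have "sqnorm n u = (\<Sum>l<n. if l = i then 1 else 0)"
        by (intro sum.cong refl) (simp add: u_def)
      also have "M\<^sup>2 * \<dots> = M\<^sup>2" using i by simp
      finally show ?thesis .
    qed
    define v where "v i j = complex_of_real (1 / M) * (if c0 j = c0 i then a i j else 0)" for i j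
    have veq: "v = (\<lambda>i j. complex_of_real (1 / M) * (if c0 j = c0 i then a i j else 0))"
      by (intro ext) (simp only: v_def)
    have "bessel n n v ((1 / M)\<^sup>2 * M\<^sup>2)"
      unfolding veq by (intro bessel_scale bessel_pinching[OF bes c0])
    then have vb: "bessel n n v 1" using M by (simp add: power_divide)
    have vs: "sqnorm n (v i) \<le> d * q ^ k" if i: "i < n" for i
    proof -
      have "sqnorm n (v i) = (1 / M)\<^sup>2 * (\<Sum>j<n. if c0 j = c0 i then (cmod (a i j))\<^sup>2 else 0)"
        unfolding sum_distrib_left
        using M by (intro sum.cong refl) (simp add: v_def norm_mult norm_divide power_mult_distrib power_divide)
      also have "\<dots> \<le> (1 / M)\<^sup>2 * (M\<^sup>2 / m)"
        using cut[OF i] row[OF i] m0 by (intro mult_left_mono) (auto simp: field_simps)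
      also have "\<dots> \<le> d * q ^ k" using M m1 by (simp add: power_divide)
      finally show ?thesis .
    qed
    obtain c1 where c1: "\<And>i. c1 i < r ^ k"
      and c1b: "\<And>\<kappa>. bessel n n (\<lambda>i j. if c1 i = \<kappa> then v i j else 0) (q ^ k)"
      using bessel_paving_iterate[OF bp d q, of k] vb vs unfolding bessel_paving_def by blast
    define c where "c i = c0 i * r ^ k + c1 i" for i
    have "c i < m * r ^ k" for i
    proof -
      have "c i < Suc (c0 i) * r ^ k" using c1[of i] by (simp add: c_def)
      also have "\<dots> \<le> m * r ^ k" using c0[of i] by (intro mult_right_mono) auto
      finally show ?thesis .
    qed
    moreover have "block_bound n a c \<theta>"
      unfolding block_bound_def
    proof (intro allI impI)
      fix \<kappa> and x :: "nat \<Rightarrow> complex"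
      assume supp: "\<forall>i<n. c i \<noteq> \<kappa> \<longrightarrow> x i = 0"
      define \<mu> where "\<mu> = \<kappa> mod r ^ k"
      define y where "y i = (\<Sum>j<n. (if c1 i = \<mu> then v i j else 0) * x j)" for i
      define S where "S = sqnorm n x"
      have S0: "0 \<le> S" by (simp add: S_def sum_nonneg)
      have cl: "c0 i = \<kappa> div r ^ k \<and> c1 i = \<mu>" if "i < n" "x i \<noteq> 0" for i
      proof -
        have "\<kappa> = c0 i * r ^ k + c1 i" using supp that c_def by auto
        then show ?thesis unfolding \<mu>_def by (simp only: div_mult_add_unique[OF c1])
      qed
      have "(\<Sum>j<n. cnj (x i) * a i j * x j) = of_real M * (cnj (x i) * y i)" if i: "i < n" for i
      proof (cases "x i = 0")
        case True
        then show ?thesis by simp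
      next
        case False
        have "y i = (\<Sum>j<n. of_real (1 / M) * (a i j * x j))"
          unfolding y_def
        proof (rule sum.cong[OF refl])
          fix j assume "j \<in> {..<n}"
          then show "(if c1 i = \<mu> then v i j else 0) * x j = of_real (1 / M) * (a i j * x j)"
            using cl[OF i False] cl[of j] by (cases "x j = 0") (auto simp: v_def)
        qed
        then have "of_real M * y i = (\<Sum>j<n. a i j * x j)"
          using M by (simp flip: sum_divide_distrib)
        then have "of_real M * (cnj (x i) * y i) = cnj (x i) * (\<Sum>j<n. a i j * x j)"
          by (simp add: mult.left_commute)
        then show ?thesis by (simp add: sum_distrib_left mult.assoc)
      qed
      then have "qform n a x = of_real M * (\<Sum>i<n. cnj (x i) * y i)"
        by (simp add: sum_distrib_left)
      then have "(cmod (qform n a x))\<^sup>2 = M\<^sup>2 * (cmod (\<Sum>i<n. cnj (x i) * y i))\<^sup>2"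
        using M by (simp add: norm_mult power_mult_distrib)
      also have "\<dots> \<le> M\<^sup>2 * (S * sqnorm n y)"
        using cmod_sum_mult_le[of "\<lambda>i. cnj (x i)" y "{..<n}"] by (intro mult_left_mono) (simp_all add: S_def)
      also have "\<dots> \<le> M\<^sup>2 * (S * (q ^ k * S))"
        using c1b[of \<mu>] S0 unfolding bessel_def y_def S_def by (intro mult_left_mono) auto
      also have "\<dots> = (M\<^sup>2 * q ^ k) * S\<^sup>2" by (simp add: power2_eq_square)
      also have "\<dots> \<le> \<theta>\<^sup>2 * S\<^sup>2"
        using k M by (intro mult_right_mono) (simp_all add: field_simps)
      also have "\<dots> = (\<theta> * S)\<^sup>2" by (simp add: power_mult_distrib)
      finally have "cmod (qform n a x) \<le> \<theta> * S"
        by (rule power2_le_imp_le) (use \<theta> S0 in simp)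
      then show "cmod (qform n a x) \<le> \<theta> * sqnorm n x"
        by (simp only: S_def)
    qed
    ultimately show "\<exists>c. (\<forall>i. c i < m * r ^ k) \<and> block_bound n a c \<theta>" by blast
  qed
qed

section \<open>Ultrafilters and infinite matrices\<close>

definition is_ultrafilter :: "'a filter \<Rightarrow> bool" where
  "is_ultrafilter U \<longleftrightarrow> U \<noteq> bot \<and> (\<forall>P. eventually P U \<or> eventually (\<lambda>x. \<not> P x) U)"

lemma ex_ultrafilter_le:
  fixes F :: "'a filter"
  assumes "F \<noteq> bot"
  shows "\<exists>U. U \<le> F \<and> is_ultrafilter U"
proof -
  define A where "A = {G. G \<noteq> bot \<and> G \<le> F}"
  have "\<exists>m\<in>A. \<forall>a\<in>A. a \<le> m \<longrightarrow> a = m"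
  proof (rule predicate_Zorn[where P = "\<lambda>a b. b \<le> a"])
    show "partial_order_on A (relation_of (\<lambda>a b. b \<le> a) A)"
      by (auto simp: partial_order_on_def preorder_on_def refl_on_def trans_def antisym_def relation_of_def)
  next
    fix C assume C: "C \<in> Chains (relation_of (\<lambda>a b. b \<le> a) A)"
    have CA: "C \<subseteq> A" using C by (auto simp: Chains_def relation_of_def)
    show "\<exists>u\<in>A. \<forall>a\<in>C. u \<le> a"
    proof (cases "C = {}")
      case True
      then show ?thesis using assms by (auto simp: A_def)
    next
      case False
      have dir: "\<exists>x\<in>C. x \<le> inf G H" if "G \<in> C" "H \<in> C" for G H
      proof -
        have "H \<le> G \<or> G \<le> H" using C that by (auto simp: Chains_def relation_of_def)
        then show ?thesis using that by (auto intro: bexI[of _ G] bexI[of _ H])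
      qed
      have "Inf C \<noteq> bot"
      proof
        assume "Inf C = bot"
        then have "eventually (\<lambda>_. False) (Inf C)" by simp
        then obtain b where "b \<in> C" "eventually (\<lambda>_. False) b"
          using eventually_Inf_base[OF False dir] by blast
        then show False using CA by (auto simp: A_def trivial_limit_def)
      qed
      moreover obtain G where "G \<in> C" using False by blast
      with CA have "Inf C \<le> F" by (auto simp: A_def intro: Inf_lower2)
      ultimately show ?thesis by (auto simp: A_def intro: Inf_lower)
    qed
  qed
  then obtain U where U: "U \<noteq> bot" "U \<le> F" and max: "\<And>G. G \<noteq> bot \<Longrightarrow> G \<le> F \<Longrightarrow> G \<le> U \<Longrightarrow> G = U"
    unfolding A_def by blast
  have "eventually P U \<or> eventually (\<lambda>x. \<not> P x) U" for P
  proof (cases "inf U (principal {x. P x}) = bot")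
    case True
    then have "eventually (\<lambda>_. False) (inf U (principal {x. P x}))" by simp
    then show ?thesis by (simp add: eventually_inf_principal)
  next
    case False
    then have "inf U (principal {x. P x}) = U" using U by (intro max) (auto intro: le_infI1)
    moreover have "eventually P (inf U (principal {x. P x}))" by (simp add: eventually_inf_principal)
    ultimately show ?thesis by simp
  qed
  then show ?thesis using U unfolding is_ultrafilter_def by blast
qed

lemma ultrafilter_tendsto:
  fixes g :: "'a \<Rightarrow> complex"
  assumes U: "is_ultrafilter U" and B: "eventually (\<lambda>x. cmod (g x) \<le> B) U"
  shows "\<exists>l. (g \<longlongrightarrow> l) U"
proof -
  let ?F = "filtermap g U"
  have "?F \<noteq> bot" using U by (simp add: is_ultrafilter_def filtermap_bot_iff)
  moreover have "eventually (\<lambda>z. z \<in> cball 0 B) ?F" using B by (simp add: eventually_filtermap)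
  ultimately obtain l where l: "inf (nhds l) ?F \<noteq> bot"
    using compact_cball[of "0::complex" B] unfolding compact_filter by blast
  have "(g \<longlongrightarrow> l) U"
  proof (rule topological_tendstoI)
    fix S assume S: "open S" "l \<in> S"
    show "eventually (\<lambda>x. g x \<in> S) U"
    proof (rule ccontr)
      assume "\<not> eventually (\<lambda>x. g x \<in> S) U"
      then have "eventually (\<lambda>x. g x \<notin> S) U" using U unfolding is_ultrafilter_def by blast
      then have "eventually (\<lambda>z. z \<notin> S) ?F" by (simp add: eventually_filtermap)
      moreover have "eventually (\<lambda>z. z \<in> S) (nhds l)" using S by (rule eventually_nhds_in_open)
      ultimately have "eventually (\<lambda>z. False) (inf (nhds l) ?F)" unfolding eventually_inf by blast
      then show False using l by (simp add: trivial_limit_def)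
    qed
  qed
  then show ?thesis by blast
qed

text \<open>
  Along an ultrafilter finer than the cofinite filter, each index has an eventually constant colour,
  and finitely many indices share a common stage.
\<close>

lemma coloring_limit:
  fixes c :: "nat \<Rightarrow> nat \<Rightarrow> nat"
  assumes c: "\<And>N i. c N i < R"
  shows "\<exists>d. (\<forall>i. d i < R) \<and> (\<forall>n. \<exists>N\<ge>n. \<forall>i<n. c N i = d i)"
proof -
  obtain U :: "nat filter" where U: "U \<le> sequentially" "is_ultrafilter U"
    using ex_ultrafilter_le[of sequentially] by auto
  have "\<exists>\<kappa>. \<kappa> < R \<and> eventually (\<lambda>N. c N i = \<kappa>) U" for i
  proof (rule ccontr)
    assume "\<not> (\<exists>\<kappa>. \<kappa> < R \<and> eventually (\<lambda>N. c N i = \<kappa>) U)"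
    then have "\<forall>\<kappa>\<in>{..<R}. eventually (\<lambda>N. c N i \<noteq> \<kappa>) U"
      using U(2) unfolding is_ultrafilter_def by blast
    then have "eventually (\<lambda>N. \<forall>\<kappa>\<in>{..<R}. c N i \<noteq> \<kappa>) U" by (intro eventually_ball_finite) auto
    then have "eventually (\<lambda>N. False) U" by (rule eventually_mono) (use c in blast)
    then show False using U(2) by (simp add: is_ultrafilter_def trivial_limit_def)
  qed
  then have "\<exists>d. \<forall>i. d i < R \<and> eventually (\<lambda>N. c N i = d i) U" by (intro choice allI)
  then obtain d where d: "\<And>i. d i < R" "\<And>i. eventually (\<lambda>N. c N i = d i) U" by blast
  have "\<exists>N\<ge>n. \<forall>i<n. c N i = d i" for n
  proof -
    have "eventually (\<lambda>N. \<forall>i\<in>{..<n}. c N i = d i) U" by (intro eventually_ball_finite) (auto simp: d)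
    moreover have "eventually (\<lambda>N. n \<le> N) U" using U(1) eventually_ge_at_top by (rule filter_leD)
    ultimately have "eventually (\<lambda>N. n \<le> N \<and> (\<forall>i<n. c N i = d i)) U" by eventually_elim auto
    then show ?thesis using eventually_happens' U(2) unfolding is_ultrafilter_def by blast
  qed
  then show ?thesis using d by blast
qed

lemma block_bound_restrict:
  assumes b: "block_bound N a c \<theta>" and n: "n \<le> N" and eq: "\<And>i. i < n \<Longrightarrow> c i = d i"
  shows "block_bound n a d \<theta>"
  unfolding block_bound_def
proof (intro allI impI)
  fix \<kappa> and x :: "nat \<Rightarrow> complex"
  assume supp: "\<forall>i<n. d i \<noteq> \<kappa> \<longrightarrow> x i = 0"
  define y where "y i = (if i < n then x i else 0)" for i
  have "qform N a y = (\<Sum>i<n. \<Sum>j<N. cnj (y i) * a i j * y j)"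
    using n by (intro sum.mono_neutral_right) (auto simp: y_def)
  also have "\<dots> = qform n a x"
    using n by (intro sum.cong refl sum.mono_neutral_cong_right) (auto simp: y_def)
  finally have e1: "qform N a y = qform n a x" .
  have e2: "sqnorm N y = sqnorm n x"
    using n by (intro sum.mono_neutral_cong_right) (auto simp: y_def)
  have "\<forall>i<N. c i \<noteq> \<kappa> \<longrightarrow> y i = 0" using supp eq by (auto simp: y_def)
  then show "cmod (qform n a x) \<le> \<theta> * sqnorm n x"
    using b unfolding block_bound_def e1[symmetric] e2[symmetric] by blast
qed

lemma infinite_paving:
  assumes bp: "bessel_paving d q r" and d: "0 < d" and q: "0 < q" "q < 1"
    and M: "0 < M" and \<theta>: "0 < \<theta>"
    and herm: "\<And>i j. a j i = cnj (a i j)" and diag: "\<And>i. a i i = 0"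
    and bes: "\<And>n. bessel n n a (M\<^sup>2)"
  shows "\<exists>R c. (\<forall>i. c i < R) \<and> (\<forall>n. block_bound n a c \<theta>)"
proof -
  obtain R where R: "\<forall>n a. (\<forall>i<n. \<forall>j<n. a j i = cnj (a i j)) \<and> (\<forall>i<n. a i i = 0) \<and> bessel n n a (M\<^sup>2) \<longrightarrow>
      (\<exists>c. (\<forall>i. c i < R) \<and> block_bound n a c \<theta>)"
    using finite_paving[OF bp d q M \<theta>] by blast
  have "\<exists>c. (\<forall>i. c i < R) \<and> block_bound n a c \<theta>" for n
    by (rule R[rule_format]) (intro conjI allI impI herm diag bes)
  then have "\<exists>c. \<forall>n. (\<forall>i. c n i < R) \<and> block_bound n a (c n) \<theta>"
    by (intro choice allI)
  then obtain c where c: "\<And>n i. c n i < R" "\<And>n. block_bound n a (c n) \<theta>" by blast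
  obtain e where e: "\<And>i. e i < R" "\<And>n. \<exists>N\<ge>n. \<forall>i<n. c N i = e i"
    using coloring_limit[of c R] c(1) by blast
  have "block_bound n a e \<theta>" for n
    using e(2)[of n] c(2) block_bound_restrict by blast
  then show ?thesis using e(1) by blast
qed

section \<open>Bounded operators on square-summable sequences\<close>

lemma summable_coord: "summable (\<lambda>n. (cmod (coord x n))\<^sup>2)"
  using coord[of x] by simp

lemma coord_add [simp]: "coord (x + y) n = coord x n + coord y n"
  by (simp add: plus_ell2.rep_eq)

lemma coord_uminus [simp]: "coord (- x) n = - coord x n"
  by (simp add: uminus_ell2.rep_eq)

lemma coord_diff [simp]: "coord (x - y) n = coord x n - coord y n"
  unfolding minus_ell2_def by (simp only: coord_add coord_uminus) simp

lemma coord_zero [simp]: "coord 0 n = 0"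
  by (simp add: zero_ell2.rep_eq)

lemma coord_scaleC [simp]: "coord (scaleC c x) n = c * coord x n"
  by (simp add: scaleC.rep_eq)

lemma coord_sum [simp]: "coord (\<Sum>i\<in>I. f i) n = (\<Sum>i\<in>I. coord (f i) n)"
  by (induction I rule: infinite_finite_induct) simp_all

lemma ell2_eqI: "(\<And>n. coord x n = coord y n) \<Longrightarrow> x = y"
  by (simp add: coord_inject[symmetric] fun_eq_iff)

lemma scaleC_add_right: "scaleC c (x + y) = scaleC c x + scaleC c y"
  and scaleC_scaleC: "scaleC c (scaleC d x) = scaleC (c * d) x"
  by (rule ell2_eqI; simp add: distrib_left)+

lemma norm_power2_ell2: "(norm x)\<^sup>2 = (\<Sum>n. (cmod (coord x n))\<^sup>2)"
  by (simp add: norm_ell2_def suminf_nonneg summable_coord)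

lemma cinner_self_norm: "cinner x x = complex_of_real ((norm x)\<^sup>2)"
  by (simp only: cinner_self norm_power2_ell2)

lemma sum_coord_le_norm: "sqnorm N (coord x) \<le> (norm x)\<^sup>2"
  unfolding norm_power2_ell2 by (rule sum_le_suminf[OF summable_coord]) auto

lemma norm_ell2_le:
  assumes "\<And>N. sqnorm N (coord x) \<le> C\<^sup>2" "0 \<le> C"
  shows "norm x \<le> C"
proof -
  have "(norm x)\<^sup>2 \<le> C\<^sup>2" unfolding norm_power2_ell2
    by (rule suminf_le_const[OF summable_coord]) (use assms in simp)
  then show ?thesis using assms(2) by (rule power2_le_imp_le)
qed

lemma norm_scaleC: "norm (scaleC c x) = cmod c * norm x"
proof -
  have "(norm (scaleC c x))\<^sup>2 = (cmod c * norm x)\<^sup>2"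
    by (simp add: norm_power2_ell2 power_mult_distrib norm_mult suminf_mult[OF summable_coord])
  then show ?thesis by (simp add: power2_eq_iff_nonneg)
qed

lemma cinner_scaleC_right: "cinner x (scaleC c y) = cnj c * cinner x y"
  unfolding cinner_cnj[of x "scaleC c y"] cinner_cnj[of x y] by (simp add: cinner_scaleC_left)

lemma cinner_add_right: "cinner x (y + z) = cinner x y + cinner x z"
  unfolding cinner_cnj[of x "y + z"] cinner_cnj[of x y] cinner_cnj[of x z] by (simp add: cinner_add_left)

lemma cinner_diff_left: "cinner (x - y) z = cinner x z - cinner y z"
proof -
  have eq: "x - y = x + scaleC (-1) y" by (rule ell2_eqI) simp
  show ?thesis unfolding eq cinner_add_left cinner_scaleC_left by simp
qed

lemma cinner_diff_right: "cinner x (y - z) = cinner x y - cinner x z"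
  unfolding cinner_cnj[of x "y - z"] cinner_cnj[of x y] cinner_cnj[of x z] by (simp add: cinner_diff_left)

lemma cinner_sum_left: "cinner (\<Sum>i\<in>I. f i) y = (\<Sum>i\<in>I. cinner (f i) y)"
  by (induction I rule: infinite_finite_induct)
    (simp_all add: cinner_add_left cinner.rep_eq[of 0])

lemma cmod_cinner_le: "cmod (cinner x y) \<le> norm x * norm y"
proof (cases "cinner x y = 0")
  case False
  define z where "z = cinner x y"
  define c where "c = cnj z / cmod z"
  have "z \<noteq> 0" using False by (simp add: z_def)
  then have c1: "cmod c = 1" by (simp add: c_def norm_divide)
  have "c * z = of_real (cmod z)"
    using \<open>z \<noteq> 0\<close> cnj_mult_self[of z] by (simp add: c_def power2_eq_square)
  then have "cmod z = Re (cinner (scaleC c x) y)"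
    by (simp add: cinner_scaleC_left z_def)
  also have "\<dots> = inner (scaleC c x) y" by (simp add: inner_ell2_def)
  also have "\<dots> \<le> norm (scaleC c x) * norm y" by (rule norm_cauchy_schwarz)
  finally show ?thesis by (simp add: norm_scaleC c1 z_def)
qed simp

lift_definition fin_vec :: "nat \<Rightarrow> (nat \<Rightarrow> complex) \<Rightarrow> ell2" is "\<lambda>N u n. if n < N then u n else 0"
  by (rule summable_finite[of "{..<_}"]) auto

lift_definition ket :: "nat \<Rightarrow> ell2" is "\<lambda>j n. if n = j then 1 else 0"
  by (rule summable_finite[of "{_}"]) auto

lemma coord_fin_vec [simp]: "coord (fin_vec N u) n = (if n < N then u n else 0)"
  by (simp add: fin_vec.rep_eq)

lemma coord_ket [simp]: "coord (ket j) n = (if n = j then 1 else 0)"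
  by (simp add: ket.rep_eq)

lemma fin_vec_eq_sum: "fin_vec N u = (\<Sum>j<N. scaleC (u j) (ket j))"
  by (rule ell2_eqI) (simp add: if_distrib cong: if_cong)

lemma norm_fin_vec: "(norm (fin_vec N u))\<^sup>2 = sqnorm N u"
proof -
  have "(norm (fin_vec N u))\<^sup>2 = (\<Sum>n<N. (cmod (coord (fin_vec N u) n))\<^sup>2)"
    unfolding norm_power2_ell2 by (rule suminf_finite) auto
  then show ?thesis by simp
qed

lemma cinner_fin_vec: "cinner x (fin_vec N u) = (\<Sum>n<N. coord x n * cnj (u n))"
proof -
  have "cinner x (fin_vec N u) = (\<Sum>n<N. coord x n * cnj (coord (fin_vec N u) n))"
    unfolding cinner.rep_eq by (rule suminf_finite) auto
  then show ?thesis by simp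
qed

lemma cinner_ket: "cinner x (ket n) = coord x n"
proof -
  have "cinner x (ket n) = (\<Sum>m\<in>{n}. coord x m * cnj (coord (ket n) m))"
    unfolding cinner.rep_eq by (rule suminf_finite) auto
  then show ?thesis by simp
qed

lemma norm_ket [simp]: "norm (ket n) = 1"
proof -
  have "complex_of_real ((norm (ket n))\<^sup>2) = 1"
    by (simp only: cinner_self_norm[symmetric] cinner_ket coord_ket) simp
  then have "(norm (ket n))\<^sup>2 = 1" by (simp only: of_real_eq_1_iff)
  then show ?thesis using power2_eq_iff_nonneg[of "norm (ket n)" 1] by simp
qed

lemma cmod_coord_le: "cmod (coord x n) \<le> norm x"
  using cmod_cinner_le[of x "ket n"] by (simp add: cinner_ket)

lemma fin_vec_tendsto: "(\<lambda>N. fin_vec N (coord x)) \<longlonglongrightarrow> x"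
proof -
  let ?f = "\<lambda>n. (cmod (coord x n))\<^sup>2"
  have "(norm (x - fin_vec N (coord x)))\<^sup>2 = (\<Sum>n. ?f n) - (\<Sum>n<N. ?f n)" for N
  proof -
    have "(norm (x - fin_vec N (coord x)))\<^sup>2 = (\<Sum>n. ?f n - (if n < N then ?f n else 0))"
      unfolding norm_power2_ell2 by (intro suminf_cong) simp
    also have "\<dots> = (\<Sum>n. ?f n) - (\<Sum>n. if n < N then ?f n else 0)"
      by (rule suminf_diff[symmetric, OF summable_coord]) (rule summable_finite[of "{..<N}"], auto)
    also have "(\<Sum>n. if n < N then ?f n else 0) = (\<Sum>n<N. if n < N then ?f n else 0)"
      by (rule suminf_finite) auto
    finally show ?thesis by simp
  qed
  moreover have "(\<lambda>N. (\<Sum>n. ?f n) - (\<Sum>n<N. ?f n)) \<longlonglongrightarrow> (\<Sum>n. ?f n) - (\<Sum>n. ?f n)"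
    by (intro tendsto_intros summable_LIMSEQ summable_coord)
  ultimately have "(\<lambda>N. (norm (x - fin_vec N (coord x)))\<^sup>2) \<longlonglongrightarrow> 0" by simp
  then have "(\<lambda>N. sqrt ((norm (x - fin_vec N (coord x)))\<^sup>2)) \<longlonglongrightarrow> sqrt 0" by (rule tendsto_real_sqrt)
  then have "(\<lambda>N. norm (fin_vec N (coord x) - x)) \<longlonglongrightarrow> 0" by (simp add: norm_minus_commute)
  then show ?thesis by (rule LIM_zero_cancel[OF tendsto_norm_zero_cancel])
qed

lemma tendsto_cinner:
  assumes "(f \<longlongrightarrow> x) F" "(g \<longlongrightarrow> y) F"
  shows "((\<lambda>n. cinner (f n) (g n)) \<longlongrightarrow> cinner x y) F"
proof -
  have "((\<lambda>n. norm (f n - x) * norm (g n) + norm x * norm (g n - y)) \<longlongrightarrow> 0 * norm y + norm x * 0) F"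
    using assms by (intro tendsto_intros tendsto_norm_zero LIM_zero)
  then have lim: "((\<lambda>n. norm (f n - x) * norm (g n) + norm x * norm (g n - y)) \<longlongrightarrow> 0) F" by simp
  have "((\<lambda>n. cinner (f n) (g n) - cinner x y) \<longlongrightarrow> 0) F"
  proof (rule Lim_null_comparison[OF _ lim], rule always_eventually, rule allI)
    fix n
    have "cinner (f n) (g n) - cinner x y = cinner (f n - x) (g n) + cinner x (g n - y)"
      by (simp add: cinner_diff_left cinner_diff_right)
    then have "norm (cinner (f n) (g n) - cinner x y) \<le> cmod (cinner (f n - x) (g n)) + cmod (cinner x (g n - y))"
      by (metis norm_triangle_ineq)
    then show "norm (cinner (f n) (g n) - cinner x y) \<le> norm (f n - x) * norm (g n) + norm x * norm (g n - y)"
      using cmod_cinner_le[of "f n - x" "g n"] cmod_cinner_le[of x "g n - y"] by linarith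
  qed
  then show ?thesis by (rule LIM_zero_cancel)
qed

lemma bounded_operatorsI:
  assumes "\<And>x y. T (x + y) = T x + T y" "\<And>c x. T (scaleC c x) = scaleC c (T x)"
    and "\<And>x. norm (T x) \<le> norm x * M"
  shows "T \<in> bounded_operators"
proof -
  have "bounded_linear T"
    by (rule bounded_linear_intro[where K = M]) (simp_all add: assms scaleR_ell2_def)
  then show ?thesis using assms by (simp add: bounded_operators_def)
qed

lemma bounded_operators_add_apply: "T \<in> bounded_operators \<Longrightarrow> T (x + y) = T x + T y"
  and bounded_operators_scaleC_apply: "T \<in> bounded_operators \<Longrightarrow> T (scaleC c x) = scaleC c (T x)"
  and bounded_operators_sum_apply: "T \<in> bounded_operators \<Longrightarrow> T (\<Sum>i\<in>I. f i) = (\<Sum>i\<in>I. T (f i))"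
  by (simp_all add: bounded_operators_def bounded_linear.linear linear_add linear_sum)

lemma bounded_operators_bound:
  assumes "T \<in> bounded_operators"
  obtains M where "0 < M" "\<And>x. norm (T x) \<le> M * norm x"
proof -
  have "bounded_linear T" using assms by (simp add: bounded_operators_def)
  then obtain K where "0 < K" "\<And>x. norm (T x) \<le> norm x * K" using bounded_linear.pos_bounded by blast
  then show ?thesis using that by (simp add: mult.commute)
qed

lemma bounded_operators_add:
  assumes "S \<in> bounded_operators" "T \<in> bounded_operators"
  shows "(\<lambda>x. S x + T x) \<in> bounded_operators"
  using assms by (auto simp: bounded_operators_def bounded_linear_add scaleC_add_right)

lemma bounded_operators_scaleC:
  assumes "T \<in> bounded_operators"
  shows "(\<lambda>x. scaleC c (T x)) \<in> bounded_operators"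
proof -
  obtain M where M: "0 < M" "\<And>x. norm (T x) \<le> M * norm x" using bounded_operators_bound[OF assms] by blast
  show ?thesis
  proof (rule bounded_operatorsI[where M = "cmod c * M"])
    show "norm (scaleC c (T x)) \<le> norm x * (cmod c * M)" for x
      using mult_left_mono[OF M(2)[of x], of "cmod c"] by (simp add: norm_scaleC mult_ac)
  qed (simp_all add: assms bounded_operators_add_apply bounded_operators_scaleC_apply scaleC_add_right scaleC_scaleC mult.commute)
qed

lemma bounded_operators_id: "(\<lambda>x. x) \<in> bounded_operators"
  by (rule bounded_operatorsI[where M = 1]) auto

lemma bounded_operators_fin_vec:
  assumes "T \<in> bounded_operators"
  shows "T (fin_vec n u) = (\<Sum>j<n. scaleC (u j) (T (ket j)))"
  unfolding fin_vec_eq_sum by (simp add: assms bounded_operators_sum_apply bounded_operators_scaleC_apply)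

lemma bounded_operators_tendsto:
  assumes "T \<in> bounded_operators" "(f \<longlongrightarrow> x) F"
  shows "((\<lambda>n. T (f n)) \<longlongrightarrow> T x) F"
  using assms by (auto simp: bounded_operators_def intro: bounded_linear.tendsto)

lemma bessel_operator_kernel:
  assumes T: "T \<in> bounded_operators" and M: "\<And>x. norm (T x) \<le> M * norm x"
  shows "bessel n n (\<lambda>i j. coord (T (ket j)) i) (M\<^sup>2)"
  unfolding bessel_def
proof
  fix u :: "nat \<Rightarrow> complex"
  have "(\<Sum>i<n. (cmod (\<Sum>k<n. coord (T (ket k)) i * u k))\<^sup>2) = (\<Sum>i<n. (cmod (coord (T (fin_vec n u)) i))\<^sup>2)"
    unfolding bounded_operators_fin_vec[OF T] by (simp add: mult.commute)
  also have "\<dots> \<le> (norm (T (fin_vec n u)))\<^sup>2" by (rule sum_coord_le_norm)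
  also have "\<dots> \<le> (M * norm (fin_vec n u))\<^sup>2" by (intro power_mono M) simp
  finally show "(\<Sum>i<n. (cmod (\<Sum>k<n. coord (T (ket k)) i * u k))\<^sup>2) \<le> M\<^sup>2 * sqnorm n u"
    by (simp add: power_mult_distrib norm_fin_vec)
qed

lemma cinner_operator_fin_vec:
  assumes T: "T \<in> bounded_operators"
  shows "cinner (T (fin_vec n u)) (fin_vec n u) = (\<Sum>i<n. \<Sum>j<n. cnj (u i) * coord (T (ket j)) i * u j)"
  unfolding cinner_fin_vec bounded_operators_fin_vec[OF T]
  by (intro sum.cong refl) (simp add: sum_distrib_left mult_ac)

text \<open>
  The adjoint has coordinates \<open>\<langle>x, T e\<^sub>n\<rangle>\<close>. They are square-summable because pairing \<open>x\<close> with
  \<open>T\<close> applied to the vector of the first \<open>N\<close> of them gives exactly their partial square sum.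
\<close>

lemma ex_adjoint:
  assumes T: "T \<in> bounded_operators"
  shows "\<exists>S\<in>bounded_operators. \<forall>x y. cinner (S x) y = cinner x (T y)"
proof -
  obtain M where M: "0 < M" "\<And>x. norm (T x) \<le> M * norm x" using bounded_operators_bound[OF T] by blast
  define s where "s x n = cinner x (T (ket n))" for x n
  have cs: "cinner x (T (fin_vec N u)) = (\<Sum>n<N. s x n * cnj (u n))" for x N u
  proof -
    have "cinner (T (fin_vec N u)) x = (\<Sum>n<N. u n * cinner (T (ket n)) x)"
      unfolding bounded_operators_fin_vec[OF T] by (simp add: cinner_sum_left cinner_scaleC_left)
    then show ?thesis
      by (subst cinner_cnj) (simp add: s_def mult.commute cinner_cnj[of _ x])
  qed
  have bound: "sqnorm N (s x) \<le> (M * norm x)\<^sup>2" for x N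
  proof -
    define X where "X = sqnorm N (s x)"
    have X0: "0 \<le> X" by (simp add: X_def sum_nonneg)
    have "complex_of_real X = cinner x (T (fin_vec N (s x)))"
      unfolding cs X_def by (simp only: of_real_sum mult.commute[of "s _ _"] cnj_mult_self)
    then have "X = cmod (cinner x (T (fin_vec N (s x))))" using X0 by (metis norm_of_real abs_of_nonneg)
    also have "\<dots> \<le> norm x * (M * norm (fin_vec N (s x)))"
      by (intro order_trans[OF cmod_cinner_le] mult_left_mono M) simp
    also have "norm (fin_vec N (s x)) = sqrt X"
      using norm_fin_vec[of N "s x"] by (metis X_def norm_ge_zero real_sqrt_unique)
    finally have "X\<^sup>2 \<le> (norm x * (M * sqrt X))\<^sup>2" using X0 by (intro power_mono)
    also have "(norm x * (M * sqrt X))\<^sup>2 = (M * norm x)\<^sup>2 * X"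
      using X0 by (simp add: power_mult_distrib)
    finally have "X * X \<le> (M * norm x)\<^sup>2 * X" by (simp only: power2_eq_square)
    then show ?thesis using X0 unfolding X_def[symmetric] by (cases "X = 0") auto
  qed
  have sm: "summable (\<lambda>n. (cmod (s x n))\<^sup>2)" for x
    by (rule bounded_imp_summable[where B = "(M * norm x)\<^sup>2"]) (use bound[of x "Suc _"] in \<open>simp_all add: lessThan_Suc_atMost\<close>)
  define S where "S x = Abs_ell2 (s x)" for x
  have Sc: "coord (S x) n = s x n" for x n
    by (simp add: S_def Abs_ell2_inverse sm)
  have SB: "S \<in> bounded_operators"
  proof (rule bounded_operatorsI[where M = M])
    show "S (x + y) = S x + S y" for x y by (rule ell2_eqI) (simp add: Sc s_def cinner_add_left)
    show "S (scaleC c x) = scaleC c (S x)" for c x by (rule ell2_eqI) (simp add: Sc s_def cinner_scaleC_left)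
    show "norm (S x) \<le> norm x * M" for x
      by (rule norm_ell2_le) (use bound[of x] M in \<open>simp_all add: Sc mult.commute\<close>)
  qed
  have "cinner (S x) y = cinner x (T y)" for x y
  proof -
    have "(\<lambda>N. cinner x (T (fin_vec N (coord y)))) \<longlonglongrightarrow> cinner x (T y)"
      by (intro tendsto_cinner tendsto_const bounded_operators_tendsto[OF T] fin_vec_tendsto)
    moreover have "(\<lambda>N. cinner (S x) (fin_vec N (coord y))) \<longlonglongrightarrow> cinner (S x) y"
      by (intro tendsto_cinner tendsto_const fin_vec_tendsto)
    moreover have "cinner (S x) (fin_vec N u) = cinner x (T (fin_vec N u))" for N u
      by (simp add: cs cinner_fin_vec Sc)
    ultimately show ?thesis using LIMSEQ_unique by simp
  qed
  then show ?thesis using SB by blast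
qed

section \<open>States and diagonal operators\<close>

definition diag_op :: "(nat \<Rightarrow> complex) \<Rightarrow> ell2 \<Rightarrow> ell2" where
  "diag_op d x = Abs_ell2 (\<lambda>n. d n * coord x n)"

abbreviation proj :: "nat set \<Rightarrow> ell2 \<Rightarrow> ell2" where
  "proj A \<equiv> diag_op (indicator A)"

lemma diag_op_bounded:
  assumes B: "\<And>n. cmod (d n) \<le> B"
  shows coord_diag_op: "coord (diag_op d x) n = d n * coord x n"
    and norm_diag_op_le: "norm (diag_op d x) \<le> B * norm x"
    and diag_op_diagonal: "diag_op d \<in> diagonal_operators"
proof -
  have B0: "0 \<le> B" using B[of 0] norm_ge_zero order_trans by blast
  have le: "(cmod (d n * coord x n))\<^sup>2 \<le> B\<^sup>2 * (cmod (coord x n))\<^sup>2" for x n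
    unfolding norm_mult power_mult_distrib by (intro mult_right_mono power_mono B) auto
  have "summable (\<lambda>n. (cmod (d n * coord x n))\<^sup>2)" for x
    by (rule summable_comparison_test'[OF summable_mult[OF summable_coord, of "B\<^sup>2" x], of 0]) (use le in simp)
  then have c: "coord (diag_op d x) n = d n * coord x n" for x n
    by (simp add: diag_op_def Abs_ell2_inverse)
  then show "coord (diag_op d x) n = d n * coord x n" .
  have nb: "norm (diag_op d x) \<le> B * norm x" for x
  proof (rule norm_ell2_le)
    fix N
    have "(\<Sum>n<N. (cmod (coord (diag_op d x) n))\<^sup>2) \<le> B\<^sup>2 * sqnorm N (coord x)"
      unfolding sum_distrib_left c by (intro sum_mono le)
    also have "\<dots> \<le> B\<^sup>2 * (norm x)\<^sup>2" by (intro mult_left_mono sum_coord_le_norm) simp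
    finally show "(\<Sum>n<N. (cmod (coord (diag_op d x) n))\<^sup>2) \<le> (B * norm x)\<^sup>2" by (simp add: power_mult_distrib)
  qed (use B0 in simp)
  then show "norm (diag_op d x) \<le> B * norm x" .
  have "diag_op d \<in> bounded_operators"
  proof (rule bounded_operatorsI[where M = B])
    show "diag_op d (x + y) = diag_op d x + diag_op d y" for x y by (rule ell2_eqI) (simp add: c distrib_left)
    show "diag_op d (scaleC k x) = scaleC k (diag_op d x)" for k x by (rule ell2_eqI) (simp add: c)
    show "norm (diag_op d x) \<le> norm x * B" for x using nb[of x] by (simp add: mult.commute)
  qed
  then show "diag_op d \<in> diagonal_operators" using c by (auto simp: diagonal_operators_def)
qed

lemma diagonal_operatorsE:
  assumes "T \<in> diagonal_operators"
  obtains d B where "\<And>n. cmod (d n) \<le> B" "T = diag_op d"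
proof -
  obtain d where T: "T \<in> bounded_operators" and d: "\<And>x n. coord (T x) n = d n * coord x n"
    using assms by (auto simp: diagonal_operators_def)
  obtain M where M: "\<And>x. norm (T x) \<le> M * norm x" using bounded_operators_bound[OF T] by blast
  have b: "cmod (d n) \<le> M" for n
    using cmod_coord_le[of "T (ket n)" n] M[of "ket n"] by (simp add: d)
  have "T = diag_op d"
    by (intro ext ell2_eqI) (simp add: d coord_diag_op[OF b])
  then show ?thesis using that b by blast
qed

lemma coord_proj [simp]: "coord (proj A x) n = indicator A n * coord x n"
  by (rule coord_diag_op[where B = 1]) (simp add: indicator_def)

lemma proj_diagonal [simp]: "proj A \<in> diagonal_operators"
  by (rule diag_op_diagonal[where B = 1]) (simp add: indicator_def)

lemma diagonal_subset_bounded: "T \<in> diagonal_operators \<Longrightarrow> T \<in> bounded_operators"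
  by (simp add: diagonal_operators_def)

lemma diag_op_add:
  assumes "\<And>n. cmod (d n) \<le> B" "\<And>n. cmod (e n) \<le> C"
  shows "diag_op (\<lambda>n. d n + e n) = (\<lambda>x. diag_op d x + diag_op e x)"
proof -
  have "cmod (d n + e n) \<le> B + C" for n using assms by (meson add_mono norm_triangle_ineq order_trans)
  then show ?thesis
    using assms by (intro ext ell2_eqI) (simp add: coord_diag_op[of _ "B + C"] coord_diag_op[of d B] coord_diag_op[of e C] distrib_right)
qed

lemma diag_op_scaleC:
  assumes "\<And>n. cmod (d n) \<le> B"
  shows "diag_op (\<lambda>n. c * d n) = (\<lambda>x. scaleC c (diag_op d x))"
proof -
  have "cmod (c * d n) \<le> cmod c * B" for n using assms by (simp add: norm_mult mult_left_mono)
  then show ?thesis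
    using assms by (intro ext ell2_eqI) (simp add: coord_diag_op[of _ "cmod c * B"] coord_diag_op[of d B] mult.assoc)
qed

lemma diag_op_one: "diag_op (\<lambda>_. 1) = (\<lambda>x. x)"
  by (intro ext ell2_eqI) (simp add: coord_diag_op[of _ 1])

lemma complex_of_real_nonneg: "0 \<le> r \<Longrightarrow> 0 \<le> complex_of_real r"
  by (simp add: less_eq_complex_def)

lemma positive_diag_op_iff:
  assumes B: "\<And>n. cmod (d n) \<le> B"
  shows "positive_operator (diag_op d) \<longleftrightarrow> (\<forall>n. 0 \<le> d n)"
proof
  assume "positive_operator (diag_op d)"
  then have "0 \<le> cinner (diag_op d (ket n)) (ket n)" for n by (simp add: positive_operator_def)
  then show "\<forall>n. 0 \<le> d n" unfolding cinner_ket coord_diag_op[OF B] by simp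
next
  assume nn: "\<forall>n. 0 \<le> d n"
  show "positive_operator (diag_op d)"
    unfolding positive_operator_def
  proof
    fix x
    have re: "d n = of_real (Re (d n))" "0 \<le> Re (d n)" for n
    proof -
      have "0 \<le> Re (d n) \<and> Im (d n) = 0" using nn[rule_format, of n] by (simp add: less_eq_complex_def)
      then show "d n = of_real (Re (d n))" "0 \<le> Re (d n)" by (auto intro: complex_eqI)
    qed
    have tm: "coord (diag_op d x) n * cnj (coord x n) = of_real (Re (d n) * (cmod (coord x n))\<^sup>2)" for n
    proof -
      have "coord (diag_op d x) n * cnj (coord x n) = d n * (cnj (coord x n) * coord x n)"
        by (simp add: coord_diag_op[OF B] mult_ac)
      also have "\<dots> = complex_of_real (Re (d n)) * of_real ((cmod (coord x n))\<^sup>2)"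
        unfolding cnj_mult_self using re(1)[of n] by simp
      finally show ?thesis by simp
    qed
    have "summable (\<lambda>n. coord (diag_op d x) n * cnj (coord x n))"
      by (rule summable_mult_cnj[OF summable_coord summable_coord])
    then have sm: "summable (\<lambda>n. Re (d n) * (cmod (coord x n))\<^sup>2)"
      unfolding tm by (simp only: summable_of_real_iff)
    have "cinner (diag_op d x) x = of_real (\<Sum>n. Re (d n) * (cmod (coord x n))\<^sup>2)"
      unfolding cinner.rep_eq tm by (rule suminf_of_real[symmetric, OF sm])
    moreover have "0 \<le> (\<Sum>n. Re (d n) * (cmod (coord x n))\<^sup>2)"
      using re(2) by (intro suminf_nonneg sm) simp
    ultimately show "0 \<le> cinner (diag_op d x) x" by (simp only: complex_of_real_nonneg)
  qed
qed

text \<open>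
  This covers both algebras at once: what is needed of them is linear combinations and diagonal
  operators.
\<close>

definition operator_system :: "(ell2 \<Rightarrow> ell2) set \<Rightarrow> bool" where
  "operator_system R \<longleftrightarrow> diagonal_operators \<subseteq> R \<and>
     (\<forall>S\<in>R. \<forall>T\<in>R. (\<lambda>x. S x + T x) \<in> R) \<and> (\<forall>c. \<forall>T\<in>R. (\<lambda>x. scaleC c (T x)) \<in> R)"

lemma operator_system_add: "operator_system R \<Longrightarrow> S \<in> R \<Longrightarrow> T \<in> R \<Longrightarrow> (\<lambda>x. S x + T x) \<in> R"
  and operator_system_scaleC: "operator_system R \<Longrightarrow> T \<in> R \<Longrightarrow> (\<lambda>x. scaleC c (T x)) \<in> R"
  by (auto simp: operator_system_def)

lemma operator_system_bounded: "operator_system bounded_operators"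
  by (auto simp: operator_system_def diagonal_subset_bounded bounded_operators_add bounded_operators_scaleC)

lemma operator_system_diagonal: "operator_system diagonal_operators"
  unfolding operator_system_def
proof (intro conjI ballI allI subset_refl)
  fix S T assume "S \<in> diagonal_operators" "T \<in> diagonal_operators"
  then obtain d B e C where d: "\<And>n. cmod (d n) \<le> B" "S = diag_op d" and e: "\<And>n. cmod (e n) \<le> C" "T = diag_op e"
    by (metis diagonal_operatorsE)
  have "cmod (d n + e n) \<le> B + C" for n
    using norm_triangle_ineq[of "d n" "e n"] d(1)[of n] e(1)[of n] by linarith
  then show "(\<lambda>x. S x + T x) \<in> diagonal_operators"
    using diag_op_diagonal[of "\<lambda>n. d n + e n" "B + C"] diag_op_add[OF d(1) e(1)] d(2) e(2) by simp
next
  fix c T assume "T \<in> diagonal_operators"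
  then obtain d B where d: "\<And>n. cmod (d n) \<le> B" "T = diag_op d" by (metis diagonal_operatorsE)
  have "cmod (c * d n) \<le> cmod c * B" for n using d(1) by (simp add: norm_mult mult_left_mono)
  then show "(\<lambda>x. scaleC c (T x)) \<in> diagonal_operators"
    using diag_op_diagonal[of "\<lambda>n. c * d n" "cmod c * B"] diag_op_scaleC[OF d(1), of c] d(2) by simp
qed

lemma state_add: "is_state R f \<Longrightarrow> S \<in> R \<Longrightarrow> T \<in> R \<Longrightarrow> f (\<lambda>x. S x + T x) = f S + f T"
  and state_scaleC: "is_state R f \<Longrightarrow> T \<in> R \<Longrightarrow> f (\<lambda>x. scaleC c (T x)) = c * f T"
  and state_id: "is_state R f \<Longrightarrow> f (\<lambda>x. x) = 1"
  and state_positive: "is_state R f \<Longrightarrow> T \<in> R \<Longrightarrow> positive_operator T \<Longrightarrow> 0 \<le> f T"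
  by (simp_all add: is_state_def)

lemma operator_system_combine:
  assumes R: "operator_system R" and f: "is_state R f" and S: "S \<in> R" and T: "T \<in> R"
  shows "(\<lambda>x. scaleC a (S x) + scaleC b (T x)) \<in> R"
    and "f (\<lambda>x. scaleC a (S x) + scaleC b (T x)) = a * f S + b * f T"
proof -
  have mem: "(\<lambda>x. scaleC a (S x)) \<in> R" "(\<lambda>x. scaleC b (T x)) \<in> R"
    by (rule operator_system_scaleC[OF R S], rule operator_system_scaleC[OF R T])
  then show "(\<lambda>x. scaleC a (S x) + scaleC b (T x)) \<in> R"
    by (rule operator_system_add[OF R])
  show "f (\<lambda>x. scaleC a (S x) + scaleC b (T x)) = a * f S + b * f T"
    using state_add[OF f mem] state_scaleC[OF f S] state_scaleC[OF f T] by simp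
qed

lemma is_state_subset:
  assumes f: "is_state R f" and "D \<subseteq> R"
  shows "is_state D f"
  using assms unfolding is_state_def by blast

lemma state_diag_op_mono:
  assumes R: "operator_system R" and f: "is_state R f"
    and B: "\<And>n. cmod (d n) \<le> B" "\<And>n. cmod (e n) \<le> C" and le: "\<And>n. d n \<le> e n"
  shows "f (diag_op d) \<le> f (diag_op e)"
proof -
  have mem: "diag_op d \<in> R" "diag_op e \<in> R"
    using R diag_op_diagonal[OF B(1)] diag_op_diagonal[OF B(2)] by (auto simp: operator_system_def)
  define g where "g n = e n + (-1) * d n" for n
  have gB: "cmod (g n) \<le> C + B" for n
    using norm_triangle_ineq4[of "e n" "d n"] B(1)[of n] B(2)[of n] by (simp add: g_def)
  have geq: "diag_op g = (\<lambda>x. scaleC 1 (diag_op e x) + scaleC (-1) (diag_op d x))"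
    by (intro ext ell2_eqI)
      (simp add: coord_diag_op[of g, OF gB] coord_diag_op[of d, OF B(1)] coord_diag_op[of e, OF B(2)] g_def algebra_simps)
  have "positive_operator (diag_op g)"
    unfolding positive_diag_op_iff[OF gB] using le by (simp add: g_def less_eq_complex_def)
  then have "0 \<le> f (diag_op g)"
    using operator_system_combine(1)[OF R f mem(2) mem(1), of 1 "-1"] unfolding geq by (intro state_positive[OF f])
  also have "f (diag_op g) = f (diag_op e) - f (diag_op d)"
    unfolding geq operator_system_combine(2)[OF R f mem(2) mem(1)] by simp
  finally show ?thesis by simp
qed

lemma state_diag_op_const:
  assumes R: "operator_system R" and f: "is_state R f"
  shows "f (diag_op (\<lambda>_. c)) = c"
proof -
  have "diag_op (\<lambda>n. c * 1) = (\<lambda>x. scaleC c (diag_op (\<lambda>_. 1) x))"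
    by (rule diag_op_scaleC[where B = 1]) simp
  then have "diag_op (\<lambda>n. c) = (\<lambda>x. scaleC c x)" by (simp add: diag_op_one)
  moreover have "(\<lambda>x. x) \<in> R"
    using R diag_op_diagonal[of "\<lambda>_. 1" 1] by (auto simp: operator_system_def diag_op_one)
  ultimately show ?thesis using state_scaleC[OF f, of "\<lambda>x. x" c] state_id[OF f] by simp
qed

lemma state_diag_op_sum:
  assumes R: "operator_system R" and f: "is_state R f" and I: "finite I"
    and B: "\<And>i n. i \<in> I \<Longrightarrow> cmod (d i n) \<le> B i"
  shows "f (diag_op (\<lambda>n. \<Sum>i\<in>I. d i n)) = (\<Sum>i\<in>I. f (diag_op (d i)))"
  using I B
proof (induction I)
  case empty
  then show ?case using state_diag_op_const[OF R f, of 0] by simp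
next
  case (insert i I)
  have b1: "cmod (d i n) \<le> B i" for n using insert.prems by simp
  have b2: "cmod (\<Sum>i\<in>I. d i n) \<le> (\<Sum>i\<in>I. B i)" for n
    using insert.prems by (intro order_trans[OF norm_sum] sum_mono) simp
  have mem: "diag_op (d i) \<in> R" "diag_op (\<lambda>n. \<Sum>i\<in>I. d i n) \<in> R"
    using R diag_op_diagonal[OF b1] diag_op_diagonal[OF b2] by (auto simp: operator_system_def)
  have "f (diag_op (\<lambda>n. d i n + (\<Sum>i\<in>I. d i n))) = f (diag_op (d i)) + f (diag_op (\<lambda>n. \<Sum>i\<in>I. d i n))"
    unfolding diag_op_add[OF b1 b2] by (rule state_add[OF f mem])
  then show ?case using insert by simp
qed

lemma state_diag_op_scaleC:
  assumes R: "operator_system R" and f: "is_state R f" and B: "\<And>n. cmod (d n) \<le> B"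
  shows "f (diag_op (\<lambda>n. c * d n)) = c * f (diag_op d)"
proof -
  have "diag_op d \<in> R" using R diag_op_diagonal[OF B] by (auto simp: operator_system_def)
  then show ?thesis unfolding diag_op_scaleC[OF B] by (rule state_scaleC[OF f])
qed

lemma cmod_indicator_le: "cmod (indicator A n) \<le> 1"
  by (simp add: indicator_def)

lemma state_partition:
  fixes c :: "nat \<Rightarrow> nat"
  assumes R: "operator_system R" and f: "is_state R f" and c: "\<And>n. c n < m"
  shows "(\<Sum>\<kappa><m. f (proj {n. c n = \<kappa>})) = 1"
proof -
  have "(\<Sum>\<kappa><m. f (proj {n. c n = \<kappa>})) = f (diag_op (\<lambda>n. \<Sum>\<kappa><m. indicator {n. c n = \<kappa>} n))"
    by (rule state_diag_op_sum[OF R f, symmetric]) (auto intro: cmod_indicator_le)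
  also have "(\<lambda>n. \<Sum>\<kappa><m. indicator {n. c n = \<kappa>} n) = (\<lambda>_. 1 :: complex)"
    using c by (intro ext) (simp add: indicator_def)
  finally show ?thesis using state_diag_op_const[OF R f] by simp
qed

lemma state_compl:
  assumes R: "operator_system R" and f: "is_state R f"
  shows "f (proj (- A)) = 1 - f (proj A)"
proof -
  have "(\<Sum>\<kappa><2. f (proj {n. (if n \<in> A then 0 else 1 :: nat) = \<kappa>})) = 1"
    by (rule state_partition[OF R f]) simp
  moreover have "{n. (if n \<in> A then 0 else 1 :: nat) = 0} = A" "{n. (if n \<in> A then 0 else 1 :: nat) = 1} = - A"
    by auto
  ultimately have "f (proj A) + f (proj (- A)) = 1" by (simp add: numeral_2_eq_2)
  then show ?thesis by (simp add: algebra_simps)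
qed

lemma state_proj_bounds:
  assumes R: "operator_system R" and f: "is_state R f"
  shows "0 \<le> f (proj A)" "f (proj A) \<le> 1"
proof -
  have "f (diag_op (\<lambda>_. 0)) \<le> f (proj A)"
    by (rule state_diag_op_mono[OF R f, where B = 0 and C = 1]) (auto simp: indicator_def less_eq_complex_def)
  then show "0 \<le> f (proj A)" by (simp add: state_diag_op_const[OF R f])
  have "f (proj A) \<le> f (diag_op (\<lambda>_. 1))"
    by (rule state_diag_op_mono[OF R f, where B = 1 and C = 1]) (auto simp: indicator_def less_eq_complex_def)
  then show "f (proj A) \<le> 1" by (simp add: state_diag_op_const[OF R f])
qed

lemma cmod_diff_le_of_squeeze:
  fixes a b c :: complex
  assumes "a \<le> b" "b \<le> a + of_real e" "a \<le> c" "c \<le> a + of_real e"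
  shows "cmod (b - c) \<le> e"
proof -
  have "Im (b - c) = 0" and "\<bar>Re (b - c)\<bar> \<le> e"
    using assms by (simp_all add: less_eq_complex_def abs_le_iff)
  then show ?thesis by (simp add: cmod_eq_Re)
qed

text \<open>
  The step function \<open>s\<close> that rounds \<open>d\<close> down to multiples of \<open>e\<close> takes finitely many values, so its
  operator is a combination of diagonal projections, and \<open>s \<le> d \<le> s + e\<close>.
\<close>

lemma states_eq_on_real_diag_op:
  assumes R: "operator_system R" and f: "is_state R f" and Q: "operator_system Q" and g: "is_state Q g"
    and eq: "\<And>A. f (proj A) = g (proj A)" and B: "\<And>n. \<bar>d n\<bar> \<le> B"
  shows "f (diag_op (\<lambda>n. of_real (d n))) = g (diag_op (\<lambda>n. of_real (d n)))"
proof -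
  let ?D = "diag_op (\<lambda>n. complex_of_real (d n))"
  have close: "cmod (f ?D - g ?D) \<le> e" if e: "0 < e" for e :: real
  proof -
    define k where "k n = \<lfloor>d n / e\<rfloor>" for n
    define I where "I = {\<lfloor>- B / e\<rfloor>..\<lfloor>B / e\<rfloor>}"
    have kI: "k n \<in> I" for n
    proof -
      have "- B / e \<le> d n / e" "d n / e \<le> B / e"
        using B[of n] e by (intro divide_right_mono; linarith)+
      then show ?thesis unfolding I_def k_def by (simp only: atLeastAtMost_iff floor_mono)
    qed
    define s where "s n = (\<Sum>i\<in>I. complex_of_real (e * of_int i) * indicator {n. k n = i} n)" for n
    have seq: "s n = of_real (e * of_int (k n))" for n
    proof -
      have "s n = (\<Sum>i\<in>I. if i = k n then of_real (e * of_int (k n)) else 0)"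
        unfolding s_def by (intro sum.cong refl) (auto simp: indicator_def)
      then show ?thesis using kI[of n] by (simp add: I_def)
    qed
    have lo: "e * of_int (k n) \<le> d n" and hi: "d n \<le> e * of_int (k n) + e" for n
    proof -
      have "of_int (k n) \<le> d n / e" "d n / e < of_int (k n) + 1" unfolding k_def by linarith+
      then show "e * of_int (k n) \<le> d n" "d n \<le> e * of_int (k n) + e" using e by (simp_all add: field_simps)
    qed
    have sB: "cmod (s n) \<le> B + e" for n
      unfolding seq norm_of_real using lo[of n] hi[of n] B[of n] e by linarith
    have sB': "cmod (s n + of_real e) \<le> B + e + e" for n
      using norm_triangle_ineq[of "s n" "of_real e"] sB[of n] e by simp
    have dB: "cmod (complex_of_real (d n)) \<le> B" for n using B by simp
    have simple: "h (diag_op s) = (\<Sum>i\<in>I. of_real (e * of_int i) * h (proj {n. k n = i}))"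
      "h (diag_op s) \<le> h ?D"
      "h ?D \<le> h (diag_op s) + of_real e"
      if P: "operator_system P" "is_state P h" for P h
    proof -
      have "h (diag_op (\<lambda>n. \<Sum>i\<in>I. complex_of_real (e * of_int i) * indicator {n. k n = i} n)) =
          (\<Sum>i\<in>I. h (diag_op (\<lambda>n. complex_of_real (e * of_int i) * indicator {n. k n = i} n)))"
        by (rule state_diag_op_sum[OF P, where B = "\<lambda>i. \<bar>e * of_int i\<bar>"])
          (auto simp: I_def indicator_def norm_mult)
      also have "\<dots> = (\<Sum>i\<in>I. of_real (e * of_int i) * h (proj {n. k n = i}))"
        by (intro sum.cong refl state_diag_op_scaleC[OF P cmod_indicator_le])
      finally show "h (diag_op s) = (\<Sum>i\<in>I. of_real (e * of_int i) * h (proj {n. k n = i}))"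
        unfolding s_def .
      show "h (diag_op s) \<le> h ?D"
        by (rule state_diag_op_mono[OF P sB dB]) (use lo in \<open>simp add: seq less_eq_complex_def\<close>)
      have "h ?D \<le> h (diag_op (\<lambda>n. s n + of_real e))"
        by (rule state_diag_op_mono[OF P dB sB']) (use hi in \<open>simp add: seq less_eq_complex_def\<close>)
      also have "diag_op (\<lambda>n. s n + of_real e) = (\<lambda>x. diag_op s x + diag_op (\<lambda>_. of_real e) x)"
        by (rule diag_op_add[OF sB, where C = e]) (use e in simp)
      also have "h \<dots> = h (diag_op s) + h (diag_op (\<lambda>_. of_real e))"
      proof (rule state_add[OF P(2)])
        show "diag_op s \<in> P" using P diag_op_diagonal[OF sB] by (auto simp: operator_system_def)
        show "diag_op (\<lambda>_. complex_of_real e) \<in> P"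
          using P diag_op_diagonal[of "\<lambda>_. complex_of_real e" e] e by (auto simp: operator_system_def)
      qed
      finally show "h ?D \<le> h (diag_op s) + of_real e"
        by (simp add: state_diag_op_const[OF P])
    qed
    have "f (diag_op s) = g (diag_op s)" using simple(1)[OF R f] simple(1)[OF Q g] eq by simp
    then have "f (diag_op s) \<le> f ?D" "f ?D \<le> f (diag_op s) + of_real e"
        "f (diag_op s) \<le> g ?D" "g ?D \<le> f (diag_op s) + of_real e"
      using simple(2,3)[OF R f] simple(2,3)[OF Q g] by simp_all
    then show ?thesis by (rule cmod_diff_le_of_squeeze)
  qed
  have "cmod (f ?D - g ?D) \<le> 0"
    by (rule field_le_epsilon) (use close in simp)
  then show ?thesis by simp
qed

lemma states_eq_on_diagonal:
  assumes R: "operator_system R" and f: "is_state R f" and Q: "operator_system Q" and g: "is_state Q g"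
    and eq: "\<And>A. f (proj A) = g (proj A)" and T: "T \<in> diagonal_operators"
  shows "f T = g T"
proof -
  obtain d B where B: "\<And>n. cmod (d n) \<le> B" and T: "T = diag_op d" using diagonal_operatorsE[OF T] by blast
  let ?X = "diag_op (\<lambda>n. complex_of_real (Re (d n)))" and ?Y = "diag_op (\<lambda>n. complex_of_real (Im (d n)))"
  have re: "\<bar>Re (d n)\<bar> \<le> B" and im: "\<bar>Im (d n)\<bar> \<le> B" for n
    using abs_Re_le_cmod[of "d n"] abs_Im_le_cmod[of "d n"] B[of n] by linarith+
  have rB: "cmod (complex_of_real (Re (d n))) \<le> B" and iB: "cmod (complex_of_real (Im (d n))) \<le> B" for n
    using re im by simp_all
  have Teq: "T = (\<lambda>x. scaleC 1 (?X x) + scaleC \<i> (?Y x))"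
    unfolding T
  proof (intro ext ell2_eqI)
    fix x n
    have "coord (diag_op d x) n = (of_real (Re (d n)) + \<i> * of_real (Im (d n))) * coord x n"
      using complex_eq[of "d n"] by (simp only: coord_diag_op[OF B])
    then show "coord (diag_op d x) n =
        coord (scaleC 1 (?X x) + scaleC \<i> (?Y x)) n"
      by (simp only: coord_add coord_scaleC coord_diag_op[OF rB] coord_diag_op[OF iB]) (simp add: algebra_simps)
  qed
  have val: "h T = h ?X + \<i> * h ?Y"
    if P: "operator_system P" "is_state P h" for P h
  proof -
    have mem: "?X \<in> P" "?Y \<in> P"
      using P diag_op_diagonal[OF rB] diag_op_diagonal[OF iB] by (auto simp: operator_system_def)
    show ?thesis unfolding Teq operator_system_combine(2)[OF P mem, of 1 \<i>] by simp
  qed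
  show ?thesis
    unfolding val[OF R f] val[OF Q g]
    using states_eq_on_real_diag_op[OF R f Q g eq re] states_eq_on_real_diag_op[OF R f Q g eq im] by simp
qed

lemma cmod_indicator_mult_le:
  assumes "\<And>n. cmod (d n) \<le> B"
  shows "cmod (indicator A n * d n) \<le> B"
  using assms[of n] order_trans[OF norm_ge_zero assms[of n]] by (auto simp: indicator_def)

lemma diag_op_compose_proj:
  assumes B: "\<And>n. cmod (d n) \<le> B"
  shows "(\<lambda>x. proj A (diag_op d x)) = diag_op (\<lambda>n. indicator A n * d n)"
proof -
  have "cmod (indicator A n * d n) \<le> B" for n by (rule cmod_indicator_mult_le[OF B])
  then show ?thesis
    by (intro ext ell2_eqI) (simp add: coord_diag_op[of _ B] coord_diag_op[of d B] B mult.assoc)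
qed

text \<open>
  Conditioning a state on a diagonal projection of positive mass.
\<close>

lemma state_compression:
  assumes s: "is_state diagonal_operators s" and t: "s (proj A) = of_real t" "0 < t"
  shows "is_state diagonal_operators (\<lambda>T. s (\<lambda>x. proj A (T x)) / of_real t)"
proof -
  have mem: "(\<lambda>x. proj A (T x)) \<in> diagonal_operators" if T: "T \<in> diagonal_operators" for T
  proof -
    obtain d B where B: "\<And>n. cmod (d n) \<le> B" and T: "T = diag_op d" using diagonal_operatorsE[OF T] by blast
    show ?thesis unfolding T diag_op_compose_proj[OF B] by (rule diag_op_diagonal, rule cmod_indicator_mult_le[OF B])
  qed
  have pB: "proj A \<in> bounded_operators" by (rule diagonal_subset_bounded) simp
  show ?thesis
    unfolding is_state_def
  proof (intro conjI ballI allI impI)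
    fix S T assume "S \<in> diagonal_operators" "T \<in> diagonal_operators"
    then show "s (\<lambda>x. proj A (S x + T x)) / of_real t = s (\<lambda>x. proj A (S x)) / of_real t + s (\<lambda>x. proj A (T x)) / of_real t"
      using state_add[OF s mem mem] by (simp add: bounded_operators_add_apply[OF pB] add_divide_distrib)
  next
    fix c T assume "T \<in> diagonal_operators"
    then show "s (\<lambda>x. proj A (scaleC c (T x))) / of_real t = c * (s (\<lambda>x. proj A (T x)) / of_real t)"
      using state_scaleC[OF s mem] by (simp add: bounded_operators_scaleC_apply[OF pB])
  next
    show "s (\<lambda>x. proj A x) / of_real t = 1" using t by simp
  next
    fix T assume T: "T \<in> diagonal_operators" and pos: "positive_operator T"
    obtain d B where B: "\<And>n. cmod (d n) \<le> B" and Td: "T = diag_op d" using diagonal_operatorsE[OF T] by blast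
    have B': "cmod (indicator A n * d n) \<le> B" for n by (rule cmod_indicator_mult_le[OF B])
    have "positive_operator (\<lambda>x. proj A (T x))"
      using pos unfolding Td diag_op_compose_proj[OF B] positive_diag_op_iff[OF B] positive_diag_op_iff[OF B']
      by (auto simp: indicator_def)
    then have "0 \<le> s (\<lambda>x. proj A (T x))" using mem[OF T] by (intro state_positive[OF s])
    then show "0 \<le> s (\<lambda>x. proj A (T x)) / of_real t"
      using t(2) by (auto simp: less_eq_complex_def)
  qed
qed

text \<open>
  If the mass \<open>t\<close> of \<open>A\<close> were strictly between \<open>0\<close> and \<open>1\<close>, the state would be a proper mixture of its
  conditional states on \<open>A\<close> and on the complement, and these differ on the projection onto \<open>A\<close>.
\<close>

lemma pure_state_diagonal_zero_one:
  assumes p: "is_pure_state diagonal_operators s"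
  shows "s (proj A) = 0 \<or> s (proj A) = 1"
proof (rule ccontr)
  assume neg: "\<not> (s (proj A) = 0 \<or> s (proj A) = 1)"
  have s: "is_state diagonal_operators s" using p by (simp add: is_pure_state_def)
  note D = operator_system_diagonal
  define t where "t = Re (s (proj A))"
  have "0 \<le> s (proj A)" "s (proj A) \<le> 1" using state_proj_bounds[OF D s] by auto
  then have im: "Im (s (proj A)) = 0" and re: "0 \<le> t" "t \<le> 1" by (auto simp: less_eq_complex_def t_def)
  have st: "s (proj A) = of_real t" using im by (simp add: t_def complex_eq_iff)
  have t: "0 < t" "t < 1" using neg re st by (auto simp: less_le)
  have sc: "s (proj (- A)) = of_real (1 - t)" unfolding state_compl[OF D s] st by simp
  define g where "g T = s (\<lambda>x. proj (- A) (T x)) / of_real (1 - t)" for T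
  define h where "h T = s (\<lambda>x. proj A (T x)) / of_real t" for T
  have gs: "is_state diagonal_operators g"
    unfolding g_def using state_compression[OF s sc] t by simp
  have hs: "is_state diagonal_operators h"
    unfolding h_def using state_compression[OF s st] t by simp
  have conv: "s T = of_real (1 - t) * g T + of_real t * h T" if T: "T \<in> diagonal_operators" for T
  proof -
    obtain d B where B: "\<And>n. cmod (d n) \<le> B" and Td: "T = diag_op d" using diagonal_operatorsE[OF T] by blast
    have "T = (\<lambda>x. proj (- A) (T x) + proj A (T x))"
      by (intro ext ell2_eqI) (auto simp: indicator_def)
    then have "s T = s (\<lambda>x. proj (- A) (T x) + proj A (T x))" by simp
    also have "\<dots> = s (\<lambda>x. proj (- A) (T x)) + s (\<lambda>x. proj A (T x))"
    proof (rule state_add[OF s])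
      show "(\<lambda>x. proj (- A) (T x)) \<in> diagonal_operators" "(\<lambda>x. proj A (T x)) \<in> diagonal_operators"
        unfolding Td diag_op_compose_proj[OF B] by (rule diag_op_diagonal, rule cmod_indicator_mult_le[OF B])+
    qed
    finally show ?thesis using t by (simp add: g_def h_def)
  qed
  have "h (proj A) = s (proj A)"
  proof -
    have "is_state diagonal_operators g \<and> is_state diagonal_operators h \<and> 0 < t \<and> t < 1 \<and>
        (\<forall>T\<in>diagonal_operators. s T = of_real (1 - t) * g T + of_real t * h T)"
      using gs hs t conv by blast
    then have "\<forall>T\<in>diagonal_operators. g T = s T \<and> h T = s T"
      using p unfolding is_pure_state_def by blast
    then show ?thesis by simp
  qed
  moreover have "h (proj A) = 1"
  proof -
    have "(\<lambda>x. proj A (proj A x)) = proj A" by (intro ext ell2_eqI) (simp add: indicator_def)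
    then show ?thesis using t by (simp add: h_def st)
  qed
  ultimately show False using neg by simp
qed

text \<open>
  The values \<open>0\<close> and \<open>1\<close> are extreme points of the unit interval, so the components of a
  mixture agree with the state on diagonal projections, and these determine a state on diagonal operators.
\<close>

lemma pure_state_diagonal_of_zero_one:
  assumes s: "is_state diagonal_operators s" and s01: "\<And>A. s (proj A) = 0 \<or> s (proj A) = 1"
  shows "is_pure_state diagonal_operators s"
  unfolding is_pure_state_def
proof (intro conjI s allI impI)
  note D = operator_system_diagonal
  fix g h and t :: real
  assume "is_state diagonal_operators g \<and> is_state diagonal_operators h \<and> 0 < t \<and> t < 1 \<and>
      (\<forall>T\<in>diagonal_operators. s T = of_real (1 - t) * g T + of_real t * h T)"
  then have g: "is_state diagonal_operators g" and h: "is_state diagonal_operators h" and t: "0 < t" "t < 1"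
    and conv: "\<And>A. s (proj A) = of_real (1 - t) * g (proj A) + of_real t * h (proj A)" by auto
  have zero: "g (proj A) = 0 \<and> h (proj A) = 0" if "s (proj A) = 0" for A
  proof -
    have nn: "0 \<le> Re (g (proj A))" "0 \<le> Re (h (proj A))" "Im (g (proj A)) = 0" "Im (h (proj A)) = 0"
      using state_proj_bounds(1)[OF D g, of A] state_proj_bounds(1)[OF D h, of A] by (simp_all add: less_eq_complex_def)
    have "Re (s (proj A)) = (1 - t) * Re (g (proj A)) + t * Re (h (proj A))" unfolding conv[of A] by simp
    then have "(1 - t) * Re (g (proj A)) + t * Re (h (proj A)) = 0" using that by simp
    moreover have "0 \<le> (1 - t) * Re (g (proj A))" "0 \<le> t * Re (h (proj A))" using nn t by simp_all
    ultimately have "(1 - t) * Re (g (proj A)) = 0" "t * Re (h (proj A)) = 0" by linarith+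
    then show ?thesis using nn t by (simp add: complex_eq_iff)
  qed
  have eq: "g (proj A) = s (proj A) \<and> h (proj A) = s (proj A)" for A
  proof (cases "s (proj A) = 0")
    case True
    then show ?thesis using zero by simp
  next
    case False
    then have 1: "s (proj A) = 1" using s01 by blast
    then have "s (proj (- A)) = 0" by (simp add: state_compl[OF D s])
    from zero[OF this] show ?thesis by (simp add: 1 state_compl[OF D g] state_compl[OF D h])
  qed
  show "\<forall>T\<in>diagonal_operators. g T = s T \<and> h T = s T"
    using states_eq_on_diagonal[OF D g D s] states_eq_on_diagonal[OF D h D s] eq by blast
qed

section \<open>Unique extension of pure states\<close>

lemma cinner_self_adjoint_real:
  assumes "\<And>x y. cinner (H x) y = cinner x (H y)"
  shows "Im (cinner (H x) x) = 0"
proof -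
  have "cinner (H x) x = cnj (cinner (H x) x)"
    using assms[of x x] cinner_cnj[of x "H x"] by simp
  then have "Im (cinner (H x) x) = Im (cnj (cinner (H x) x))" by (rule arg_cong)
  then show ?thesis by simp
qed

text \<open>
  For \<open>y\<close> and \<open>z\<close> the parts of \<open>x\<close> on \<open>A\<close> and off \<open>A\<close>, the mixed terms of \<open>\<langle>H x, x\<rangle>\<close> are at most
  \<open>2 M \<parallel>y\<parallel> \<parallel>z\<parallel> \<le> \<theta> \<parallel>y\<parallel>\<^sup>2 + (M\<^sup>2 / \<theta>) \<parallel>z\<parallel>\<^sup>2\<close>. So \<open>H\<close> lies below the diagonal operator \<open>G\<close> equal to \<open>2 \<theta>\<close> on \<open>A\<close>
  and to \<open>c = M\<^sup>2 / \<theta> + M\<close> off \<open>A\<close>, and \<open>h\<close> does not see the second part of \<open>G\<close>.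
\<close>

lemma state_le_of_compression_le:
  assumes h: "is_state bounded_operators h" and hA: "h (proj A) = 1"
    and H: "H \<in> bounded_operators" and sa: "\<And>x y. cinner (H x) y = cinner x (H y)"
    and \<theta>: "0 < \<theta>" and le: "\<And>x. Re (cinner (H (proj A x)) (proj A x)) \<le> \<theta> * (norm (proj A x))\<^sup>2"
  shows "h H \<le> of_real (2 * \<theta>)"
proof -
  note B = operator_system_bounded
  obtain M where M: "0 < M" "\<And>x. norm (H x) \<le> M * norm x" using bounded_operators_bound[OF H] by blast
  define c where "c = M\<^sup>2 / \<theta> + M"
  define G where "G x = scaleC (of_real (2 * \<theta>)) (proj A x) + scaleC (of_real c) (proj (- A) x)" for x
  have pm: "proj A \<in> bounded_operators" "proj (- A) \<in> bounded_operators"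
    by (rule diagonal_subset_bounded, simp)+
  have Geq: "G = (\<lambda>x. scaleC (of_real (2 * \<theta>)) (proj A x) + scaleC (of_real c) (proj (- A) x))"
    by (intro ext) (simp only: G_def)
  have GB: "G \<in> bounded_operators" unfolding Geq by (rule operator_system_combine(1)[OF B h pm])
  have hG: "h G = of_real (2 * \<theta>)"
    unfolding Geq operator_system_combine(2)[OF B h pm] by (simp add: state_compl[OF B h] hA)
  define D where "D x = scaleC 1 (G x) + scaleC (-1) (H x)" for x
  have Deq: "D = (\<lambda>x. scaleC 1 (G x) + scaleC (-1) (H x))" by (intro ext) (simp only: D_def)
  have DB: "D \<in> bounded_operators" unfolding Deq by (rule operator_system_combine(1)[OF B h GB H])
  have hD: "h D = of_real (2 * \<theta>) - h H"
    unfolding Deq operator_system_combine(2)[OF B h GB H] by (simp add: hG)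
  have "positive_operator D"
    unfolding positive_operator_def
  proof
    fix x
    define y z where "y = proj A x" and "z = proj (- A) x"
    have xyz: "x = y + z" by (rule ell2_eqI) (auto simp: y_def z_def indicator_def)
    have "cinner y z = 0"
    proof -
      have "coord y n * cnj (coord z n) = 0" for n by (simp add: y_def z_def indicator_def)
      then show ?thesis by (simp only: cinner.rep_eq suminf_zero)
    qed
    moreover from this have "cinner z y = 0" using cinner_cnj[of z y] by simp
    ultimately have Gx: "cinner (G x) x = of_real (2 * \<theta> * (norm y)\<^sup>2 + c * (norm z)\<^sup>2)"
      unfolding G_def y_def[symmetric] z_def[symmetric]
      by (subst xyz) (simp add: cinner_add_left cinner_add_right cinner_scaleC_left cinner_self_norm)
    have "cinner (H x) x = cinner (H y) y + cinner (H y) z + cinner (H z) y + cinner (H z) z"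
      unfolding xyz bounded_operators_add_apply[OF H] by (simp add: cinner_add_left cinner_add_right)
    then have "Re (cinner (H x) x) = Re (cinner (H y) y) + Re (cinner (H y) z) + Re (cinner (H z) y) + Re (cinner (H z) z)"
      by simp
    moreover have "Re (cinner (H y) y) \<le> \<theta> * (norm y)\<^sup>2" using le[of x] by (simp only: y_def)
    moreover have cs: "Re (cinner (H a) b) \<le> M * norm a * norm b" for a b
    proof -
      have "Re (cinner (H a) b) \<le> norm (H a) * norm b"
        using complex_Re_le_cmod[of "cinner (H a) b"] cmod_cinner_le[of "H a" b] by linarith
      also have "\<dots> \<le> M * norm a * norm b" by (intro mult_right_mono M) simp
      finally show ?thesis .
    qed
    moreover have "2 * (M * norm y * norm z) \<le> \<theta> * (norm y)\<^sup>2 + M\<^sup>2 / \<theta> * (norm z)\<^sup>2"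
    proof -
      have "0 \<le> (\<theta> * norm y - M * norm z)\<^sup>2" by simp
      also have "\<dots> = \<theta> * (\<theta> * (norm y)\<^sup>2 + M\<^sup>2 / \<theta> * (norm z)\<^sup>2 - 2 * (M * norm y * norm z))"
        using \<theta> by (simp add: power2_eq_square field_simps)
      finally have "0 \<le> \<theta> * (norm y)\<^sup>2 + M\<^sup>2 / \<theta> * (norm z)\<^sup>2 - 2 * (M * norm y * norm z)"
        using \<theta> by (simp add: zero_le_mult_iff)
      then show ?thesis by simp
    qed
    moreover have "M * norm z * norm z = M * (norm z)\<^sup>2" "M * norm z * norm y = M * norm y * norm z"
      by (simp_all add: power2_eq_square)
    moreover have "c * (norm z)\<^sup>2 = M\<^sup>2 / \<theta> * (norm z)\<^sup>2 + M * (norm z)\<^sup>2"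
      by (simp only: c_def distrib_right)
    ultimately have re: "Re (cinner (H x) x) \<le> 2 * \<theta> * (norm y)\<^sup>2 + c * (norm z)\<^sup>2"
      using cs[of y z] cs[of z y] cs[of z z] by linarith
    have "D x = G x - H x" by (rule ell2_eqI) (simp add: D_def)
    then have "cinner (D x) x = of_real (2 * \<theta> * (norm y)\<^sup>2 + c * (norm z)\<^sup>2) - cinner (H x) x"
      by (simp only: cinner_diff_left Gx)
    then show "0 \<le> cinner (D x) x"
      using re cinner_self_adjoint_real[OF sa, of x] by (simp add: less_eq_complex_def)
  qed
  then have "0 \<le> h D" by (rule state_positive[OF h DB])
  then show ?thesis by (simp add: hD)
qed

text \<open>
  Pave \<open>H\<close> with bound \<open>\<theta> / 2\<close>. The projections onto the classes have total mass \<open>1\<close> and single masses \<open>0\<close> or \<open>1\<close>,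
  so one class has mass \<open>1\<close>, and comparison on that class bounds \<open>h\<close> at both \<open>H\<close> and \<open>- H\<close>.
\<close>

lemma state_self_adjoint_zero_diagonal:
  assumes bp: "bessel_paving d q r" "0 < d" "0 < q" "q < 1"
    and h: "is_state bounded_operators h" and h01: "\<And>A. h (proj A) = 0 \<or> h (proj A) = 1"
    and H: "H \<in> bounded_operators" and sa: "\<And>x y. cinner (H x) y = cinner x (H y)"
    and diag: "\<And>n. coord (H (ket n)) n = 0"
  shows "h H = 0"
proof -
  note B = operator_system_bounded
  obtain M where M: "0 < M" "\<And>x. norm (H x) \<le> M * norm x" using bounded_operators_bound[OF H] by blast
  have small: "cmod (h H) \<le> 0 + \<theta>" if \<theta>: "0 < \<theta>" for \<theta>
  proof -
    define a where "a i j = coord (H (ket j)) i" for i j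
    have "\<exists>R c. (\<forall>i. c i < R) \<and> (\<forall>n. block_bound n a c (\<theta> / 2))"
    proof (rule infinite_paving[OF bp M(1)])
      show "0 < \<theta> / 2" using \<theta> by simp
      show "a j i = cnj (a i j)" for i j
      proof -
        have "a j i = cinner (ket i) (H (ket j))" by (simp only: a_def cinner_ket[symmetric] sa)
        also have "\<dots> = cnj (a i j)" by (subst cinner_cnj) (simp only: a_def cinner_ket)
        finally show ?thesis .
      qed
      show "a i i = 0" for i by (simp add: a_def diag)
      show "bessel n n a (M\<^sup>2)" for n
      proof -
        have "a = (\<lambda>i j. coord (H (ket j)) i)" by (intro ext) (simp only: a_def)
        then show ?thesis using bessel_operator_kernel[OF H M(2), of n] by simp
      qed
    qed
    then obtain R and c :: "nat \<Rightarrow> nat" where c: "\<And>i. c i < R" and bb: "\<And>n. block_bound n a c (\<theta> / 2)" by blast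
    have "\<exists>\<kappa><R. h (proj {n. c n = \<kappa>}) = 1"
    proof (rule ccontr)
      assume "\<not> (\<exists>\<kappa><R. h (proj {n. c n = \<kappa>}) = 1)"
      then have "(\<Sum>\<kappa><R. h (proj {n. c n = \<kappa>})) = 0" using h01 by (intro sum.neutral) blast
      then show False using state_partition[OF B h c] by simp
    qed
    then obtain \<kappa> where \<kappa>: "h (proj {n. c n = \<kappa>}) = 1" by blast
    define A where "A = {n. c n = \<kappa>}"
    have bound: "cmod (cinner (H (proj A x)) (proj A x)) \<le> \<theta> / 2 * (norm (proj A x))\<^sup>2" for x
    proof -
      define y where "y = proj A x"
      have lim: "(\<lambda>n. cmod (cinner (H (fin_vec n (coord y))) (fin_vec n (coord y)))) \<longlonglongrightarrow> cmod (cinner (H y) y)"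
        by (intro tendsto_norm tendsto_cinner bounded_operators_tendsto[OF H] fin_vec_tendsto)
      have "cmod (cinner (H (fin_vec n (coord y))) (fin_vec n (coord y))) \<le> \<theta> / 2 * (norm y)\<^sup>2" for n
      proof -
        have "\<forall>i<n. c i \<noteq> \<kappa> \<longrightarrow> coord y i = 0" by (simp add: y_def A_def)
        then have "cmod (qform n a (coord y)) \<le> \<theta> / 2 * sqnorm n (coord y)"
          using bb[of n] unfolding block_bound_def by blast
        also have "\<dots> \<le> \<theta> / 2 * (norm y)\<^sup>2"
          using \<theta> by (intro mult_left_mono sum_coord_le_norm) simp
        finally show ?thesis unfolding cinner_operator_fin_vec[OF H] a_def .
      qed
      then have "cmod (cinner (H y) y) \<le> \<theta> / 2 * (norm y)\<^sup>2" by (intro LIMSEQ_le_const2[OF lim]) blast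
      then show ?thesis by (simp only: y_def)
    qed
    let ?A = "{n. c n = \<kappa>}"
    have up: "h H \<le> of_real (2 * (\<theta> / 2))"
    proof (rule state_le_of_compression_le[OF h \<kappa> H sa])
      show "Re (cinner (H (proj ?A x)) (proj ?A x)) \<le> \<theta> / 2 * (norm (proj ?A x))\<^sup>2" for x
        using bound[of x] complex_Re_le_cmod order_trans unfolding A_def by blast
    qed (use \<theta> in simp)
    define N where "N x = scaleC (-1) (H x)" for x
    have Neq: "N = (\<lambda>x. scaleC (-1) (H x))" by (intro ext) (simp only: N_def)
    have NB: "N \<in> bounded_operators" unfolding Neq by (rule bounded_operators_scaleC[OF H])
    have "h N \<le> of_real (2 * (\<theta> / 2))"
    proof (rule state_le_of_compression_le[OF h \<kappa> NB])
      show "cinner (N x) y = cinner x (N y)" for x y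
        by (simp add: N_def cinner_scaleC_left cinner_scaleC_right sa)
      show "Re (cinner (N (proj ?A x)) (proj ?A x)) \<le> \<theta> / 2 * (norm (proj ?A x))\<^sup>2" for x
        using bound[of x] abs_Re_le_cmod[of "cinner (H (proj A x)) (proj A x)"]
        by (simp add: N_def cinner_scaleC_left A_def)
    qed (use \<theta> in simp)
    also have "h N = - h H" unfolding Neq state_scaleC[OF h H] by simp
    finally have "Im (h H) = 0" "\<bar>Re (h H)\<bar> \<le> \<theta>"
      using up by (simp_all add: less_eq_complex_def abs_le_iff)
    then show ?thesis by (simp add: cmod_eq_Re)
  qed
  have "cmod (h H) \<le> 0" by (rule field_le_epsilon) (rule small)
  then show ?thesis by simp
qed

definition diagonal_part :: "(ell2 \<Rightarrow> ell2) \<Rightarrow> ell2 \<Rightarrow> ell2" where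
  "diagonal_part T = diag_op (\<lambda>n. coord (T (ket n)) n)"

lemma diagonal_entries_bounded:
  assumes "T \<in> bounded_operators"
  obtains M where "\<And>n. cmod (coord (T (ket n)) n) \<le> M"
proof -
  obtain M where M: "\<And>x. norm (T x) \<le> M * norm x" using bounded_operators_bound[OF assms] by blast
  have "cmod (coord (T (ket n)) n) \<le> M" for n
    using cmod_coord_le[of "T (ket n)" n] M[of "ket n"] by simp
  then show ?thesis by (rule that)
qed

lemma diagonal_part_diagonal:
  assumes "T \<in> bounded_operators"
  shows "diagonal_part T \<in> diagonal_operators"
proof -
  obtain M where "\<And>n. cmod (coord (T (ket n)) n) \<le> M" using diagonal_entries_bounded[OF assms] by blast
  then show ?thesis unfolding diagonal_part_def by (rule diag_op_diagonal)
qed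

lemma diagonal_part_diag:
  assumes "T \<in> diagonal_operators"
  shows "diagonal_part T = T"
proof -
  obtain d B where B: "\<And>n. cmod (d n) \<le> B" and T: "T = diag_op d" using diagonal_operatorsE[OF assms] by blast
  show ?thesis by (simp add: diagonal_part_def T coord_diag_op[OF B])
qed

text \<open>
  The off-diagonal part \<open>T0\<close> of \<open>T\<close> is \<open>H + \<i> K\<close> with \<open>H\<close> and \<open>K\<close> self-adjoint and of zero
  diagonal, and \<open>h\<close> vanishes on both.
\<close>

lemma state_eq_state_diagonal_part:
  assumes bp: "bessel_paving d q r" "0 < d" "0 < q" "q < 1"
    and h: "is_state bounded_operators h" and h01: "\<And>A. h (proj A) = 0 \<or> h (proj A) = 1"
    and T: "T \<in> bounded_operators"
  shows "h T = h (diagonal_part T)"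
proof -
  note B = operator_system_bounded
  have E: "diagonal_part T \<in> bounded_operators"
    by (rule diagonal_subset_bounded[OF diagonal_part_diagonal[OF T]])
  obtain M where M: "\<And>n. cmod (coord (T (ket n)) n) \<le> M" using diagonal_entries_bounded[OF T] by blast
  define T0 where "T0 = (\<lambda>x. scaleC 1 (T x) + scaleC (-1) (diagonal_part T x))"
  have T0: "T0 \<in> bounded_operators" unfolding T0_def by (rule operator_system_combine(1)[OF B h T E])
  have hT0: "h T0 = h T - h (diagonal_part T)"
    unfolding T0_def operator_system_combine(2)[OF B h T E] by simp
  have T0d: "coord (T0 (ket n)) n = 0" for n
    by (simp add: T0_def diagonal_part_def coord_diag_op[OF M])
  obtain S where S: "S \<in> bounded_operators" and adj: "\<And>x y. cinner (S x) y = cinner x (T0 y)"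
    using ex_adjoint[OF T0] by blast
  have adj': "cinner x (S y) = cinner (T0 x) y" for x y
    by (subst cinner_cnj, subst adj, subst cinner_cnj[of y "T0 x"]) simp
  have Sd: "coord (S (ket n)) n = 0" for n
  proof -
    have "coord (S (ket n)) n = cinner (ket n) (T0 (ket n))" by (simp only: cinner_ket[symmetric] adj)
    also have "\<dots> = 0" by (subst cinner_cnj) (simp only: cinner_ket T0d complex_cnj_zero)
    finally show ?thesis .
  qed
  define H where "H = (\<lambda>x. scaleC (1/2) (T0 x) + scaleC (1/2) (S x))"
  define K where "K = (\<lambda>x. scaleC (- \<i>/2) (T0 x) + scaleC (\<i>/2) (S x))"
  have HB: "H \<in> bounded_operators" unfolding H_def by (rule operator_system_combine(1)[OF B h T0 S])
  have KB: "K \<in> bounded_operators" unfolding K_def by (rule operator_system_combine(1)[OF B h T0 S])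
  have "h H = 0"
  proof (rule state_self_adjoint_zero_diagonal[OF bp h h01 HB])
    show "cinner (H x) y = cinner x (H y)" for x y
      by (simp add: H_def cinner_add_left cinner_add_right cinner_scaleC_left cinner_scaleC_right adj adj')
    show "coord (H (ket n)) n = 0" for n by (simp add: H_def T0d Sd)
  qed
  moreover have "h K = 0"
  proof (rule state_self_adjoint_zero_diagonal[OF bp h h01 KB])
    show "cinner (K x) y = cinner x (K y)" for x y
      by (simp add: K_def cinner_add_left cinner_add_right cinner_scaleC_left cinner_scaleC_right adj adj')
    show "coord (K (ket n)) n = 0" for n by (simp add: K_def T0d Sd)
  qed
  moreover have "T0 = (\<lambda>x. scaleC 1 (H x) + scaleC \<i> (K x))"
    by (intro ext ell2_eqI) (simp add: H_def K_def algebra_simps)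
  ultimately have "h T0 = 0" using operator_system_combine(2)[OF B h HB KB, of 1 \<i>] by simp
  then show ?thesis by (simp add: hT0)
qed

text \<open>
  The only possible extension of \<open>s\<close> is \<open>T \<mapsto> s (diagonal_part T)\<close>. If it is a mixture of two states, their
  restrictions to the diagonal operators equal \<open>s\<close> by purity, so both are again this extension.
\<close>

lemma kadison_singer_of_bessel_paving:
  assumes bp: "bessel_paving d q r" "0 < d" "0 < q" "q < 1"
  shows kadison_singer
  unfolding kadison_singer_def
proof (intro allI impI)
  fix s assume p: "is_pure_state diagonal_operators s"
  note B = operator_system_bounded and D = operator_system_diagonal
  have s: "is_state diagonal_operators s" using p by (simp add: is_pure_state_def)
  define g where "g T = s (diagonal_part T)" for T
  have gD: "g T = s T" if "T \<in> diagonal_operators" for T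
    using that by (simp add: g_def diagonal_part_diag)
  have gs: "is_state bounded_operators g"
    unfolding is_state_def
  proof (intro conjI ballI allI impI)
    fix S T assume S: "S \<in> bounded_operators" and T: "T \<in> bounded_operators"
    obtain M where M: "\<And>n. cmod (coord (S (ket n)) n) \<le> M" using diagonal_entries_bounded[OF S] by blast
    obtain N where N: "\<And>n. cmod (coord (T (ket n)) n) \<le> N" using diagonal_entries_bounded[OF T] by blast
    have "diagonal_part (\<lambda>x. S x + T x) = (\<lambda>x. diagonal_part S x + diagonal_part T x)"
      unfolding diagonal_part_def by (simp add: diag_op_add[OF M N])
    then show "g (\<lambda>x. S x + T x) = g S + g T"
      using state_add[OF s diagonal_part_diagonal[OF S] diagonal_part_diagonal[OF T]] by (simp add: g_def)
  next
    fix c T assume T: "T \<in> bounded_operators"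
    obtain N where N: "\<And>n. cmod (coord (T (ket n)) n) \<le> N" using diagonal_entries_bounded[OF T] by blast
    have "diagonal_part (\<lambda>x. scaleC c (T x)) = (\<lambda>x. scaleC c (diagonal_part T x))"
      unfolding diagonal_part_def by (simp add: diag_op_scaleC[OF N])
    then show "g (\<lambda>x. scaleC c (T x)) = c * g T"
      using state_scaleC[OF s diagonal_part_diagonal[OF T]] by (simp add: g_def)
  next
    show "g (\<lambda>x. x) = 1" by (simp add: g_def diagonal_part_def diag_op_one state_id[OF s])
  next
    fix T assume T: "T \<in> bounded_operators" and pos: "positive_operator T"
    obtain N where N: "\<And>n. cmod (coord (T (ket n)) n) \<le> N" using diagonal_entries_bounded[OF T] by blast
    have "0 \<le> coord (T (ket n)) n" for n
      using pos unfolding positive_operator_def cinner_ket[symmetric] by blast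
    then have "positive_operator (diagonal_part T)"
      unfolding diagonal_part_def positive_diag_op_iff[OF N] by blast
    then show "0 \<le> g T" unfolding g_def by (rule state_positive[OF s diagonal_part_diagonal[OF T]])
  qed
  have uniq: "h T = g T" if h: "is_state bounded_operators h" and hs: "\<And>T. T \<in> diagonal_operators \<Longrightarrow> h T = s T"
    and T: "T \<in> bounded_operators" for h T
  proof -
    have "h (proj A) = 0 \<or> h (proj A) = 1" for A
      using pure_state_diagonal_zero_one[OF p, of A] hs[of "proj A"] by simp
    then have "h T = h (diagonal_part T)" by (rule state_eq_state_diagonal_part[OF bp h _ T])
    then show ?thesis by (simp add: g_def hs diagonal_part_diagonal[OF T])
  qed
  have "is_pure_state bounded_operators g"
    unfolding is_pure_state_def
  proof (intro conjI allI impI gs)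
    fix k l and t :: real
    assume A: "is_state bounded_operators k \<and> is_state bounded_operators l \<and> 0 < t \<and> t < 1 \<and>
        (\<forall>T\<in>bounded_operators. g T = of_real (1 - t) * k T + of_real t * l T)"
    have sub: "diagonal_operators \<subseteq> bounded_operators" using diagonal_subset_bounded by blast
    have "is_state diagonal_operators k \<and> is_state diagonal_operators l \<and> 0 < t \<and> t < 1 \<and>
        (\<forall>T\<in>diagonal_operators. s T = of_real (1 - t) * k T + of_real t * l T)"
    proof (intro conjI ballI)
      show "s T = of_real (1 - t) * k T + of_real t * l T" if "T \<in> diagonal_operators" for T
        using A gD[OF that] diagonal_subset_bounded[OF that] by simp
    qed (use A is_state_subset[OF _ sub] in blast)+
    then have "\<forall>T\<in>diagonal_operators. k T = s T \<and> l T = s T"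
      using p unfolding is_pure_state_def by blast
    then show "\<forall>T\<in>bounded_operators. k T = g T \<and> l T = g T"
      using A uniq by blast
  qed
  then show "\<exists>g. is_pure_state bounded_operators g \<and> (\<forall>T\<in>diagonal_operators. g T = s T) \<and>
      (\<forall>h. is_state bounded_operators h \<and> (\<forall>T\<in>diagonal_operators. h T = s T) \<longrightarrow>
        (\<forall>T\<in>bounded_operators. h T = g T))"
    using gD uniq by blast
qed

section \<open>Direct sums of projections that cannot be paved\<close>

lemma projection_mult_norm:
  assumes P: "orthogonal_projection n P"
  shows "complex_of_real (\<Sum>i<n. (cmod (\<Sum>j<n. P $$ (i, j) * w j))\<^sup>2) =
      (\<Sum>i<n. cnj (w i) * (\<Sum>j<n. P $$ (i, j) * w j))"
proof -
  have Pc: "P \<in> carrier_mat n n" and PP: "P * P = P" and PA: "mat_adjoint P = P"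
    using P by (auto simp: orthogonal_projection_def)
  define z where "z i = (\<Sum>j<n. P $$ (i, j) * w j)" for i
  have herm: "cnj (P $$ (i, j)) = P $$ (j, i)" if "i < n" "j < n" for i j
    using mat_adjoint_index[OF Pc that(2) that(1)] by (simp add: PA)
  have idem: "(\<Sum>k<n. P $$ (i, k) * P $$ (k, j)) = P $$ (i, j)" if "i < n" "j < n" for i j
  proof -
    have "(P * P) $$ (i, j) = (\<Sum>k<n. P $$ (i, k) * P $$ (k, j))"
      using Pc that by (simp add: scalar_prod_def atLeast0LessThan)
    then show ?thesis by (simp add: PP)
  qed
  have "complex_of_real (sqnorm n z) = (\<Sum>i<n. cnj (z i) * z i)"
    by (simp only: of_real_sum cnj_mult_self)
  also have "\<dots> = (\<Sum>i<n. \<Sum>j<n. cnj (w j) * (P $$ (j, i) * z i))"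
  proof (rule sum.cong[OF refl])
    fix i assume "i \<in> {..<n}"
    then have "cnj (z i) = (\<Sum>j<n. cnj (w j) * P $$ (j, i))"
      unfolding z_def cnj_sum by (intro sum.cong refl) (simp add: herm)
    then show "cnj (z i) * z i = (\<Sum>j<n. cnj (w j) * (P $$ (j, i) * z i))"
      by (simp only: sum_distrib_right mult.assoc)
  qed
  also have "\<dots> = (\<Sum>j<n. \<Sum>i<n. cnj (w j) * (P $$ (j, i) * z i))" by (rule sum.swap)
  also have "\<dots> = (\<Sum>j<n. cnj (w j) * z j)"
  proof (rule sum.cong[OF refl])
    fix j assume j: "j \<in> {..<n}"
    have "(\<Sum>i<n. P $$ (j, i) * z i) = (\<Sum>i<n. \<Sum>k<n. P $$ (j, i) * P $$ (i, k) * w k)"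
      by (simp add: z_def sum_distrib_left mult.assoc)
    also have "\<dots> = (\<Sum>k<n. \<Sum>i<n. P $$ (j, i) * P $$ (i, k) * w k)" by (rule sum.swap)
    also have "\<dots> = z j"
      unfolding z_def using j by (intro sum.cong refl) (simp add: idem flip: sum_distrib_right)
    finally show "(\<Sum>i<n. cnj (w j) * (P $$ (j, i) * z i)) = cnj (w j) * z j"
      by (simp flip: sum_distrib_left)
  qed
  finally show ?thesis by (simp only: z_def)
qed

lemma projection_contraction:
  assumes P: "orthogonal_projection n P"
  shows "(\<Sum>i<n. (cmod (\<Sum>j<n. P $$ (i, j) * w j))\<^sup>2) \<le> sqnorm n w" (is "?X \<le> ?W")
proof -
  have X0: "0 \<le> ?X" by (simp add: sum_nonneg)
  have "?X\<^sup>2 = (cmod (complex_of_real ?X))\<^sup>2" by (simp only: norm_of_real power2_abs)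
  also have "\<dots> \<le> ?W * ?X"
    unfolding projection_mult_norm[OF P]
    using cmod_sum_mult_le[of "\<lambda>i. cnj (w i)" "\<lambda>i. \<Sum>j<n. P $$ (i, j) * w j" "{..<n}"] by simp
  finally have "?X * ?X \<le> ?W * ?X" by (simp only: power2_eq_square)
  then show ?thesis
    using X0 by (cases "?X = 0") (simp_all add: sum_nonneg mult_le_cancel_right)
qed

text \<open>
  The direct sum of the matrices \<open>P r\<close>, with coordinate \<open>i\<close> of block \<open>r\<close> stored at position
  \<open>prod_encode (r, i)\<close>; positions with \<open>i \<ge> n r\<close> carry the zero operator.
\<close>

definition block_diag_op :: "(nat \<Rightarrow> nat) \<Rightarrow> (nat \<Rightarrow> complex mat) \<Rightarrow> ell2 \<Rightarrow> ell2" where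
  "block_diag_op n P x = Abs_ell2 (\<lambda>p. case prod_decode p of (r, i) \<Rightarrow>
     if i < n r then \<Sum>j<n r. P r $$ (i, j) * coord x (prod_encode (r, j)) else 0)"

lemma block_diag_op_projections:
  assumes P: "\<And>r. orthogonal_projection (n r) (P r)"
  shows coord_block_diag_op: "coord (block_diag_op n P x) (prod_encode (r, i)) =
      (if i < n r then \<Sum>j<n r. P r $$ (i, j) * coord x (prod_encode (r, j)) else 0)"
    and block_diag_op_bounded: "block_diag_op n P \<in> bounded_operators"
proof -
  define y where "y x p = (case prod_decode p of (r, i) \<Rightarrow>
     if i < n r then \<Sum>j<n r. P r $$ (i, j) * coord x (prod_encode (r, j)) else 0)" for x p
  have ye: "y x (prod_encode (r, i)) = (if i < n r then \<Sum>j<n r. P r $$ (i, j) * coord x (prod_encode (r, j)) else 0)" for x r i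
    by (simp add: y_def)
  have bound: "sqnorm N (y x) \<le> (norm x)\<^sup>2" for x N
  proof -
    define I where "I = Sigma {..<N} (\<lambda>r. {..<n r})"
    have finI: "finite I" by (simp add: I_def)
    have inj: "inj_on prod_encode I" by (rule inj_prod_encode)
    have "sqnorm N (y x) \<le> (\<Sum>p\<in>{..<N} \<union> prod_encode ` I. (cmod (y x p))\<^sup>2)"
      using finI by (intro sum_mono2) auto
    also have "\<dots> = (\<Sum>p\<in>prod_encode ` I. (cmod (y x p))\<^sup>2)"
    proof (rule sum.mono_neutral_right)
      show "\<forall>p\<in>{..<N} \<union> prod_encode ` I - prod_encode ` I. (cmod (y x p))\<^sup>2 = 0"
      proof
        fix p assume p: "p \<in> {..<N} \<union> prod_encode ` I - prod_encode ` I"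
        obtain r i where ri: "p = prod_encode (r, i)" by (metis prod_decode_inverse surj_pair)
        have "r < N" using p le_prod_encode_1[of r i] ri by auto
        then have "\<not> i < n r" using p by (auto simp: ri I_def)
        then show "(cmod (y x p))\<^sup>2 = 0" by (simp add: ri ye)
      qed
    qed (use finI in auto)
    also have "\<dots> = (\<Sum>(r, i)\<in>I. (cmod (y x (prod_encode (r, i))))\<^sup>2)"
      by (simp add: sum.reindex[OF inj] o_def case_prod_unfold)
    also have "\<dots> = (\<Sum>r<N. \<Sum>i<n r. (cmod (\<Sum>j<n r. P r $$ (i, j) * coord x (prod_encode (r, j))))\<^sup>2)"
      unfolding I_def by (subst sum.Sigma[symmetric]) (auto simp: ye intro!: sum.cong)
    also have "\<dots> \<le> (\<Sum>r<N. \<Sum>j<n r. (cmod (coord x (prod_encode (r, j))))\<^sup>2)"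
      by (intro sum_mono projection_contraction P)
    also have "\<dots> = (\<Sum>(r, i)\<in>I. (cmod (coord x (prod_encode (r, i))))\<^sup>2)"
      unfolding I_def by (subst sum.Sigma) auto
    also have "\<dots> = (\<Sum>p\<in>prod_encode ` I. (cmod (coord x p))\<^sup>2)"
      by (simp add: sum.reindex[OF inj] o_def case_prod_unfold)
    also have "\<dots> \<le> (norm x)\<^sup>2"
      unfolding norm_power2_ell2 using finI by (intro sum_le_suminf summable_coord) auto
    finally show ?thesis .
  qed
  have sm: "summable (\<lambda>p. (cmod (y x p))\<^sup>2)" for x
    by (rule bounded_imp_summable[where B = "(norm x)\<^sup>2"])
      (use bound[where x = x and N = "Suc _"] in \<open>simp_all add: lessThan_Suc_atMost\<close>)
  have Tc: "coord (block_diag_op n P x) p = y x p" for x p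
  proof -
    have "block_diag_op n P x = Abs_ell2 (y x)"
      unfolding block_diag_op_def y_def ..
    then show ?thesis by (simp add: Abs_ell2_inverse sm)
  qed
  then show "coord (block_diag_op n P x) (prod_encode (r, i)) =
      (if i < n r then \<Sum>j<n r. P r $$ (i, j) * coord x (prod_encode (r, j)) else 0)"
    by (simp add: ye)
  show "block_diag_op n P \<in> bounded_operators"
  proof (rule bounded_operatorsI[where M = 1])
    show "block_diag_op n P (x + z) = block_diag_op n P x + block_diag_op n P z" for x z
      by (rule ell2_eqI) (simp add: Tc y_def distrib_left sum.distrib split: prod.split)
    show "block_diag_op n P (scaleC c x) = scaleC c (block_diag_op n P x)" for c x
      by (rule ell2_eqI) (simp add: Tc y_def sum_distrib_left mult.left_commute split: prod.split)
    show "norm (block_diag_op n P x) \<le> norm x * 1" for x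
      by (rule norm_ell2_le) (use bound in \<open>simp_all add: Tc\<close>)
  qed
qed

text \<open>
  The threshold \<open>1/4\<close> lies above the diagonal entries, at most \<open>1/16\<close>, and its square root is the
  norm \<open>1/2\<close> allowed for the blocks.
\<close>

definition quarter_bounded :: "(ell2 \<Rightarrow> ell2) \<Rightarrow> nat set \<Rightarrow> bool" where
  "quarter_bounded T A \<longleftrightarrow> (\<forall>x. (\<forall>n. n \<notin> A \<longrightarrow> coord x n = 0) \<longrightarrow> Re (cinner (T x) x) \<le> 1 / 4 * (norm x)\<^sup>2)"

lemma quarter_bounded_subset: "quarter_bounded T A \<Longrightarrow> B \<subseteq> A \<Longrightarrow> quarter_bounded T B"
  unfolding quarter_bounded_def by blast

text \<open>
  For a projection \<open>P\<close> and a vector \<open>w\<close> supported on the block, \<open>\<parallel>P w\<parallel>\<^sup>2 = \<langle>P w, w\<rangle> \<le> \<parallel>w\<parallel>\<^sup>2 / 4\<close>, so already \<open>P Q\<close>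
  has norm at most \<open>1/2\<close>.
\<close>

lemma opnorm_le_half_of_quarter_bounded:
  assumes P: "\<And>r. orthogonal_projection (n r) (P r)"
    and A: "quarter_bounded (block_diag_op n P) A"
  shows "opnorm_mat (diag_proj (n r) {i. prod_encode (r, i) \<in> A} * P r * diag_proj (n r) {i. prod_encode (r, i) \<in> A}) \<le> 1 / 2"
    (is "opnorm_mat (?Q * _ * _) \<le> _")
proof (rule opnorm_le)
  have Pc: "P r \<in> carrier_mat (n r) (n r)" using P[of r] by (simp add: orthogonal_projection_def)
  show "?Q * P r * ?Q \<in> carrier_mat (n r) (n r)"
    by (intro mult_carrier_mat[of _ _ "n r"] Pc diag_proj_carrier)
  fix v :: "complex Matrix.vec" assume v: "v \<in> carrier_vec (n r)"
  define w where "w i = (if prod_encode (r, i) \<in> A then v $ i else 0)" for i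
  define z where "z i = (\<Sum>j<n r. P r $$ (i, j) * w j)" for i
  define x where "x = (\<Sum>i<n r. scaleC (w i) (ket (prod_encode (r, i))))"
  have xc: "coord x (prod_encode (r, i)) = w i" if "i < n r" for i
    using that by (simp add: x_def if_distrib eq_commute[of i] cong: if_cong)
  have cx: "cinner u x = (\<Sum>i<n r. cnj (w i) * coord u (prod_encode (r, i)))" for u
  proof -
    have "cinner u x = cnj (\<Sum>i<n r. w i * cnj (coord u (prod_encode (r, i))))"
      by (subst cinner_cnj)
        (simp only: x_def cinner_sum_left cinner_scaleC_left cinner_cnj[of "ket _" u] cinner_ket)
    then show ?thesis by simp
  qed
  have nx: "(norm x)\<^sup>2 = sqnorm (n r) w"
  proof -
    have "complex_of_real ((norm x)\<^sup>2) = (\<Sum>i<n r. cnj (w i) * w i)"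
      unfolding cinner_self_norm[symmetric] cx by (simp add: xc)
    then show ?thesis by (simp only: cnj_mult_self of_real_sum[symmetric] of_real_eq_iff)
  qed
  have Tx: "cinner (block_diag_op n P x) x = complex_of_real (sqnorm (n r) z)"
  proof -
    have "coord (block_diag_op n P x) (prod_encode (r, i)) = z i" if "i < n r" for i
      using that by (simp add: coord_block_diag_op[OF P] z_def xc)
    then show ?thesis unfolding cx z_def projection_mult_norm[OF P] by simp
  qed
  have "coord x p = 0" if "p \<notin> A" for p
    using that by (auto simp: x_def w_def intro!: sum.neutral)
  then have "Re (cinner (block_diag_op n P x) x) \<le> 1 / 4 * (norm x)\<^sup>2"
    using A unfolding quarter_bounded_def by blast
  then have zw: "sqnorm (n r) z \<le> 1 / 4 * sqnorm (n r) w"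
    unfolding Tx nx by simp
  have Qv: "?Q *\<^sub>v v = Matrix.vec (n r) w"
    unfolding diag_proj_mult_vec[OF v] by (rule eq_vecI) (simp_all add: w_def)
  have PQv: "(P r *\<^sub>v Matrix.vec (n r) w) $ i = z i" if "i < n r" for i
    unfolding mult_mat_vec_index[OF Pc vec_carrier that] z_def by (intro sum.cong refl) simp
  have "(l2norm_vec ((?Q * P r * ?Q) *\<^sub>v v))\<^sup>2 = (\<Sum>i<n r. (cmod (if prod_encode (r, i) \<in> A then z i else 0))\<^sup>2)"
    unfolding l2norm_vec_power2 compression_mult_vec[OF Pc v] Qv
      diag_proj_mult_vec[OF mult_mat_vec_carrier[OF Pc vec_carrier]]
    by (auto simp: PQv simp del: index_mult_mat_vec intro!: sum.cong)
  also have "\<dots> \<le> sqnorm (n r) z" by (intro sum_mono) simp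
  also have "\<dots> \<le> 1 / 4 * sqnorm (n r) w" by (rule zw)
  also have "\<dots> \<le> 1 / 4 * (\<Sum>i<n r. (cmod (v $ i))\<^sup>2)"
    by (intro mult_left_mono sum_mono) (simp_all add: w_def)
  also have "\<dots> = (1 / 2 * l2norm_vec v)\<^sup>2"
    using v by (simp add: power_mult_distrib power_divide l2norm_vec_power2)
  finally show "l2norm_vec ((?Q * P r * ?Q) *\<^sub>v v) \<le> 1 / 2 * l2norm_vec v"
    by (rule power2_le_imp_le) simp
qed simp

lemma partition_of_cover:
  assumes fin: "finite X" and cov: "\<Union>X = UNIV"
  shows "\<exists>B. is_partition n (card X) B \<and> (\<forall>j\<in>{1..card X}. \<exists>A\<in>X. B j \<subseteq> {i. f i \<in> A})"
proof -
  obtain h where h: "bij_betw h {1..card X} X" using ex_bij_betw_nat_finite_1[OF fin] by blast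
  define B where "B j = {i. i < n \<and> f i \<in> h j \<and> (\<forall>l\<in>{1..<j}. f i \<notin> h l)}" for j
  have "disjoint_family_on B {1..card X}"
    unfolding disjoint_family_on_def
  proof (intro ballI impI)
    fix j l assume "j \<in> {1..card X}" "l \<in> {1..card X}" "j \<noteq> l"
    then show "B j \<inter> B l = {}"
      by (cases "j < l") (auto simp: B_def)
  qed
  moreover have "(\<Union>j\<in>{1..card X}. B j) = {..<n}"
  proof
    show "{..<n} \<subseteq> (\<Union>j\<in>{1..card X}. B j)"
    proof
      fix i assume i: "i \<in> {..<n}"
      have "\<exists>j. j \<in> {1..card X} \<and> f i \<in> h j"
      proof -
        obtain A where "A \<in> X" "f i \<in> A" using cov by blast
        then show ?thesis using h unfolding bij_betw_def by (metis imageE)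
      qed
      then have L: "(LEAST j. j \<in> {1..card X} \<and> f i \<in> h j) \<in> {1..card X} \<and> f i \<in> h (LEAST j. j \<in> {1..card X} \<and> f i \<in> h j)"
        by (rule LeastI_ex)
      define m where "m = (LEAST j. j \<in> {1..card X} \<and> f i \<in> h j)"
      have "f i \<notin> h l" if "l \<in> {1..<m}" for l
        using not_less_Least[of l "\<lambda>j. j \<in> {1..card X} \<and> f i \<in> h j"] that L unfolding m_def by auto
      then have "i \<in> B m" using L i unfolding B_def m_def by blast
      then show "i \<in> (\<Union>j\<in>{1..card X}. B j)" using L unfolding m_def by blast
    qed
  qed (auto simp: B_def)
  moreover have "\<exists>A\<in>X. B j \<subseteq> {i. f i \<in> A}" if "j \<in> {1..card X}" for j
  proof -
    have "h j \<in> X" using h that unfolding bij_betw_def by blast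
    then show ?thesis by (auto simp: B_def)
  qed
  ultimately show ?thesis unfolding is_partition_def by blast
qed

lemma cmod_diagonal_block_diag_op_le:
  assumes P: "\<And>r. orthogonal_projection (n r) (P r)" and small: "\<And>r. max_diag (P r) \<le> \<delta>" and \<delta>: "0 \<le> \<delta>"
  shows "cmod (coord (block_diag_op n P (ket p)) p) \<le> \<delta>"
proof -
  obtain r i where p: "p = prod_encode (r, i)" by (metis prod_decode_inverse surj_pair)
  show ?thesis
  proof (cases "i < n r")
    case True
    have dim: "dim_row (P r) = n r" using P[of r] by (auto simp: orthogonal_projection_def)
    have "coord (block_diag_op n P (ket p)) p = (\<Sum>j<n r. if j = i then P r $$ (i, i) else 0)"
      unfolding p coord_block_diag_op[OF P] using True by (simp add: if_distrib cong: if_cong)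
    also have "cmod \<dots> \<le> max_diag (P r)"
      using True dim unfolding max_diag_def by simp
    finally show ?thesis using small[of r] by linarith
  next
    case False
    then show ?thesis using \<delta> by (simp add: p coord_block_diag_op[OF P])
  qed
qed

text \<open>
  A cover by \<open>r\<close> such sets would cut the \<open>r\<close>-th projection into \<open>r\<close> blocks of norm at most \<open>1/2\<close>,
  which the assumption on that projection excludes.
\<close>

lemma not_finite_cover_by_quarter_bounded_sets:
  assumes P: "\<And>r. orthogonal_projection (n r) (P r)"
    and bad: "\<And>r. \<not> (\<exists>A. is_partition (n r) r A \<and>
        (\<forall>j\<in>{1..r}. opnorm_mat (diag_proj (n r) (A j) * P r * diag_proj (n r) (A j)) \<le> 1 / 2))"
    and X: "finite X" "\<And>A. A \<in> X \<Longrightarrow> quarter_bounded (block_diag_op n P) A"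
  shows "\<Union>X \<noteq> UNIV"
proof
  assume "\<Union>X = UNIV"
  define r where "r = card X"
  obtain B where B: "is_partition (n r) r B"
    and sub: "\<And>j. j \<in> {1..r} \<Longrightarrow> \<exists>A\<in>X. B j \<subseteq> {i. prod_encode (r, i) \<in> A}"
    using partition_of_cover[OF X(1) \<open>\<Union>X = UNIV\<close>, of "n r" "\<lambda>i. prod_encode (r, i)"] unfolding r_def by blast
  have "opnorm_mat (diag_proj (n r) (B j) * P r * diag_proj (n r) (B j)) \<le> 1 / 2" if j: "j \<in> {1..r}" for j
  proof -
    obtain A where A: "A \<in> X" "B j \<subseteq> {i. prod_encode (r, i) \<in> A}" using sub[OF j] by blast
    have "quarter_bounded (block_diag_op n P) ((\<lambda>i. prod_encode (r, i)) ` B j)"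
      using A by (intro quarter_bounded_subset[OF X(2)[OF A(1)]]) auto
    moreover have "{i. prod_encode (r, i) \<in> (\<lambda>i. prod_encode (r, i)) ` B j} = B j" by auto
    ultimately show ?thesis using opnorm_le_half_of_quarter_bounded[OF P, where A = "(\<lambda>i. prod_encode (r, i)) ` B j" and r = r] by simp
  qed
  then show False using B bad by blast
qed

lemma ex_unit_vector_of_not_quarter_bounded:
  assumes T: "T \<in> bounded_operators" and A: "\<not> quarter_bounded T A"
  shows "\<exists>x. norm x = 1 \<and> (\<forall>n. n \<notin> A \<longrightarrow> coord x n = 0) \<and> 1 / 4 \<le> Re (cinner (T x) x)"
proof -
  obtain x where x: "\<And>n. n \<notin> A \<Longrightarrow> coord x n = 0" and big: "1 / 4 * (norm x)\<^sup>2 < Re (cinner (T x) x)"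
    using A unfolding quarter_bounded_def by (meson not_le)
  have "x \<noteq> 0"
  proof
    assume "x = 0"
    then have "cinner (T x) x = 0" by (simp add: cinner.rep_eq)
    then show False using big \<open>x = 0\<close> by simp
  qed
  then have n0: "0 < norm x" by simp
  define y where "y = scaleC (of_real (1 / norm x)) x"
  have "norm y = 1" using n0 by (simp add: y_def norm_scaleC norm_divide)
  moreover have "coord y n = 0" if "n \<notin> A" for n using x[OF that] by (simp add: y_def)
  moreover have "1 / 4 \<le> Re (cinner (T y) y)"
  proof -
    have "cinner (T y) y = of_real (1 / norm x) * (of_real (1 / norm x) * cinner (T x) x)"
      by (simp add: y_def bounded_operators_scaleC_apply[OF T] cinner_scaleC_left cinner_scaleC_right)
    then have eq: "Re (cinner (T y) y) = Re (cinner (T x) x) / (norm x)\<^sup>2"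
      by (simp add: power2_eq_square)
    have "0 < (norm x)\<^sup>2" using n0 by simp
    then show ?thesis unfolding eq using big by (simp only: pos_le_divide_eq)
  qed
  ultimately show ?thesis by blast
qed

section \<open>Two extensions of a pure state\<close>

text \<open>
  Vector states of a fixed operator are bounded, hence converge along an ultrafilter, and the
  conditions on a state are closed under limits.
\<close>

lemma ex_vector_limit_state:
  assumes V: "is_ultrafilter V" and unit: "eventually (\<lambda>x. norm x = 1) V"
  shows "\<exists>f. is_state bounded_operators f \<and>
    (\<forall>T\<in>bounded_operators. ((\<lambda>x. cinner (T x) x) \<longlongrightarrow> f T) V)"
proof -
  have nb: "V \<noteq> bot" using V by (simp add: is_ultrafilter_def)
  have "\<exists>l. ((\<lambda>x. cinner (T x) x) \<longlongrightarrow> l) V" if T: "T \<in> bounded_operators" for T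
  proof -
    obtain M where M: "0 < M" "\<And>x. norm (T x) \<le> M * norm x" using bounded_operators_bound[OF T] by blast
    have "eventually (\<lambda>x. cmod (cinner (T x) x) \<le> M) V"
      using unit
    proof (rule eventually_mono)
      fix x :: ell2 assume x: "norm x = 1"
      show "cmod (cinner (T x) x) \<le> M" using cmod_cinner_le[of "T x" x] M(2)[of x] x by simp
    qed
    then show ?thesis by (rule ultrafilter_tendsto[OF V])
  qed
  then have "\<exists>f. \<forall>T\<in>bounded_operators. ((\<lambda>x. cinner (T x) x) \<longlongrightarrow> f T) V" by (intro bchoice ballI)
  then obtain f where f: "\<And>T. T \<in> bounded_operators \<Longrightarrow> ((\<lambda>x. cinner (T x) x) \<longlongrightarrow> f T) V" by blast
  have "is_state bounded_operators f"
    unfolding is_state_def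
  proof (intro conjI ballI allI impI)
    fix S T assume S: "S \<in> bounded_operators" and T: "T \<in> bounded_operators"
    have "((\<lambda>x. cinner (S x + T x) x) \<longlongrightarrow> f S + f T) V"
      unfolding cinner_add_left by (intro tendsto_add f S T)
    then show "f (\<lambda>x. S x + T x) = f S + f T"
      using tendsto_unique[OF nb f[OF bounded_operators_add[OF S T]]] by blast
  next
    fix c T assume T: "T \<in> bounded_operators"
    have "((\<lambda>x. cinner (scaleC c (T x)) x) \<longlongrightarrow> c * f T) V"
      unfolding cinner_scaleC_left by (intro tendsto_mult tendsto_const f T)
    then show "f (\<lambda>x. scaleC c (T x)) = c * f T"
      using tendsto_unique[OF nb f[OF bounded_operators_scaleC[OF T]]] by blast
  next
    have "((\<lambda>x. cinner x x) \<longlongrightarrow> 1) V"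
      by (rule tendsto_eventually, rule eventually_mono[OF unit]) (simp add: cinner_self_norm)
    then show "f (\<lambda>x. x) = 1" using tendsto_unique[OF nb f[OF bounded_operators_id]] by blast
  next
    fix T assume T: "T \<in> bounded_operators" and pos: "positive_operator T"
    have nn: "0 \<le> Re (cinner (T x) x)" "Im (cinner (T x) x) = 0" for x
      using pos by (simp_all add: positive_operator_def less_eq_complex_def)
    have "((\<lambda>x. Re (cinner (T x) x)) \<longlongrightarrow> Re (f T)) V" "((\<lambda>x. Im (cinner (T x) x)) \<longlongrightarrow> Im (f T)) V"
      by (intro tendsto_Re tendsto_Im f T)+
    then have "0 \<le> Re (f T)" "Im (f T) = 0"
      using tendsto_lowerbound[OF _ _ nb, of "\<lambda>x. Re (cinner (T x) x)" "Re (f T)" 0] tendsto_unique[OF nb, of "\<lambda>x. 0"]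
      by (simp_all add: nn tendsto_const_iff[OF nb])
    then show "0 \<le> f T" by (simp add: less_eq_complex_def)
  qed
  then show ?thesis using f by blast
qed

text \<open>
  The ultrafilter \<open>U\<close> on coordinates contains no set on which \<open>T\<close> is bounded by \<open>1/4\<close>, so each of its
  sets \<open>A\<close> carries a unit vector in \<open>W A\<close>. The state \<open>g\<close> is the limit of the diagonal entries along
  \<open>U\<close>, and \<open>f\<close> is a limit of vector states along an ultrafilter \<open>V\<close> on vectors that contains every \<open>W A\<close>.
  Both give a diagonal projection the value \<open>1\<close> if its set belongs to \<open>U\<close> and \<open>0\<close> otherwise, so they agree on all
  diagonal operators, but they differ on \<open>T\<close>.
\<close>

lemma pavable_projections_of_kadison_singer:
  assumes KS: kadison_singer
  shows "\<exists>r. pavable_projections (1 / 16) (1 / 2) r"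
proof (rule ccontr)
  assume neg: "\<nexists>r. pavable_projections (1 / 16) (1 / 2) r"
  define bad where "bad r m Q \<longleftrightarrow> orthogonal_projection m Q \<and> max_diag Q \<le> 1 / 16 \<and>
      \<not> (\<exists>A. is_partition m r A \<and> (\<forall>j\<in>{1..r}. opnorm_mat (diag_proj m (A j) * Q * diag_proj m (A j)) \<le> 1 / 2))"
    for r m Q
  have half: "(1 - 1 / 2 :: real) = 1 / 2" by simp
  have "\<exists>m Q. bad r m Q" for r
  proof -
    have "\<not> pavable_projections (1 / 16) (1 / 2) r" using neg by blast
    then show ?thesis unfolding pavable_projections_def half bad_def by blast
  qed
  then have "\<forall>r. \<exists>mQ. bad r (fst mQ) (snd mQ)" by simp
  from choice[OF this] obtain mQ where mQ: "\<forall>r. bad r (fst (mQ r)) (snd (mQ r))" ..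
  define n P where "n = (\<lambda>r. fst (mQ r))" and "P = (\<lambda>r. snd (mQ r))"
  have P: "orthogonal_projection (n r) (P r)" and small: "max_diag (P r) \<le> 1 / 16"
    and nonpavable: "\<not> (\<exists>A. is_partition (n r) r A \<and>
        (\<forall>j\<in>{1..r}. opnorm_mat (diag_proj (n r) (A j) * P r * diag_proj (n r) (A j)) \<le> 1 / 2))" for r
    using mQ[rule_format, of r] unfolding n_def P_def bad_def by blast+
  define T where "T = block_diag_op n P"
  have T: "T \<in> bounded_operators" unfolding T_def by (rule block_diag_op_bounded[OF P])
  note B = operator_system_bounded and D = operator_system_diagonal
  define F where "F = (INF A\<in>{A. quarter_bounded T A}. principal (- A))"
  have "F \<noteq> bot"
    unfolding F_def
  proof (rule INF_filter_not_bot)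
    fix X assume X: "X \<subseteq> {A. quarter_bounded T A}" "finite X"
    then have "\<Union>X \<noteq> UNIV"
      unfolding T_def by (intro not_finite_cover_by_quarter_bounded_sets[OF P nonpavable]) auto
    then have "(\<Inter>A\<in>X. - A) \<noteq> {}" by auto
    then show "(INF A\<in>X. principal (- A)) \<noteq> bot"
      by (simp only: INF_principal_finite[OF X(2)] principal_eq_bot_iff not_False_eq_True)
  qed
  then obtain U where UF: "U \<le> F" and U: "is_ultrafilter U" using ex_ultrafilter_le by blast
  have Unb: "U \<noteq> bot" using U by (simp add: is_ultrafilter_def)
  have Uq: "\<not> quarter_bounded T A" if A: "eventually (\<lambda>p. p \<in> A) U" for A
  proof
    assume "quarter_bounded T A"
    then have "F \<le> principal (- A)" unfolding F_def by (intro INF_lower) simp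
    then have "eventually (\<lambda>p. p \<in> - A) U"
      using UF by (meson eventually_principal filter_leD order_refl)
    with A have "eventually (\<lambda>p. False) U" by eventually_elim simp
    then show False using Unb by (simp add: trivial_limit_def)
  qed
  have Ucompl: "eventually (\<lambda>p. p \<in> A) U \<or> eventually (\<lambda>p. p \<in> - A) U" for A
    using U unfolding is_ultrafilter_def by simp
  have ultra_ket: "is_ultrafilter (filtermap ket U)"
    using U unfolding is_ultrafilter_def by (simp add: filtermap_bot_iff eventually_filtermap)
  obtain g where g: "is_state bounded_operators g"
    and glim: "\<And>S. S \<in> bounded_operators \<Longrightarrow> ((\<lambda>p. cinner (S (ket p)) (ket p)) \<longlongrightarrow> g S) U"
    using ex_vector_limit_state[OF ultra_ket] by (auto simp: eventually_filtermap filterlim_filtermap)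
  define W where "W A = {x. norm x = 1 \<and> (\<forall>p. p \<notin> A \<longrightarrow> coord x p = 0) \<and> 1 / 4 \<le> Re (cinner (T x) x)}" for A
  define G where "G = (INF A\<in>{A. eventually (\<lambda>p. p \<in> A) U}. principal (W A))"
  have "G \<noteq> bot"
    unfolding G_def
  proof (rule INF_filter_not_bot)
    fix X assume X: "X \<subseteq> {A. eventually (\<lambda>p. p \<in> A) U}" "finite X"
    have "eventually (\<lambda>p. \<forall>A\<in>X. p \<in> A) U" using X by (intro eventually_ball_finite) auto
    then have "eventually (\<lambda>p. p \<in> \<Inter>X) U" by simp
    then obtain x where "x \<in> W (\<Inter>X)"
      using ex_unit_vector_of_not_quarter_bounded[OF T Uq] unfolding W_def by blast
    then have "x \<in> (\<Inter>A\<in>X. W A)" unfolding W_def by blast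
    then have "(\<Inter>A\<in>X. W A) \<noteq> {}" by blast
    then show "(INF A\<in>X. principal (W A)) \<noteq> bot"
      by (simp only: INF_principal_finite[OF X(2)] principal_eq_bot_iff not_False_eq_True)
  qed
  then obtain V where VG: "V \<le> G" and V: "is_ultrafilter V" using ex_ultrafilter_le by blast
  have Vnb: "V \<noteq> bot" using V by (simp add: is_ultrafilter_def)
  have VW: "eventually (\<lambda>x. x \<in> W A) V" if "eventually (\<lambda>p. p \<in> A) U" for A
  proof -
    have "G \<le> principal (W A)" unfolding G_def using that by (intro INF_lower) simp
    then show ?thesis using VG by (meson eventually_principal filter_leD order_refl)
  qed
  have Vunit: "eventually (\<lambda>x. norm x = 1) V" and Vbig: "eventually (\<lambda>x. 1 / 4 \<le> Re (cinner (T x) x)) V"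
    using VW[of UNIV] by (auto simp: W_def elim!: eventually_mono)
  obtain f where f: "is_state bounded_operators f"
    and flim: "\<And>S. S \<in> bounded_operators \<Longrightarrow> ((\<lambda>x. cinner (S x) x) \<longlongrightarrow> f S) V"
    using ex_vector_limit_state[OF V Vunit] by blast
  have pB: "proj A \<in> bounded_operators" for A by (rule diagonal_subset_bounded) simp
  have g1: "g (proj A) = 1" if "eventually (\<lambda>p. p \<in> A) U" for A
  proof -
    have "((\<lambda>p. cinner (proj A (ket p)) (ket p)) \<longlongrightarrow> 1) U"
      by (rule tendsto_eventually, rule eventually_mono[OF that]) (simp add: cinner_ket)
    then show ?thesis using tendsto_unique[OF Unb glim[OF pB]] by blast
  qed
  have f1: "f (proj A) = 1" if "eventually (\<lambda>p. p \<in> A) U" for A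
  proof -
    have "cinner (proj A x) x = 1" if x: "x \<in> W A" for x
    proof -
      have "proj A x = x" using x by (intro ell2_eqI) (auto simp: W_def indicator_def)
      then show ?thesis using x by (simp add: cinner_self_norm W_def)
    qed
    then have "((\<lambda>x. cinner (proj A x) x) \<longlongrightarrow> 1) V"
      by (intro tendsto_eventually eventually_mono[OF VW[OF that]])
    then show ?thesis using tendsto_unique[OF Vnb flim[OF pB]] by blast
  qed
  have fg: "f (proj A) = g (proj A) \<and> (g (proj A) = 0 \<or> g (proj A) = 1)" for A
  proof (cases "eventually (\<lambda>p. p \<in> A) U")
    case True
    then show ?thesis by (simp add: f1 g1)
  next
    case False
    then have c: "eventually (\<lambda>p. p \<in> - A) U" using Ucompl by blast
    then show ?thesis using f1[OF c] g1[OF c] by (simp add: state_compl[OF B f] state_compl[OF B g])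
  qed
  have "is_state diagonal_operators g"
    by (rule is_state_subset[OF g]) (use diagonal_subset_bounded in blast)
  then have "is_pure_state diagonal_operators g"
    using fg by (intro pure_state_diagonal_of_zero_one) blast+
  from KS[unfolded kadison_singer_def, rule_format, OF this]
  obtain k where k: "\<forall>h. is_state bounded_operators h \<and> (\<forall>S\<in>diagonal_operators. h S = g S) \<longrightarrow>
      (\<forall>S\<in>bounded_operators. h S = k S)"
    by (elim exE conjE)
  have "\<forall>S\<in>diagonal_operators. f S = g S"
    using states_eq_on_diagonal[OF B f B g] fg by blast
  then have "f T = k T" using k f T by simp
  moreover have "g T = k T" using k g T by simp
  moreover have "1 / 4 \<le> Re (f T)"
    by (rule tendsto_lowerbound[OF tendsto_Re[OF flim[OF T]] Vbig Vnb])
  moreover have "cmod (g T) \<le> 1 / 16"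
  proof (rule tendsto_upperbound[OF tendsto_norm[OF glim[OF T]] _ Unb])
    show "eventually (\<lambda>p. cmod (cinner (T (ket p)) (ket p)) \<le> 1 / 16) U"
      unfolding cinner_ket T_def
      by (intro always_eventually allI cmod_diagonal_block_diag_op_le[OF P small]) simp
  qed
  ultimately show False using complex_Re_le_cmod[of "g T"] by simp
qed

section \<open>The equivalence\<close>

theorem theorem3p11:
  shows "kadison_singer \<longleftrightarrow>
    (\<exists>(\<delta>::real) (\<epsilon>::real) (r::nat). 0 < \<delta> \<and> sqrt \<delta> \<le> \<epsilon> \<and> \<epsilon> < 1 \<and>
      (\<forall>n\<ge>1. \<forall>P. orthogonal_projection n P \<and> max_diag P \<le> \<delta> \<and>
        (\<forall>i<n. \<forall>j<n. l2norm_vec (P *\<^sub>v unit_vec n i) = l2norm_vec (P *\<^sub>v unit_vec n j)) \<longrightarrow>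
        (\<exists>A. is_partition n r A \<and>
          (\<forall>j\<in>{1..r}. opnorm_mat (diag_proj n (A j) * P * diag_proj n (A j)) \<le> 1 - \<epsilon>))))"
  unfolding pavable_projections_def[symmetric]
proof
  assume kadison_singer
  then obtain r where r: "pavable_projections (1 / 16) (1 / 2) r"
    using pavable_projections_of_kadison_singer by blast
  have "sqrt (1 / 16) = (1 / 4 :: real)" by (rule real_sqrt_unique) (simp_all add: power2_eq_square)
  then have "0 < (1 / 16 :: real) \<and> sqrt (1 / 16) \<le> (1 / 2 :: real) \<and> 1 / 2 < (1 :: real)" by simp
  with r show "\<exists>\<delta> \<epsilon> r. 0 < \<delta> \<and> sqrt \<delta> \<le> \<epsilon> \<and> \<epsilon> < 1 \<and> pavable_projections \<delta> \<epsilon> r" by blast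
next
  assume "\<exists>\<delta> \<epsilon> r. 0 < \<delta> \<and> sqrt \<delta> \<le> \<epsilon> \<and> \<epsilon> < 1 \<and> pavable_projections \<delta> \<epsilon> r"
  then obtain \<delta> \<epsilon> r where *: "0 < \<delta>" "sqrt \<delta> \<le> \<epsilon>" "\<epsilon> < 1" "pavable_projections \<delta> \<epsilon> r" by blast
  have "0 < \<epsilon>" using *(1,2) real_sqrt_gt_zero[of \<delta>] by linarith
  then obtain d q r where "0 < d" "0 < q" "q < 1" "bessel_paving d q r"
    using bessel_paving_of_pavable_projections[OF *(4,1) _ *(3)] by blast
  then show kadison_singer by (intro kadison_singer_of_bessel_paving)
qed

end
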